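(* Let $(M,h)$ be a Riemannian manifold of dimension $n\ge 2$. Assume that $N$ is an integer with $1\le N\le\frac n2$ if $n$ is even, and $N\ge1$ if $n$ is odd. Then the identities $$\lambda N\sum_{j=0}^N \mathcal T_{2j}^*(\lambda)(v_{2N-2j}) + (\lambda-n+2N)\sum_{j=0}^N j\,\mathcal T_{2j}^*(\lambda)(v_{2N-2j}) = 0$$ hold true as identities of rational functions in $\lambda$ (with values in $C^\infty(M)$). Here $v_{2j}$ are the holographic coefficients of $h$ and $\mathcal T_{2j}^*(\lambda)$ is the formal adjoint of the operator $\mathcal T_{2j}(\lambda)=\mathcal T_{2j}(h;\lambda)$.
   Context: Poincaré-Einstein metric. On $M\times(0,\varepsilon)$ consider $g_+=r^{-2}(dr^2+h_r)$, where $h_r$ is a one-parameter family of metrics on $M$ with $h_0=h$. For odd $n$, $h_r=h+r^2h_{(2)}+r^4h_{(4)}+\cdots$ is the unique formal even power series for which $\mathrm{Ric}(g_+)+n g_+=0$ to all orders in $r$. For even $n$, $h_r=h+r^2h_{(2)}+\dots+r^{n-2}h_{(n-2)}+r^n(h_{(n)}+\log r\,\bar h_{(n)})+\cdots$ is such that $\mathrm{Ric}(g_+)+n g_+=O(r^{n-2})$ and the restriction to $TM$ of $r^{2-n}(\mathrm{Ric}(g_+)+n g_+)$ at $r=0$ has vanishing trace with respect to $h$. These conditions determine $h_{(2)},\dots,h_{(n-2)}$ and $\mathrm{tr}_h(h_{(n)})$ uniquely in terms of $h$, and $\mathrm{tr}_h(\bar h_{(n)})=0$; the quantities below depend only on these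 data. Holographic coefficients. Write $v(r)=\mathrm{dvol}(h_r)/\mathrm{dvol}(h)=1+v_2r^2+v_4r^4+\cdots$ and $v_0=1$. The functions $v_{2j}\in C^\infty(M)$ are determined by $h$ for all $j$ with $2j\le n$ if $n$ is even, and for all $j\ge 0$ if $n$ is odd. Operators $\mathcal T_{2j}(\lambda)$. All Laplacians $\Delta$ are non-positive. For $f\in C^\infty(M)$ and generic $\lambda\in\mathbb C$, there are unique coefficients $\mathcal T_{2j}(\lambda)f$ with $\mathcal T_0(\lambda)=\mathrm{Id}$ such that $u=\sum_{j} r^{\lambda+2j}\,\mathcal T_{2j}(\lambda)f$ solves $-\Delta_{g_+}u=\lambda(n-\lambda)u$ asymptotically: formally to all orders in $r$ if $n$ is odd (sum over all $j\ge0$), and with $\Delta_{g_+}u+\lambda(n-\lambda)u=O(r^{\lambda+n+1})$ if $n$ is even (sum over $0\le j\le n/2$). The $\mathcal T_{2j}(\lambda)=\mathcal T_{2j}(h;\lambda)$ are differential operators on $M$, rational in $\lambda$, with poles contained in $\{\frac n2-1,\dots,\frac n2-j\}$. The formal adjoint $\mathcal T_{2j}^*(\lambda)$ is taken with respect to $\mathrm{dvol}(h)$ and the bilinear pairing: $\int_M \mathcal T_{2j}(\lambda)(f)\,g\,\mathrm{dvol}(h)=\int_M f\,\mathcal T_{2j}^*(\lambda)(g)\,\mathrm{dvol}(h)$ for compactly supported $f$. *)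

theory Defs
  imports "HOL-Analysis.Analysis" "HOL-Library.Landau_Symbols"
begin

section \<open>Smooth functions on open subsets of coordinate space\<close>

definition pderiv_at :: "'m::finite \<Rightarrow> (real^'m \<Rightarrow> 'b::real_normed_vector) \<Rightarrow> real^'m \<Rightarrow> 'b" where
  "pderiv_at i f x = frechet_derivative f (at x) (axis i 1)"

primrec iter_pderiv :: "'m::finite list \<Rightarrow> (real^'m \<Rightarrow> 'b::real_normed_vector) \<Rightarrow> real^'m \<Rightarrow> 'b" where
  "iter_pderiv [] f = f"
| "iter_pderiv (i # is) f = pderiv_at i (iter_pderiv is f)"

text \<open>Only meaningful for open \<open>S\<close>; all uses below are on open sets.\<close>

definition smooth_on :: "(real^'m::finite) set \<Rightarrow> (real^'m \<Rightarrow> 'b::real_normed_vector) \<Rightarrow> bool" where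
  "smooth_on S f \<longleftrightarrow> (\<forall>is. iter_pderiv is f differentiable_on S)"


section \<open>Smooth manifolds\<close>

text \<open>
  The manifold is the whole type \<open>'a\<close>. A chart is a pair of a domain and a coordinate map,
  whose values outside the domain are irrelevant.
\<close>

type_synonym ('a, 'n) chart = "'a set \<times> ('a \<Rightarrow> real^'n)"

abbreviation dom_of :: "('a, 'n) chart \<Rightarrow> 'a set" where "dom_of c \<equiv> fst c"
abbreviation coord :: "('a, 'n) chart \<Rightarrow> 'a \<Rightarrow> real^'n" where "coord c \<equiv> snd c"

definition param :: "('a, 'n::finite) chart \<Rightarrow> real^'n \<Rightarrow> 'a" where
  "param c = inv_into (dom_of c) (coord c)"

definition img :: "('a, 'n::finite) chart \<Rightarrow> (real^'n) set" where
  "img c = coord c ` dom_of c"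

definition smooth_atlas ::
    "('a::{t2_space,second_countable_topology}, 'n::finite) chart set \<Rightarrow> bool" where
  "smooth_atlas A \<longleftrightarrow>
     (\<Union>c\<in>A. dom_of c) = UNIV \<and>
     (\<forall>c\<in>A. open (dom_of c) \<and> open (img c) \<and> inj_on (coord c) (dom_of c) \<and>
        homeomorphism (dom_of c) (img c) (coord c) (param c)) \<and>
     (\<forall>c\<in>A. \<forall>c'\<in>A. smooth_on (coord c ` (dom_of c \<inter> dom_of c')) (coord c' \<circ> param c))"

definition smooth_fun :: "('a, 'n::finite) chart set \<Rightarrow> ('a \<Rightarrow> 'b::real_normed_vector) \<Rightarrow> bool" where
  "smooth_fun A f \<longleftrightarrow> (\<forall>c\<in>A. smooth_on (img c) (f \<circ> param c))"

definition compactly_supported :: "('a::topological_space \<Rightarrow> 'b::zero) \<Rightarrow> bool" where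
  "compactly_supported f \<longleftrightarrow> compact (closure {x. f x \<noteq> 0})"

text \<open>A symmetric 2-tensor is given by its component matrix in every chart.\<close>

type_synonym ('a, 'n) tensor2 = "('a, 'n) chart \<Rightarrow> real^'n \<Rightarrow> real^'n^'n"

definition sym_tensor :: "('a, 'n::finite) chart set \<Rightarrow> ('a, 'n) tensor2 \<Rightarrow> bool" where
  "sym_tensor A k \<longleftrightarrow>
     (\<forall>c\<in>A. smooth_on (img c) (k c) \<and> (\<forall>x\<in>img c. transpose (k c x) = k c x)) \<and>
     (\<forall>c\<in>A. \<forall>c'\<in>A. \<forall>x \<in> coord c ` (dom_of c \<inter> dom_of c').
        let \<tau> = coord c' \<circ> param c; J = matrix (frechet_derivative \<tau> (at x))
        in k c x = transpose J ** k c' (\<tau> x) ** J)"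

definition riemannian_metric :: "('a, 'n::finite) chart set \<Rightarrow> ('a, 'n) tensor2 \<Rightarrow> bool" where
  "riemannian_metric A h \<longleftrightarrow> sym_tensor A h \<and>
     (\<forall>c\<in>A. \<forall>x\<in>img c. \<forall>\<xi>. \<xi> \<noteq> 0 \<longrightarrow> \<xi> \<bullet> (h c x *v \<xi>) > 0)"

text \<open>This determines \<open>\<mu>\<close> uniquely, as countably many charts cover the manifold.\<close>

definition riemannian_volume ::
    "('a::topological_space, 'n::finite) chart set \<Rightarrow> ('a, 'n) tensor2 \<Rightarrow> 'a measure \<Rightarrow> bool" where
  "riemannian_volume A h \<mu> \<longleftrightarrow> sets \<mu> = sets borel \<and>
     (\<forall>c\<in>A. \<forall>B\<in>sets borel. B \<subseteq> dom_of c \<longrightarrow>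
        emeasure \<mu> B =
          (\<integral>\<^sup>+x. ennreal (sqrt (det (h c x))) * indicator (coord c ` B) x \<partial>lborel))"

definition diff_operator ::
    "('a, 'n::finite) chart set \<Rightarrow> (('a \<Rightarrow> complex) \<Rightarrow> ('a \<Rightarrow> complex)) \<Rightarrow> bool" where
  "diff_operator A P \<longleftrightarrow> (\<exists>m. \<forall>c\<in>A. \<exists>a :: 'n list \<Rightarrow> real^'n \<Rightarrow> complex.
     (\<forall>is. smooth_on (img c) (a is)) \<and>
     (\<forall>f. smooth_fun A f \<longrightarrow> (\<forall>x\<in>img c.
        P f (param c x) = (\<Sum>is | length is \<le> m. a is x * iter_pderiv is (f \<circ> param c) x))))"

definition formal_adjoint ::
    "('a::topological_space, 'n::finite) chart set \<Rightarrow> 'a measure \<Rightarrow>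
     (('a \<Rightarrow> complex) \<Rightarrow> ('a \<Rightarrow> complex)) \<Rightarrow> (('a \<Rightarrow> complex) \<Rightarrow> ('a \<Rightarrow> complex)) \<Rightarrow> bool" where
  "formal_adjoint A \<mu> P Q \<longleftrightarrow>
     (\<forall>g. smooth_fun A g \<longrightarrow> smooth_fun A (Q g) \<and>
        (\<forall>f. smooth_fun A f \<and> compactly_supported f \<longrightarrow>
           (\<integral>x. P f x * g x \<partial>\<mu>) = (\<integral>x. f x * Q g x \<partial>\<mu>)))"


section \<open>Ricci tensor and Laplacian in coordinates\<close>

definition christoffel ::
    "(real^'m::finite \<Rightarrow> real^'m^'m) \<Rightarrow> 'm \<Rightarrow> 'm \<Rightarrow> 'm \<Rightarrow> real^'m \<Rightarrow> real" where
  "christoffel g k i j y = (1/2) * (\<Sum>l\<in>UNIV. matrix_inv (g y) $ k $ l *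
     (pderiv_at i (\<lambda>z. g z $ j $ l) y + pderiv_at j (\<lambda>z. g z $ i $ l) y
        - pderiv_at l (\<lambda>z. g z $ i $ j) y))"

text \<open>Sign convention: the Ricci tensor of the round sphere is positive.\<close>

definition ricci :: "(real^'m::finite \<Rightarrow> real^'m^'m) \<Rightarrow> real^'m \<Rightarrow> real^'m^'m" where
  "ricci g y = (\<chi> i j.
     (\<Sum>k\<in>UNIV. pderiv_at k (christoffel g k i j) y - pderiv_at j (christoffel g k i k) y
       + (\<Sum>l\<in>UNIV. christoffel g k k l y * christoffel g l i j y
                  - christoffel g k j l y * christoffel g l i k y)))"

text \<open>The non-positive Laplacian \<open>div grad\<close>, acting on complex-valued functions.\<close>

definition laplacian :: "(real^'m::finite \<Rightarrow> real^'m^'m) \<Rightarrow> (real^'m \<Rightarrow> complex) \<Rightarrow> real^'m \<Rightarrow> complex" where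
  "laplacian g u y = (1 / sqrt (det (g y))) *\<^sub>R
     (\<Sum>a\<in>UNIV. \<Sum>b\<in>UNIV.
        pderiv_at a (\<lambda>z. (sqrt (det (g z)) * matrix_inv (g z) $ a $ b) *\<^sub>R pderiv_at b u z) y)"


section \<open>Poincare-Einstein metrics\<close>

text \<open>
  Coordinates on the cylinder \<open>M \<times> (0,\<epsilon>)\<close> are indexed by \<open>'n option\<close>:
  \<open>Some i\<close> are the coordinates on \<open>M\<close>, and \<open>None\<close> is the coordinate \<open>r\<close>.
\<close>

definition cyl_point :: "real^'n::finite \<Rightarrow> real \<Rightarrow> real^('n option)" where
  "cyl_point x r = (\<chi> a. case a of None \<Rightarrow> r | Some i \<Rightarrow> x $ i)"

definition cyl_base :: "real^('n::finite option) \<Rightarrow> real^'n" where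
  "cyl_base y = (\<chi> i. y $ Some i)"

text \<open>The metric \<open>g\<^sub>+ = r\<^sup>-\<^sup>2 (dr\<^sup>2 + H\<^sub>r)\<close>, for a one-parameter family \<open>H r x\<close>.\<close>

definition g_plus ::
    "(real \<Rightarrow> real^'n::finite \<Rightarrow> real^'n^'n) \<Rightarrow> real^('n option) \<Rightarrow> real^('n option)^('n option)" where
  "g_plus H y = (\<chi> a b.
     (case (a, b) of
        (None, None) \<Rightarrow> 1
      | (Some i, Some j) \<Rightarrow> H (y $ None) (cyl_base y) $ i $ j
      | _ \<Rightarrow> 0) / (y $ None)^2)"

text \<open>
  The expansion of \<open>h\<^sub>r\<close> truncated after \<open>r\<^sup>2\<^sup>K\<close>. The coefficients \<open>hk j\<close> stand for \<open>h\<^sub>(\<^sub>2\<^sub>j\<^sub>)\<close>,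
  and \<open>hlog\<close> for the coefficient of \<open>r\<^sup>n log r\<close>, which is present only for even \<open>n\<close>.
  For even \<open>n\<close> this is used with \<open>K = n/2\<close> only; the further terms of the expansion play no role.
  For odd \<open>n\<close> the series is formal, i.e. need not converge, and a statement ``formally to all
  orders'' means that, for each order \<open>m\<close>, all sufficiently long truncations satisfy
  it up to \<open>O(r\<^sup>m)\<close>. For fixed \<open>x\<close> and small \<open>r > 0\<close> the truncations are positive definite.
\<close>

definition h_trunc ::
    "(nat \<Rightarrow> ('a, 'n::finite) tensor2) \<Rightarrow> ('a, 'n) tensor2 \<Rightarrow> nat \<Rightarrow> ('a, 'n) chart \<Rightarrow>
     real \<Rightarrow> real^'n \<Rightarrow> real^'n^'n" where
  "h_trunc hk hlog K c r x = (\<Sum>j\<le>K. r^(2*j) *\<^sub>R hk j c x) +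
     (if even CARD('n) then (r^CARD('n) * ln r) *\<^sub>R hlog c x else 0)"

definition truncations :: "nat \<Rightarrow> nat filter" where
  "truncations n = (if even n then principal {n div 2} else sequentially)"

text \<open>The indices \<open>j\<close> for which the objects with index \<open>2j\<close> are determined by \<open>h\<close>.\<close>

definition admissible :: "nat \<Rightarrow> nat \<Rightarrow> bool" where
  "admissible n j \<longleftrightarrow> (even n \<longrightarrow> 2 * j \<le> n)"

definition einstein_defect ::
    "(real \<Rightarrow> real^'n::finite \<Rightarrow> real^'n^'n) \<Rightarrow> real^'n \<Rightarrow> real \<Rightarrow> real^('n option)^('n option)" where
  "einstein_defect H x r =
     ricci (g_plus H) (cyl_point x r) + real CARD('n) *\<^sub>R g_plus H (cyl_point x r)"

definition poincare_einstein ::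
    "('a, 'n::finite) chart set \<Rightarrow> ('a, 'n) tensor2 \<Rightarrow>
     (nat \<Rightarrow> ('a, 'n) tensor2) \<Rightarrow> ('a, 'n) tensor2 \<Rightarrow> bool" where
  "poincare_einstein A h hk hlog \<longleftrightarrow>
     (\<forall>c\<in>A. \<forall>x\<in>img c. hk 0 c x = h c x) \<and>
     (\<forall>j. admissible CARD('n) j \<longrightarrow> sym_tensor A (hk j)) \<and>
     (odd CARD('n) \<longrightarrow>
        (\<forall>c\<in>A. \<forall>x\<in>img c. \<forall>a b. \<forall>m. \<forall>\<^sub>F K in sequentially.
           (\<lambda>r. einstein_defect (h_trunc hk hlog K c) x r $ a $ b) \<in> O[at_right 0](\<lambda>r. r^m))) \<and>
     (even CARD('n) \<longrightarrow>
        sym_tensor A hlog \<and>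
        (\<forall>c\<in>A. \<forall>x\<in>img c.
           let E = einstein_defect (h_trunc hk hlog (CARD('n) div 2) c) x in
           (\<forall>a b. (\<lambda>r. E r $ a $ b) \<in> O[at_right 0](\<lambda>r. r^(CARD('n) - 2))) \<and>
           ((\<lambda>r. \<Sum>i\<in>UNIV. \<Sum>j\<in>UNIV.
               matrix_inv (h c x) $ i $ j * (E r $ Some i $ Some j / r^(CARD('n) - 2)))
             \<longlongrightarrow> 0) (at_right 0)))"

text \<open>\<open>v j\<close> stands for \<open>v\<^sub>2\<^sub>j\<close>, and \<open>v\<close> is the expansion of \<open>dvol(h\<^sub>r)/dvol(h)\<close>.\<close>

definition holographic_coeffs ::
    "('a, 'n::finite) chart set \<Rightarrow> ('a, 'n) tensor2 \<Rightarrow>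
     (nat \<Rightarrow> ('a, 'n) tensor2) \<Rightarrow> ('a, 'n) tensor2 \<Rightarrow> (nat \<Rightarrow> 'a \<Rightarrow> real) \<Rightarrow> bool" where
  "holographic_coeffs A h hk hlog v \<longleftrightarrow>
     (\<forall>j. admissible CARD('n) j \<longrightarrow> smooth_fun A (v j)) \<and>
     (\<forall>J. admissible CARD('n) J \<longrightarrow>
        (\<forall>c\<in>A. \<forall>x\<in>img c. \<forall>\<^sub>F K in truncations CARD('n).
           (\<lambda>r. sqrt (det (h_trunc hk hlog K c r x)) / sqrt (det (h c x))
                - (\<Sum>j\<le>J. v j (param c x) * r^(2*j))) \<in> o[at_right 0](\<lambda>r. r^(2*J))))"


section \<open>The solution operators\<close>

definition poles :: "nat \<Rightarrow> nat \<Rightarrow> complex set" where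
  "poles n j = {of_nat n / 2 - of_nat i | i. 1 \<le> i \<and> i \<le> j}"

definition rational_diff_operator ::
    "('a, 'n::finite) chart set \<Rightarrow> complex set \<Rightarrow>
     (complex \<Rightarrow> ('a \<Rightarrow> complex) \<Rightarrow> ('a \<Rightarrow> complex)) \<Rightarrow> bool" where
  "rational_diff_operator A S P \<longleftrightarrow>
     (\<exists>(q :: complex poly) d B. q \<noteq> 0 \<and> (\<forall>z. poly q z = 0 \<longrightarrow> z \<in> S) \<and>
        (\<forall>k. diff_operator A (B k)) \<and>
        (\<forall>lam f x. lam \<notin> S \<and> smooth_fun A f \<longrightarrow>
           P lam f x = (\<Sum>k\<le>(d::nat). lam^k * B k f x) / poly q lam))"

text \<open>
  In the chart \<open>c\<close>, the function \<open>\<Sum>\<^sub>j\<^sub>\<le>\<^sub>K r\<^sup>\<lambda>\<^sup>+\<^sup>2\<^sup>j T\<^sub>2\<^sub>j(\<lambda>) f\<close>, where \<open>T j lam\<close> stands for \<open>T\<^sub>2\<^sub>j(\<lambda>)\<close>.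
\<close>

definition u_trunc ::
    "(nat \<Rightarrow> complex \<Rightarrow> ('a \<Rightarrow> complex) \<Rightarrow> ('a \<Rightarrow> complex)) \<Rightarrow> complex \<Rightarrow> ('a \<Rightarrow> complex) \<Rightarrow>
     nat \<Rightarrow> ('a, 'n::finite) chart \<Rightarrow> real^('n option) \<Rightarrow> complex" where
  "u_trunc T lam f K c y = (\<Sum>j\<le>K. complex_of_real (y $ None) powr (lam + 2 * of_nat j) *
     T j lam f (param c (cyl_base y)))"

definition eigen_defect ::
    "(nat \<Rightarrow> ('a, 'n::finite) tensor2) \<Rightarrow> ('a, 'n) tensor2 \<Rightarrow>
     (nat \<Rightarrow> complex \<Rightarrow> ('a \<Rightarrow> complex) \<Rightarrow> ('a \<Rightarrow> complex)) \<Rightarrow> complex \<Rightarrow> ('a \<Rightarrow> complex) \<Rightarrow>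
     nat \<Rightarrow> ('a, 'n) chart \<Rightarrow> real^'n \<Rightarrow> real \<Rightarrow> complex" where
  "eigen_defect hk hlog T lam f K c x r =
     laplacian (g_plus (h_trunc hk hlog K c)) (u_trunc T lam f K c) (cyl_point x r)
     + lam * (of_nat CARD('n) - lam) * u_trunc T lam f K c (cyl_point x r)"

text \<open>
  The eigenfunction equation is required for \<open>lam\<close> outside the union of all pole sets; rationality in
  \<open>lam\<close> then determines \<open>T j lam\<close> for all \<open>lam\<close> outside \<open>poles n j\<close>. At points of \<open>poles n j\<close> the value
  of \<open>T j\<close> is arbitrary.
\<close>

definition solution_operators ::
    "('a, 'n::finite) chart set \<Rightarrow> (nat \<Rightarrow> ('a, 'n) tensor2) \<Rightarrow> ('a, 'n) tensor2 \<Rightarrow>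
     (nat \<Rightarrow> complex \<Rightarrow> ('a \<Rightarrow> complex) \<Rightarrow> ('a \<Rightarrow> complex)) \<Rightarrow> bool" where
  "solution_operators A hk hlog T \<longleftrightarrow>
     (\<forall>lam f. smooth_fun A f \<longrightarrow> T 0 lam f = f) \<and>
     (\<forall>j. admissible CARD('n) j \<longrightarrow> rational_diff_operator A (poles CARD('n) j) (T j)) \<and>
     (\<forall>lam f. (\<forall>j. admissible CARD('n) j \<longrightarrow> lam \<notin> poles CARD('n) j) \<and> smooth_fun A f \<longrightarrow>
        (\<forall>c\<in>A. \<forall>x\<in>img c.
           (odd CARD('n) \<longrightarrow> (\<forall>m. \<forall>\<^sub>F K in sequentially.
              eigen_defect hk hlog T lam f K c x
                \<in> O[at_right 0](\<lambda>r. complex_of_real r powr (lam + of_nat m)))) \<and>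
           (even CARD('n) \<longrightarrow>
              eigen_defect hk hlog T lam f (CARD('n) div 2) c x
                \<in> O[at_right 0](\<lambda>r. complex_of_real r powr (lam + of_nat CARD('n) + 1)))))"

end

theory Submission
  imports Defs "HOL-Computational_Algebra.Formal_Power_Series" "HOL-Real_Asymp.Real_Asymp"
begin

text \<open>Why the identity holds. Let \<open>u\<close> be the formal solution \<open>\<Sum>j. r\<^bsup>lam + 2j\<^esup> T\<^sub>2\<^sub>j(lam) f\<close>, for a test function \<open>f\<close>
with compact support. In the coordinates of the cylinder the eigenfunction equation, multiplied by
\<open>v(r) = dvol(h\<^sub>r)/dvol(h)\<close>, reads
\<open>r\<^bsup>n+1\<^esup> \<partial>\<^sub>r (r\<^bsup>1-n\<^esup> v \<partial>\<^sub>r u) + lam (n - lam) v u + r\<^sup>2 v \<Delta>\<^sub>r u = 0\<close>, where \<open>\<Delta>\<^sub>r\<close> is the Laplacian of \<open>h\<^sub>r\<close>.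
Since \<open>v \<Delta>\<^sub>r u\<close> is a divergence with respect to \<open>dvol(h)\<close>, it integrates to zero over \<open>M\<close>. In what is left
the coefficient of \<open>r\<^bsup>lam+2N\<^esup>\<close> is \<open>2 \<Sum>j. (lam N + j (lam - n + 2N)) \<integral> v\<^sub>2\<^sub>N\<^sub>-\<^sub>2\<^sub>j T\<^sub>2\<^sub>j(lam) f\<close>, because
\<open>(lam + 2N - n) (lam + 2j) + lam (n - lam) = 2 (lam N + j (lam - n + 2N))\<close>.
Moving \<open>T\<^sub>2\<^sub>j(lam)\<close> to the other factor and letting \<open>f\<close> vary gives the theorem.

How the argument is organised. The equation holds up to an error \<open>O(r\<^bsup>lam + k\<^esup>)\<close> that need not be
uniform in the point of \<open>M\<close>, so the coefficient of \<open>r\<^bsup>lam+2N\<^esup>\<close> is extracted at each point before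
integrating. What has to be known about it is that the part coming from \<open>\<Delta>\<^sub>r\<close> is the divergence of a
continuously differentiable vector field; this is the lemma \<open>divergence_identity\<close>. Its proof multiplies the
equation by the square of \<open>P = det h\<^sub>r\<close>: all coefficients are then polynomial in the entries of \<open>h\<^sub>r\<close>
and their first derivatives (\<open>laplacian_g_plus\<close>), hence have expansions that may be multiplied and
differentiated termwise (\<open>jet_expansion\<close>). The expansion of \<open>P\<close> is the square of the series
\<open>w = sqrt (det h) \<Sum>k. v\<^sub>2\<^sub>k r\<^bsup>2k\<^esup>\<close>, and dividing by \<open>w\<^sup>3\<close> in the ring of formal power series turns the
equation into divergence form.

For even \<open>n\<close> the family \<open>h\<^sub>r\<close> contains the term \<open>r\<^bsup>n\<^esup> log r\<close>. In the part coming from \<open>\<Delta>\<^sub>r\<close> it has order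
above \<open>r\<^bsup>n\<^esup>\<close>; in \<open>P\<close> it cannot appear, since \<open>P\<close> is asymptotic to \<open>w\<^sup>2\<close> (\<open>has_log_expansion_unique\<close>).

It is enough to test against functions supported in a single chart: the operators are local, so the
whole integral lives in that chart (\<open>chart_integral\<close>, \<open>integral_divergence_zero\<close>), and bump functions detect
every continuous function (\<open>vanishing_from_bumps\<close>). Finally, the eigenfunction equation is available only
off the poles of all the operators; the identity for the remaining \<open>lam\<close> follows by continuity, as the tested
identity is a rational function of \<open>lam\<close> (\<open>test_identity\<close>).\<close>

section \<open>Partial derivatives\<close>

lemma pderiv_at_eqI: "(f has_derivative f') (at x) \<Longrightarrow> pderiv_at i f x = f' (axis i 1)"
  unfolding pderiv_at_def by (drule frechet_derivative_at) simp

lemma differentiable_has_derivative_frechet: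
  "f differentiable (at x) \<Longrightarrow> (f has_derivative frechet_derivative f (at x)) (at x)"
  by (simp add: frechet_derivative_works)

lemma pderiv_at_const [simp]: "pderiv_at i (\<lambda>x. c) x = 0"
  by (rule pderiv_at_eqI[THEN trans]) (auto intro: has_derivative_const)

lemma pderiv_at_add:
  assumes "f differentiable (at x)" "g differentiable (at x)"
  shows "pderiv_at i (\<lambda>x. f x + g x) x = pderiv_at i f x + pderiv_at i g x"
  by (subst pderiv_at_eqI[OF has_derivative_add[OF assms[THEN differentiable_has_derivative_frechet]]])
     (simp add: pderiv_at_def)

lemma pderiv_at_mult:
  fixes f g :: "real^'m::finite \<Rightarrow> 'b::real_normed_algebra"
  assumes "f differentiable (at x)" "g differentiable (at x)"
  shows "pderiv_at i (\<lambda>x. f x * g x) x = f x * pderiv_at i g x + pderiv_at i f x * g x"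
  by (subst pderiv_at_eqI[OF has_derivative_mult[OF assms[THEN differentiable_has_derivative_frechet]]])
     (simp add: pderiv_at_def)

lemma pderiv_at_scaleR:
  assumes "f differentiable (at x)" "g differentiable (at x)"
  shows "pderiv_at i (\<lambda>x. f x *\<^sub>R g x) x = f x *\<^sub>R pderiv_at i g x + pderiv_at i f x *\<^sub>R g x"
  by (subst pderiv_at_eqI[OF has_derivative_scaleR[OF assms[THEN differentiable_has_derivative_frechet]]])
     (simp add: pderiv_at_def)

lemma pderiv_at_sum:
  assumes "\<And>k. k \<in> I \<Longrightarrow> f k differentiable (at x)"
  shows "pderiv_at i (\<lambda>x. \<Sum>k\<in>I. f k x) x = (\<Sum>k\<in>I. pderiv_at i (f k) x)"
  by (subst pderiv_at_eqI[OF has_derivative_sum[OF assms[THEN differentiable_has_derivative_frechet]]])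
     (auto simp: pderiv_at_def)

lemma pderiv_at_bounded_linear:
  assumes "bounded_linear L" "f differentiable (at x)"
  shows "pderiv_at i (\<lambda>x. L (f x)) x = L (pderiv_at i f x)"
  by (subst pderiv_at_eqI[OF bounded_linear.has_derivative[OF assms(1) assms(2)[THEN differentiable_has_derivative_frechet]]])
     (auto simp: pderiv_at_def)

lemma differentiable_bounded_linear:
  assumes "bounded_linear L" "f differentiable F"
  shows "(\<lambda>x. L (f x)) differentiable F"
  using bounded_linear.has_derivative[OF assms(1)] assms(2) unfolding differentiable_def by blast

lemma pderiv_at_compose_real:
  fixes q :: "real^'m::finite \<Rightarrow> real" and \<psi> :: "real \<Rightarrow> 'b::real_normed_vector"
  assumes "(\<psi> has_vector_derivative d) (at (q x))" "q differentiable (at x)"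
  shows "pderiv_at i (\<lambda>x. \<psi> (q x)) x = pderiv_at i q x *\<^sub>R d"
proof -
  have "((\<lambda>x. \<psi> (q x)) has_derivative (\<lambda>h. frechet_derivative q (at x) h *\<^sub>R d)) (at x)"
    using diff_chain_at[OF differentiable_has_derivative_frechet[OF assms(2)]
        assms(1)[unfolded has_vector_derivative_def]]
    by (simp add: o_def)
  from pderiv_at_eqI[OF this] show ?thesis by (simp add: pderiv_at_def)
qed

lemma differentiable_compose_real:
  fixes q :: "real^'m::finite \<Rightarrow> real" and \<psi> :: "real \<Rightarrow> 'b::real_normed_vector"
  assumes "(\<psi> has_vector_derivative d) (at (q x))" "q differentiable (at x)"
  shows "(\<lambda>x. \<psi> (q x)) differentiable (at x)"
  using diff_chain_at[OF differentiable_has_derivative_frechet[OF assms(2)]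
        assms(1)[unfolded has_vector_derivative_def]]
  by (auto simp: o_def differentiable_def)

lemma pderiv_at_cong:
  assumes "open S" "x \<in> S" "\<And>y. y \<in> S \<Longrightarrow> f y = g y"
  shows "pderiv_at i f x = pderiv_at i g x"
proof -
  have "(f has_derivative f') (at x) = (g has_derivative f') (at x)" for f'
    using has_derivative_transform_within_open[OF _ assms(1,2), of f f' UNIV g]
      has_derivative_transform_within_open[OF _ assms(1,2), of g f' UNIV f] assms(3) by auto
  then show ?thesis unfolding pderiv_at_def frechet_derivative_def by simp
qed

lemma differentiable_cong_open:
  assumes "open S" "x \<in> S" "\<And>y. y \<in> S \<Longrightarrow> f y = g y" "f differentiable (at x)"
  shows "g differentiable (at x)"
  using has_derivative_transform_within_open[OF _ assms(1,2), of f _ UNIV g] assms(3,4)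
  unfolding differentiable_def by blast

section \<open>Smooth functions\<close>

lemma differentiable_on_open_iff:
  assumes "open S"
  shows "f differentiable_on S \<longleftrightarrow> (\<forall>x\<in>S. f differentiable (at x))"
proof -
  have "f differentiable (at x within S) \<longleftrightarrow> f differentiable (at x)" if "x \<in> S" for x
    using at_within_open[OF that assms] by (rule arg_cong)
  then show ?thesis unfolding differentiable_on_def by (rule ball_cong[OF refl])
qed

lemma iter_pderiv_append: "iter_pderiv (is @ js) f = iter_pderiv is (iter_pderiv js f)"
  by (induction "is") auto

lemma smooth_on_differentiable: "smooth_on S f \<Longrightarrow> f differentiable_on S"
  unfolding smooth_on_def by (metis iter_pderiv.simps(1))

lemma smooth_on_differentiable_at:
  "open S \<Longrightarrow> smooth_on S f \<Longrightarrow> x \<in> S \<Longrightarrow> f differentiable (at x)"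
  using smooth_on_differentiable differentiable_on_open_iff by blast

lemma smooth_on_pderiv:
  assumes "smooth_on S f" shows "smooth_on S (pderiv_at i f)"
  unfolding smooth_on_def
proof
  fix "is"
  have "iter_pderiv (is @ [i]) f differentiable_on S" using assms by (simp add: smooth_on_def)
  then show "iter_pderiv is (pderiv_at i f) differentiable_on S" by (simp add: iter_pderiv_append)
qed

lemma smooth_on_iter_pderiv: "smooth_on S f \<Longrightarrow> smooth_on S (iter_pderiv is f)"
  by (induction "is") (auto intro: smooth_on_pderiv)

text \<open>Smoothness is the greatest property that implies differentiability and is inherited by partial derivatives.
It therefore suffices to exhibit a class closed under partial derivatives up to agreement on \<open>S\<close>; this
replaces the Leibniz and Faa di Bruno formulas for iterated derivatives.\<close>

lemma smooth_on_coinduct: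
  assumes S: "open S" and f: "f \<in> C"
    and diff: "\<And>f x. f \<in> C \<Longrightarrow> x \<in> S \<Longrightarrow> f differentiable (at x)"
    and closed: "\<And>f i. f \<in> C \<Longrightarrow> \<exists>g\<in>C. \<forall>x\<in>S. pderiv_at i f x = g x"
  shows "smooth_on S f"
proof -
  have *: "\<exists>g\<in>C. \<forall>x\<in>S. iter_pderiv is f x = g x" for "is"
  proof (induction "is")
    case Nil
    then show ?case using f by auto
  next
    case (Cons i "is")
    then obtain g where g: "g \<in> C" "\<And>x. x \<in> S \<Longrightarrow> iter_pderiv is f x = g x" by blast
    obtain k where k: "k \<in> C" "\<And>x. x \<in> S \<Longrightarrow> pderiv_at i g x = k x" using closed g(1) by blast
    have "iter_pderiv (i # is) f x = k x" if "x \<in> S" for x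
      using pderiv_at_cong[OF S that g(2)] k(2) that by simp
    then show ?case using k(1) by blast
  qed
  show ?thesis unfolding smooth_on_def differentiable_on_open_iff[OF S]
  proof (intro allI ballI)
    fix "is" x assume x: "x \<in> S"
    obtain g where g: "g \<in> C" "\<And>x. x \<in> S \<Longrightarrow> iter_pderiv is f x = g x" using * by blast
    show "iter_pderiv is f differentiable (at x)"
      using differentiable_cong_open[OF S x, of g] diff[OF g(1) x] g(2) by auto
  qed
qed

lemma smooth_on_cong:
  assumes "open S" "smooth_on S f" "\<And>x. x \<in> S \<Longrightarrow> g x = f x"
  shows "smooth_on S g"
proof (rule smooth_on_coinduct[OF assms(1), where C="{g. \<exists>f. smooth_on S f \<and> (\<forall>x\<in>S. g x = f x)}"])
  show "g \<in> {g. \<exists>f. smooth_on S f \<and> (\<forall>x\<in>S. g x = f x)}" using assms by auto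
next
  fix g x assume g: "g \<in> {g. \<exists>f. smooth_on S f \<and> (\<forall>x\<in>S. g x = f x)}" and x: "x \<in> S"
  then obtain f where f: "smooth_on S f" "\<forall>x\<in>S. g x = f x" by blast
  then show "g differentiable at x"
    using differentiable_cong_open[OF assms(1) x, of f g]
      smooth_on_differentiable[OF f(1)] x differentiable_on_open_iff[OF assms(1)] by auto
next
  fix g i assume "g \<in> {g. \<exists>f. smooth_on S f \<and> (\<forall>x\<in>S. g x = f x)}"
  then obtain f where f: "smooth_on S f" "\<And>x. x\<in>S \<Longrightarrow> g x = f x" by blast
  then show "\<exists>ga\<in>{g. \<exists>f. smooth_on S f \<and> (\<forall>x\<in>S. g x = f x)}. \<forall>x\<in>S. pderiv_at i g x = ga x"
    using smooth_on_pderiv[OF f(1), of i] pderiv_at_cong[OF assms(1) _ f(2)]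
    by (intro bexI[of _ "pderiv_at i f"]) auto
qed

text \<open>Products of two smooth functions, or compositions with one, are not closed under derivatives. Their sums of
products are.\<close>

inductive_set generated_alg :: "('x \<Rightarrow> 'b::real_normed_algebra) set \<Rightarrow> ('x \<Rightarrow> 'b) set"
  for G where
  gen: "f \<in> G \<Longrightarrow> f \<in> generated_alg G"
| add: "f \<in> generated_alg G \<Longrightarrow> g \<in> generated_alg G \<Longrightarrow> (\<lambda>x. f x + g x) \<in> generated_alg G"
| mult: "f \<in> generated_alg G \<Longrightarrow> g \<in> generated_alg G \<Longrightarrow> (\<lambda>x. f x * g x) \<in> generated_alg G"

text \<open>By the sum and product rules, closedness under derivatives has to be checked on generators only.\<close>

lemma smooth_on_generated_alg:
  fixes G :: "(real^'m::finite \<Rightarrow> 'b::real_normed_algebra) set"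
  assumes S: "open S" and f: "f \<in> generated_alg G"
    and diff: "\<And>f x. f \<in> G \<Longrightarrow> x \<in> S \<Longrightarrow> f differentiable (at x)"
    and closed: "\<And>f i. f \<in> G \<Longrightarrow> \<exists>g\<in>generated_alg G. \<forall>x\<in>S. pderiv_at i f x = g x"
  shows "smooth_on S f"
proof (rule smooth_on_coinduct[OF S f])
  show d: "f differentiable (at x)" if "f \<in> generated_alg G" "x \<in> S" for f x
    using that by (induction) (auto intro: diff)
  show "\<exists>g\<in>generated_alg G. \<forall>x\<in>S. pderiv_at i f x = g x" if "f \<in> generated_alg G" for f i
    using that
  proof induction
    case (gen f)
    then show ?case by (rule closed)
  next
    case (add f g)
    then obtain f' g' where "f' \<in> generated_alg G" "g' \<in> generated_alg G"
      "\<forall>x\<in>S. pderiv_at i f x = f' x" "\<forall>x\<in>S. pderiv_at i g x = g' x" by blast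
    then show ?case using add d
      by (intro bexI[of _ "\<lambda>x. f' x + g' x"]) (auto simp: pderiv_at_add intro: generated_alg.add)
  next
    case (mult f g)
    then obtain f' g' where "f' \<in> generated_alg G" "g' \<in> generated_alg G"
      "\<forall>x\<in>S. pderiv_at i f x = f' x" "\<forall>x\<in>S. pderiv_at i g x = g' x" by blast
    then show ?case using mult d
      by (intro bexI[of _ "\<lambda>x. f x * g' x + f' x * g x"])
         (auto simp: pderiv_at_mult intro!: generated_alg.add generated_alg.mult)
  qed
qed

lemma smooth_on_pderiv_eq:
  "smooth_on S f \<Longrightarrow> \<exists>g\<in>generated_alg {f. smooth_on S f}. \<forall>x\<in>S. pderiv_at i f x = g x"
  using smooth_on_pderiv by (blast intro: generated_alg.gen)

lemma smooth_on_add: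
  fixes f g :: "real^'m::finite \<Rightarrow> 'b::real_normed_algebra"
  assumes S: "open S" and "smooth_on S f" "smooth_on S g"
  shows "smooth_on S (\<lambda>x. f x + g x)"
proof (rule smooth_on_generated_alg[OF S, where G="{f. smooth_on S f}"])
  show "(\<lambda>x. f x + g x) \<in> generated_alg {f. smooth_on S f}"
    using assms(2,3) by (intro generated_alg.add) (auto intro: generated_alg.gen)
qed (auto intro: smooth_on_differentiable_at[OF S] smooth_on_pderiv_eq)

lemma smooth_on_mult:
  fixes f g :: "real^'m::finite \<Rightarrow> 'b::real_normed_algebra"
  assumes S: "open S" and "smooth_on S f" "smooth_on S g"
  shows "smooth_on S (\<lambda>x. f x * g x)"
proof (rule smooth_on_generated_alg[OF S, where G="{f. smooth_on S f}"])
  show "(\<lambda>x. f x * g x) \<in> generated_alg {f. smooth_on S f}"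
    using assms(2,3) by (intro generated_alg.mult) (auto intro: generated_alg.gen)
qed (auto intro: smooth_on_differentiable_at[OF S] smooth_on_pderiv_eq)

lemma smooth_on_const: "open S \<Longrightarrow> smooth_on S (\<lambda>x. c)"
  by (rule smooth_on_coinduct[where C="range (\<lambda>c x. c)"]) (auto intro: exI[of _ 0])

lemma smooth_on_sum:
  fixes f :: "'k \<Rightarrow> real^'m::finite \<Rightarrow> 'b::real_normed_algebra"
  assumes S: "open S" and "\<And>k. k \<in> I \<Longrightarrow> smooth_on S (f k)"
  shows "smooth_on S (\<lambda>x. \<Sum>k\<in>I. f k x)"
  using assms(2) by (induction I rule: infinite_finite_induct) (auto intro!: smooth_on_add smooth_on_const S)

lemma smooth_on_bounded_linear:
  assumes S: "open S" and f: "smooth_on S f" and L: "bounded_linear L"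
  shows "smooth_on S (\<lambda>x. L (f x))"
proof (rule smooth_on_coinduct[OF S, where C="{(\<lambda>x. L (f x)) |f. smooth_on S f}"])
  fix g x assume "g \<in> {(\<lambda>x. L (f x)) |f. smooth_on S f}" "x \<in> S"
  then show "g differentiable (at x)"
    using smooth_on_differentiable differentiable_on_open_iff[OF S]
    by (auto intro!: differentiable_bounded_linear[OF L])
next
  fix g i assume "g \<in> {(\<lambda>x. L (f x)) |f. smooth_on S f}"
  then obtain f where f: "g = (\<lambda>x. L (f x))" "smooth_on S f" by auto
  show "\<exists>g'\<in>{(\<lambda>x. L (f x)) |f. smooth_on S f}. \<forall>x\<in>S. pderiv_at i g x = g' x"
    using f smooth_on_pderiv[OF f(2), of i] smooth_on_differentiable_at[OF S f(2)]
    by (intro bexI[of _ "\<lambda>x. L (pderiv_at i f x)"]) (auto simp: pderiv_at_bounded_linear[OF L])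
qed (use f in auto)

lemma smooth_on_nth: "open S \<Longrightarrow> smooth_on S f \<Longrightarrow> smooth_on S (\<lambda>x. f x $ i)"
  by (rule smooth_on_bounded_linear[OF _ _ bounded_linear_vec_nth])

lemma smooth_on_of_real:
  "open S \<Longrightarrow> smooth_on S f \<Longrightarrow> smooth_on S (\<lambda>x. complex_of_real (f x))"
  by (rule smooth_on_bounded_linear[OF _ _ bounded_linear_of_real])

text \<open>Here \<open>\<psi> k\<close> is the \<open>k\<close>-th derivative of \<open>\<psi> 0\<close>. The algebra is generated by the smooth functions and
all \<open>\<psi> k \<circ> q\<close>, the derivative of \<open>\<psi> k \<circ> q\<close> being \<open>(\<psi> (k + 1) \<circ> q) \<partial>q\<close>.\<close>

lemma smooth_on_compose_real:
  fixes q :: "real^'m::finite \<Rightarrow> real"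
  assumes S: "open S" and q: "smooth_on S q"
    and \<psi>: "\<And>k t. (\<psi> k has_real_derivative \<psi> (Suc k) t) (at t)"
  shows "smooth_on S (\<lambda>x. \<psi> k (q x))"
proof -
  let ?G = "{f. smooth_on S f} \<union> range (\<lambda>k x. \<psi> k (q x))"
  have q': "q differentiable (at x)" if "x \<in> S" for x
    using that q S smooth_on_differentiable differentiable_on_open_iff by blast
  have \<psi>': "(\<psi> k has_vector_derivative \<psi> (Suc k) t) (at t)" for k t
    using \<psi> by (simp add: has_real_derivative_iff_has_vector_derivative)
  show ?thesis
  proof (rule smooth_on_generated_alg[OF S, where G="?G"])
    show "(\<lambda>x. \<psi> k (q x)) \<in> generated_alg ?G" by (auto intro!: generated_alg.gen)
  next
    fix f x assume "f \<in> ?G" "x \<in> S"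
    then show "f differentiable (at x)"
      using smooth_on_differentiable differentiable_on_open_iff[OF S]
      by (auto intro!: differentiable_compose_real[OF \<psi>'] q')
  next
    fix f i assume "f \<in> ?G"
    then consider "smooth_on S f" | k where "f = (\<lambda>x. \<psi> k (q x))" by auto
    then show "\<exists>g\<in>generated_alg ?G. \<forall>x\<in>S. pderiv_at i f x = g x"
    proof cases
      case 1
      then show ?thesis by (intro bexI[of _ "pderiv_at i f"]) (auto intro!: generated_alg.gen smooth_on_pderiv)
    next
      case 2
      have "(\<lambda>x. pderiv_at i q x * \<psi> (Suc k) (q x)) \<in> generated_alg ?G"
        by (intro generated_alg.mult generated_alg.gen) (auto intro: smooth_on_pderiv[OF q])
      then show ?thesis using 2 by (auto simp: pderiv_at_compose_real[OF \<psi>' q'] intro!: bexI)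
    qed
  qed
qed

section \<open>Continuously differentiable functions\<close>

text \<open>The coefficients of the expansions below are differentiated once and then integrated by parts, for which
this class suffices; its closure properties are proved directly from the derivative rules.\<close>

definition C1_on :: "(real^'m::finite) set \<Rightarrow> (real^'m \<Rightarrow> 'b::real_normed_vector) \<Rightarrow> bool" where
  "C1_on S f \<longleftrightarrow> (\<forall>x\<in>S. f differentiable (at x)) \<and> (\<forall>i. continuous_on S (pderiv_at i f))"

lemma C1_on_continuous: "C1_on S f \<Longrightarrow> continuous_on S f"
  by (auto simp: C1_on_def intro: differentiable_imp_continuous_within continuous_at_imp_continuous_on)

lemma C1_on_continuous_pderiv: "C1_on S f \<Longrightarrow> continuous_on S (pderiv_at i f)"
  by (auto simp: C1_on_def)

lemma smooth_on_imp_C1_on: "open S \<Longrightarrow> smooth_on S f \<Longrightarrow> C1_on S f"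
  unfolding C1_on_def
  using smooth_on_differentiable smooth_on_pderiv differentiable_on_open_iff
    differentiable_imp_continuous_on by blast

lemma C1_on_const [simp]: "C1_on S (\<lambda>x. c)"
proof -
  have "pderiv_at i (\<lambda>x. c) = (\<lambda>x. 0)" for i by (rule ext) simp
  then show ?thesis unfolding C1_on_def by simp
qed

lemma C1_onI:
  assumes "\<And>x. x \<in> S \<Longrightarrow> f differentiable (at x)"
    and "\<And>i. continuous_on S (D i)" "\<And>i x. x \<in> S \<Longrightarrow> pderiv_at i f x = D i x"
  shows "C1_on S f"
  unfolding C1_on_def
proof (intro conjI allI ballI)
  show "continuous_on S (pderiv_at i f)" for i
    using assms(2)[of i] by (rule continuous_on_eq) (simp add: assms(3))
qed (rule assms(1))

lemma C1_on_add:
  assumes "C1_on S f" "C1_on S g" shows "C1_on S (\<lambda>x. f x + g x)"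
  by (rule C1_onI[where D="\<lambda>i x. pderiv_at i f x + pderiv_at i g x"])
     (use assms in \<open>auto simp: C1_on_def pderiv_at_add intro!: continuous_on_add\<close>)

lemma C1_on_mult:
  fixes f g :: "real^'m::finite \<Rightarrow> 'b::real_normed_algebra"
  assumes "C1_on S f" "C1_on S g" shows "C1_on S (\<lambda>x. f x * g x)"
proof -
  have "continuous_on S f" "continuous_on S g" using assms by (auto intro: C1_on_continuous)
  then have "continuous_on S (\<lambda>x. f x * pderiv_at i g x + pderiv_at i f x * g x)" for i
    using assms by (intro continuous_intros) (auto simp: C1_on_def)
  then show ?thesis
    by (rule C1_onI[rotated]) (use assms in \<open>auto simp: C1_on_def pderiv_at_mult\<close>)
qed

lemma C1_on_sum:
  "(\<And>k. k \<in> I \<Longrightarrow> C1_on S (f k)) \<Longrightarrow> C1_on S (\<lambda>x. \<Sum>k\<in>I. f k x)"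
  by (induction I rule: infinite_finite_induct) (auto intro: C1_on_add)

lemma C1_on_prod:
  fixes f :: "'k \<Rightarrow> real^'m::finite \<Rightarrow> 'b::{real_normed_algebra,comm_ring_1}"
  shows "(\<And>k. k \<in> I \<Longrightarrow> C1_on S (f k)) \<Longrightarrow> C1_on S (\<lambda>x. \<Prod>k\<in>I. f k x)"
  by (induction I rule: infinite_finite_induct) (auto intro: C1_on_mult)

lemma C1_on_bounded_linear:
  assumes "bounded_linear L" "C1_on S f" shows "C1_on S (\<lambda>x. L (f x))"
proof -
  have "continuous_on S (\<lambda>x. L (pderiv_at i f x))" for i
    using assms(2) by (intro bounded_linear.continuous_on[OF assms(1)]) (auto simp: C1_on_def)
  then show ?thesis
    by (rule C1_onI[rotated]) (use assms(2) in \<open>auto intro!: differentiable_bounded_linear[OF assms(1)]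
        simp: C1_on_def pderiv_at_bounded_linear[OF assms(1)]\<close>)
qed

lemma C1_on_compose_real:
  fixes q :: "real^'m::finite \<Rightarrow> real" and \<psi> :: "real \<Rightarrow> real"
  assumes q: "C1_on S q" and \<psi>: "\<And>x. x \<in> S \<Longrightarrow> (\<psi> has_real_derivative \<psi>' (q x)) (at (q x))"
    and "continuous_on (q ` S) \<psi>'"
  shows "C1_on S (\<lambda>x. \<psi> (q x))"
proof -
  have \<psi>': "(\<psi> has_vector_derivative \<psi>' (q x)) (at (q x))" if "x \<in> S" for x
    using \<psi>[OF that] by (simp add: has_real_derivative_iff_has_vector_derivative)
  have "continuous_on S (\<lambda>x. pderiv_at i q x * \<psi>' (q x))" for i
    using q assms(3) by (intro continuous_intros continuous_on_compose2[OF assms(3)])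
      (auto simp: C1_on_def C1_on_continuous)
  then show ?thesis
    by (rule C1_onI[rotated]) (use q in \<open>auto intro!: differentiable_compose_real[OF \<psi>']
        simp: C1_on_def pderiv_at_compose_real[OF \<psi>']\<close>)
qed

lemma C1_on_cong:
  assumes "open S" "C1_on S f" "\<And>x. x \<in> S \<Longrightarrow> g x = f x"
  shows "C1_on S g"
proof (rule C1_onI[where D="\<lambda>i. pderiv_at i f"])
  fix x assume x: "x \<in> S"
  show "g differentiable (at x)"
    using differentiable_cong_open[OF assms(1) x, of f g] assms x by (auto simp: C1_on_def)
  show "pderiv_at i g x = pderiv_at i f x" for i
    using pderiv_at_cong[OF assms(1) x assms(3)] .
next
  fix i show "continuous_on S (pderiv_at i f)"
    using assms(2) by (simp add: C1_on_def)
qed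

section \<open>Asymptotic expansions in even powers\<close>

definition fps_trunc_eval :: "nat \<Rightarrow> 'b::real_normed_field fps \<Rightarrow> real \<Rightarrow> 'b" where
  "fps_trunc_eval m \<phi> r = (\<Sum>k\<le>m. fps_nth \<phi> k * of_real r ^ (2 * k))"

text \<open>Coefficients of \<open>\<phi>\<close> beyond \<open>m\<close> are irrelevant. Taking a power series in \<open>r\<^sup>2\<close> instead of its truncation
makes the product of two expansions a product in a ring, which will later allow division.\<close>

definition has_expansion :: "nat \<Rightarrow> (real \<Rightarrow> 'b::real_normed_field) \<Rightarrow> 'b fps \<Rightarrow> bool" where
  "has_expansion m F \<phi> \<longleftrightarrow> (\<lambda>r. F r - fps_trunc_eval m \<phi> r) \<in> o[at_right 0](\<lambda>r. of_real r ^ (2 * m))"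

lemma even_power_smallo:
  assumes "k > m"
  shows "(\<lambda>r. of_real r ^ (2 * k) :: 'b::real_normed_field) \<in> o[at_right 0](\<lambda>r. of_real r ^ (2 * m))"
proof (rule smalloI_tendsto)
  show "\<forall>\<^sub>F r in at_right (0::real). (of_real r ^ (2 * m) :: 'b) \<noteq> 0"
    using eventually_at_right_less[of "0::real"] by eventually_elim simp
  have "((\<lambda>r. of_real r ^ (2 * (k - m)) :: 'b) \<longlongrightarrow> of_real 0 ^ (2 * (k - m))) (at_right 0)"
    by (intro tendsto_intros)
  then have "((\<lambda>r. of_real r ^ (2 * (k - m)) :: 'b) \<longlongrightarrow> 0) (at_right 0)"
    using assms by (simp add: power_0_left)
  moreover have "\<forall>\<^sub>F r in at_right (0::real). (of_real r ^ (2 * (k - m)) :: 'b) = of_real r ^ (2 * k) / of_real r ^ (2 * m)"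
  proof -
    have "of_real r ^ (2 * k) = (of_real r ^ (2 * (k - m)) * of_real r ^ (2 * m) :: 'b)" for r
    proof -
      have "2 * k = 2 * (k - m) + 2 * m" using assms by simp
      then show ?thesis by (metis power_add)
    qed
    note * = this
    show ?thesis
      using eventually_at_right_less[of "0::real"] by eventually_elim (simp add: *)
  qed
  ultimately show "((\<lambda>r. of_real r ^ (2 * k) / of_real r ^ (2 * m) :: 'b) \<longlongrightarrow> 0) (at_right 0)"
    by (rule Lim_transform_eventually)
qed

lemma even_power_bigo:
  assumes "k \<ge> m"
  shows "(\<lambda>r. of_real r ^ (2 * k) :: 'b::real_normed_field) \<in> O[at_right 0](\<lambda>r. of_real r ^ (2 * m))"
  using even_power_smallo[of m k, where 'b='b] assms by (cases "k = m") (auto intro: landau_o.small_imp_big)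

lemma fps_trunc_eval_add: "fps_trunc_eval m (\<phi> + \<psi>) r = fps_trunc_eval m \<phi> r + fps_trunc_eval m \<psi> r"
  by (simp add: fps_trunc_eval_def sum.distrib algebra_simps)

lemma fps_trunc_eval_bounded: "fps_trunc_eval m \<phi> \<in> O[at_right 0](\<lambda>_. 1)"
  unfolding fps_trunc_eval_def
  using even_power_bigo[of 0, where 'b='a] by (intro big_sum_in_bigo) simp

lemma has_expansion_imp_bounded:
  assumes "has_expansion m F \<phi>" shows "F \<in> O[at_right 0](\<lambda>_. 1)"
proof -
  have "(\<lambda>r. F r - fps_trunc_eval m \<phi> r) \<in> O[at_right 0](\<lambda>r. of_real r ^ (2 * m))"
    using assms unfolding has_expansion_def by (rule landau_o.small_imp_big)
  also have "(\<lambda>r. of_real r ^ (2 * m)) \<in> O[at_right 0](\<lambda>r. of_real r ^ (2 * 0) :: 'a)"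
    by (rule even_power_bigo) simp
  finally have "(\<lambda>r. F r - fps_trunc_eval m \<phi> r) \<in> O[at_right 0](\<lambda>_. 1)" by simp
  from sum_in_bigo(1)[OF this fps_trunc_eval_bounded[of m \<phi>]] show ?thesis by simp
qed

lemma has_expansion_add: "has_expansion m F \<phi> \<Longrightarrow> has_expansion m G \<psi> \<Longrightarrow> has_expansion m (\<lambda>r. F r + G r) (\<phi> + \<psi>)"
  unfolding has_expansion_def fps_trunc_eval_add
  by (drule (1) sum_in_smallo(1)) (simp add: algebra_simps)

lemma has_expansion_zero: "has_expansion m (\<lambda>_. 0) 0"
  by (simp add: has_expansion_def fps_trunc_eval_def)

lemma has_expansion_sum: "(\<And>k. k \<in> I \<Longrightarrow> has_expansion m (F k) (\<phi> k)) \<Longrightarrow> has_expansion m (\<lambda>r. \<Sum>k\<in>I. F k r) (\<Sum>k\<in>I. \<phi> k)"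
  by (induction I rule: infinite_finite_induct) (auto intro: has_expansion_add has_expansion_zero)

lemma has_expansion_cong_eventually:
  assumes "has_expansion m F \<phi>" "\<forall>\<^sub>F r in at_right 0. F r = G r" shows "has_expansion m G \<phi>"
  using assms(1) unfolding has_expansion_def
  by (rule landau_o.small.ev_eq_trans2[rotated]) (use assms(2) in eventually_elim, simp)

lemma has_expansion_cong_pos:
  "has_expansion m F \<phi> \<Longrightarrow> (\<And>r. r > 0 \<Longrightarrow> F r = G r) \<Longrightarrow> has_expansion m G \<phi>"
  by (erule has_expansion_cong_eventually, use eventually_at_right_less[of "0::real"] in eventually_elim) simp

lemma fps_trunc_eval_cong: "(\<And>k. k \<le> m \<Longrightarrow> fps_nth \<phi> k = fps_nth \<psi> k) \<Longrightarrow> fps_trunc_eval m \<phi> = fps_trunc_eval m \<psi>"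
  by (auto simp: fps_trunc_eval_def fun_eq_iff)

lemma has_expansion_cong_coeffs:
  "has_expansion m F \<phi> \<Longrightarrow> (\<And>k. k \<le> m \<Longrightarrow> fps_nth \<phi> k = fps_nth \<psi> k) \<Longrightarrow> has_expansion m F \<psi>"
  unfolding has_expansion_def using fps_trunc_eval_cong[of m \<phi> \<psi>] by simp

lemma even_power_sum_smallo:
  assumes "finite I" "\<And>k. k \<in> I \<Longrightarrow> p k > m"
  shows "(\<lambda>r. \<Sum>k\<in>I. c k * of_real r ^ (2 * p k) :: 'b::real_normed_field)
    \<in> o[at_right 0](\<lambda>r. of_real r ^ (2 * m))"
  using even_power_smallo[of m, where 'b='b] assms by (intro big_sum_in_smallo) auto

lemma has_expansion_polynomial:
  assumes "m \<le> K"
  shows "has_expansion m (\<lambda>r. \<Sum>k\<le>K. c k * of_real r ^ (2 * k) :: 'b::real_normed_field) (Abs_fps c)"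
proof -
  have "{..K} = {..m} \<union> {m<..K}" using assms by auto
  then have "(\<lambda>r. (\<Sum>k\<le>K. c k * of_real r ^ (2 * k)) - fps_trunc_eval m (Abs_fps c) r)
      = (\<lambda>r. \<Sum>k\<in>{m<..K}. c k * of_real r ^ (2 * k))"
    by (simp add: fun_eq_iff fps_trunc_eval_def, subst sum.union_disjoint) auto
  then show ?thesis unfolding has_expansion_def by (auto intro: even_power_sum_smallo)
qed

lemma has_expansion_weaken:
  assumes "has_expansion m F \<phi>" "m' \<le> m" shows "has_expansion m' F \<phi>"
proof -
  have "(\<lambda>r. F r - fps_trunc_eval m \<phi> r) \<in> o[at_right 0](\<lambda>r. of_real r ^ (2 * m))"
    using assms unfolding has_expansion_def by simp
  also have "(\<lambda>r. of_real r ^ (2 * m)) \<in> O[at_right 0](\<lambda>r. of_real r ^ (2 * m') :: 'a)"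
    by (rule even_power_bigo) fact
  finally have "(\<lambda>r. F r - fps_trunc_eval m \<phi> r) \<in> o[at_right 0](\<lambda>r. of_real r ^ (2 * m'))" .
  moreover have "(\<lambda>r. fps_trunc_eval m \<phi> r - fps_trunc_eval m' \<phi> r) \<in> o[at_right 0](\<lambda>r. of_real r ^ (2 * m'))"
    using has_expansion_polynomial[OF assms(2), of "fps_nth \<phi>"]
    unfolding has_expansion_def by (simp add: fps_trunc_eval_def fps_nth_inverse)
  ultimately show ?thesis unfolding has_expansion_def by (drule_tac sum_in_smallo(1)) (auto simp: algebra_simps)
qed

lemma has_expansion_imp_tendsto:
  fixes F :: "real \<Rightarrow> real"
  assumes "has_expansion m F \<phi>" shows "(F \<longlongrightarrow> fps_nth \<phi> 0) (at_right 0)"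
proof -
  have "has_expansion 0 F \<phi>" using assms by (rule has_expansion_weaken) simp
  then have "(\<lambda>r. F r - fps_nth \<phi> 0) \<in> o[at_right 0](\<lambda>_. 1)"
    by (simp add: has_expansion_def fps_trunc_eval_def)
  from smalloD_tendsto[OF this] have "((\<lambda>r. F r - fps_nth \<phi> 0) \<longlongrightarrow> 0) (at_right 0)" by simp
  then show ?thesis by (rule Lim_null[THEN iffD2])
qed

text \<open>The two sides differ by the terms with \<open>i + j > m\<close> of the double sum.\<close>

lemma fps_trunc_eval_mult:
  "(\<lambda>r. fps_trunc_eval m \<phi> r * fps_trunc_eval m \<psi> r - fps_trunc_eval m (\<phi> * \<psi>) r)
     \<in> o[at_right 0](\<lambda>r. of_real r ^ (2 * m))"
proof -
  let ?t = "\<lambda>(i, j). fps_nth \<phi> i * fps_nth \<psi> j" and ?S = "{..m} \<times> {..m}" and ?T = "SIGMA k:{..m}. {..k}"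
  have "(\<lambda>r. fps_trunc_eval m \<phi> r * fps_trunc_eval m \<psi> r - fps_trunc_eval m (\<phi> * \<psi>) r)
     = (\<lambda>r. \<Sum>p \<in> {(i, j). i \<le> m \<and> j \<le> m \<and> i + j > m}. ?t p * of_real r ^ (2 * (fst p + snd p)))"
  proof
    fix r :: real
    have 1: "fps_trunc_eval m \<phi> r * fps_trunc_eval m \<psi> r
        = (\<Sum>p\<in>?S. ?t p * of_real r ^ (2 * (fst p + snd p)))"
      by (simp add: fps_trunc_eval_def sum_product sum.cartesian_product case_prod_unfold algebra_simps power_add power_mult)
    have "fps_trunc_eval m (\<phi> * \<psi>) r = (\<Sum>(k, i)\<in>?T. ?t (i, k - i) * of_real r ^ (2 * k))"
      by (simp add: fps_trunc_eval_def fps_mult_nth sum_distrib_right sum.Sigma atMost_atLeast0)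
    also have "\<dots> = (\<Sum>(k, i)\<in>?T. ?t (i, k - i) * of_real r ^ (2 * (i + (k - i))))"
      by (rule sum.cong) (auto simp del: distrib_left_numeral)
    also have "\<dots> = (\<Sum>p\<in>{(i, j). i + j \<le> m}. ?t p * of_real r ^ (2 * (fst p + snd p)))"
      by (rule sum.reindex_bij_witness[where i="\<lambda>(i, j). (i + j, i)" and j="\<lambda>(k, i). (i, k - i)"]) auto
    finally have 2: "fps_trunc_eval m (\<phi> * \<psi>) r = \<dots>" .
    have "?S = {(i, j). i + j \<le> m} \<union> {(i, j). i \<le> m \<and> j \<le> m \<and> i + j > m}" by auto
    moreover have "finite {(i, j). i + j \<le> m}" "finite {(i, j). i \<le> m \<and> j \<le> m \<and> i + j > m}"
      by (auto intro: finite_subset[of _ ?S])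
    ultimately have "(\<Sum>p\<in>?S. ?t p * of_real r ^ (2 * (fst p + snd p)))
       = (\<Sum>p\<in>{(i, j). i + j \<le> m}. ?t p * of_real r ^ (2 * (fst p + snd p)))
       + (\<Sum>p \<in> {(i, j). i \<le> m \<and> j \<le> m \<and> i + j > m}. ?t p * of_real r ^ (2 * (fst p + snd p)))"
      by (simp only:) (rule sum.union_disjoint, auto)
    with 1 2 show "fps_trunc_eval m \<phi> r * fps_trunc_eval m \<psi> r - fps_trunc_eval m (\<phi> * \<psi>) r
       = (\<Sum>p \<in> {(i, j). i \<le> m \<and> j \<le> m \<and> i + j > m}. ?t p * of_real r ^ (2 * (fst p + snd p)))"
      by simp
  qed
  moreover have "finite {(i, j). i \<le> m \<and> j \<le> m \<and> i + j > m}"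
    by (auto intro: finite_subset[of _ ?S])
  ultimately show ?thesis by (simp only:) (rule even_power_sum_smallo, auto)
qed

lemma has_expansion_mult:
  assumes F: "has_expansion m F \<phi>" and G: "has_expansion m G \<psi>"
  shows "has_expansion m (\<lambda>r. F r * G r) (\<phi> * \<psi>)"
proof -
  let ?o = "o[at_right 0](\<lambda>r. of_real r ^ (2 * m) :: 'a)"
  have 1: "(\<lambda>r. (F r - fps_trunc_eval m \<phi> r) * G r) \<in> ?o"
    using landau_o.small_big_mult[OF F[unfolded has_expansion_def] has_expansion_imp_bounded[OF G]] by simp
  have 2: "(\<lambda>r. fps_trunc_eval m \<phi> r * (G r - fps_trunc_eval m \<psi> r)) \<in> ?o"
    using landau_o.big_small_mult[OF fps_trunc_eval_bounded G[unfolded has_expansion_def]] by simp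
  from sum_in_smallo(1)[OF sum_in_smallo(1)[OF 1 2] fps_trunc_eval_mult[of m \<phi> \<psi>]]
  show ?thesis unfolding has_expansion_def by (simp add: algebra_simps)
qed

lemma has_expansion_const: "has_expansion m (\<lambda>_. c) (fps_const c)"
proof -
  have "fps_trunc_eval m (fps_const c) r = c" for r
    by (simp add: fps_trunc_eval_def if_distrib[of "\<lambda>x. x * _"] sum.delta cong: if_cong)
  then show ?thesis by (simp add: has_expansion_def)
qed

lemma has_expansion_cmult: "has_expansion m F \<phi> \<Longrightarrow> has_expansion m (\<lambda>r. c * F r) (fps_const c * \<phi>)"
  by (rule has_expansion_mult[OF has_expansion_const])

lemma has_expansion_shift:
  assumes "has_expansion m F \<phi>" shows "has_expansion (Suc m) (\<lambda>r. of_real r ^ 2 * F r) (fps_X * \<phi>)"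
proof -
  have "fps_trunc_eval (Suc m) (fps_X * \<phi>) r = of_real r ^ 2 * fps_trunc_eval m \<phi> r" for r
    by (simp add: fps_trunc_eval_def sum.atMost_Suc_shift sum_distrib_left algebra_simps power2_eq_square
          del: sum.atMost_Suc)
  moreover have "(\<lambda>r. of_real r ^ 2 * (F r - fps_trunc_eval m \<phi> r)) \<in> o[at_right 0](\<lambda>r. of_real r ^ 2 * of_real r ^ (2 * m))"
    using assms unfolding has_expansion_def by (intro landau_o.small.mult_left) auto
  ultimately show ?thesis unfolding has_expansion_def by (simp add: algebra_simps power_add power2_eq_square)
qed

lemma has_expansion_of_real:
  assumes "has_expansion m F \<phi>"
  shows "has_expansion m (\<lambda>r. complex_of_real (F r)) (Abs_fps (\<lambda>k. of_real (fps_nth \<phi> k)))"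
proof -
  have "(\<lambda>r. complex_of_real (F r - fps_trunc_eval m \<phi> r)) \<in> o[at_right 0](\<lambda>r. complex_of_real (r ^ (2 * m)))"
    unfolding landau_o.small.of_real_iff using assms by (simp add: has_expansion_def)
  then show ?thesis by (simp add: has_expansion_def fps_trunc_eval_def)
qed

text \<open>If the coefficients below \<open>k\<close> vanish, truncate at \<open>k\<close>, divide by \<open>r\<^bsup>2k\<^esup>\<close> and let \<open>r\<close> tend to zero.\<close>

lemma has_expansion_zero_coeffs:
  assumes "has_expansion m (\<lambda>_. 0) \<psi>" "k \<le> m"
  shows "fps_nth \<psi> k = (0 :: 'b::real_normed_field)"
  using assms(2)
proof (induction k rule: less_induct)
  case (less k)
  have "has_expansion k (\<lambda>_. 0) \<psi>" using has_expansion_weaken[OF assms(1) less.prems] .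
  then have "(\<lambda>r. fps_trunc_eval k \<psi> r) \<in> o[at_right 0](\<lambda>r. of_real r ^ (2 * k))"
    by (simp add: has_expansion_def)
  moreover have "fps_trunc_eval k \<psi> r = fps_nth \<psi> k * of_real r ^ (2 * k)" for r
    unfolding fps_trunc_eval_def by (subst sum.remove[of _ k]) (use less in auto)
  ultimately have "(\<lambda>r. fps_nth \<psi> k * of_real r ^ (2 * k)) \<in> o[at_right 0](\<lambda>r. of_real r ^ (2 * k))"
    by simp
  from smalloD_tendsto[OF this]
  have "((\<lambda>r. fps_nth \<psi> k * of_real r ^ (2 * k) / of_real r ^ (2 * k)) \<longlongrightarrow> 0) (at_right 0)" .
  moreover have "\<forall>\<^sub>F r in at_right (0::real). fps_nth \<psi> k * of_real r ^ (2 * k) / of_real r ^ (2 * k) = fps_nth \<psi> k"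
    using eventually_at_right_less[of "0::real"] by eventually_elim simp
  ultimately have "((\<lambda>r::real. fps_nth \<psi> k) \<longlongrightarrow> 0) (at_right 0)"
    by (rule Lim_transform_eventually)
  then show ?case by (simp add: tendsto_const_iff)
qed

lemma has_expansion_diff: "has_expansion m F \<phi> \<Longrightarrow> has_expansion m G \<psi> \<Longrightarrow> has_expansion m (\<lambda>r. F r - G r) (\<phi> - \<psi>)"
  using has_expansion_add[of m F \<phi> "\<lambda>r. (-1) * G r" "fps_const (-1) * \<psi>"] has_expansion_cmult[of m G \<psi> "-1"]
  by (simp flip: fps_const_neg)

lemma has_expansion_unique:
  assumes "has_expansion m F \<phi>" "has_expansion m F \<psi>" "k \<le> m" shows "fps_nth \<phi> k = fps_nth \<psi> k"
  using has_expansion_zero_coeffs[of m "\<phi> - \<psi>" k] has_expansion_diff[OF assms(1,2)] assms(3) by simp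

section \<open>Expansions with a logarithmic term\<close>

text \<open>With \<open>2 * m\<close> the dimension, this is the kind of expansion that the entries of \<open>h\<^sub>r\<close> have. The logarithm
occurs only at the last order, so products of two such functions are again of this kind.\<close>

definition has_log_expansion :: "nat \<Rightarrow> (real \<Rightarrow> real) \<Rightarrow> real fps \<Rightarrow> real \<Rightarrow> bool" where
  "has_log_expansion m F \<phi> a \<longleftrightarrow> has_expansion m (\<lambda>r. F r - a * (r ^ (2 * m) * ln r)) \<phi>"

lemma has_log_expansion_cong_pos:
  "has_log_expansion m F \<phi> a \<Longrightarrow> (\<And>r. r > 0 \<Longrightarrow> F r = G r) \<Longrightarrow> has_log_expansion m G \<phi> a"
  unfolding has_log_expansion_def
  by (erule has_expansion_cong_eventually, use eventually_at_right_less[of "0::real"] in eventually_elim) simp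

lemma power_ln_smallo:
  assumes "k < m" shows "(\<lambda>r. r ^ (2 * m) * ln r) \<in> o[at_right 0](\<lambda>r. r ^ (2 * k) :: real)"
proof -
  have "(\<lambda>r. r * ln r) \<in> o[at_right 0](\<lambda>r. 1 :: real)" by real_asymp
  from landau_o.small.mult_left[OF this, of "\<lambda>r. r ^ (2 * m - 1)"]
  have "(\<lambda>r. r ^ (2 * m) * ln r) \<in> o[at_right 0](\<lambda>r. r ^ (2 * m - 1) :: real)"
    using assms power_minus_mult[of "2 * m", where 'a=real] by (simp flip: mult.assoc)
  also have "(\<lambda>r. r ^ (2 * m - 1) :: real) \<in> O[at_right 0](\<lambda>r. r ^ (2 * k))"
  proof (rule landau_o.bigI[of 1])
    have "\<forall>\<^sub>F r in at_right (0::real). r < 1" by (rule eventually_at_right_field[THEN iffD2]) (auto intro: exI[of _ 1])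
    then show "\<forall>\<^sub>F r in at_right (0::real). norm (r ^ (2 * m - 1)) \<le> 1 * norm (r ^ (2 * k))"
      using eventually_at_right_less[of "0::real"]
      by eventually_elim (use assms in \<open>auto intro!: power_decreasing\<close>)
  qed simp
  finally show ?thesis .
qed

lemma has_log_expansion_imp_has_expansion: "has_log_expansion m F \<phi> a \<Longrightarrow> k < m \<Longrightarrow> has_expansion k F \<phi>"
proof -
  assume a: "has_log_expansion m F \<phi> a" and k: "k < m"
  have "has_expansion k (\<lambda>r. a * (r ^ (2 * m) * ln r)) 0"
    using power_ln_smallo[OF k] by (simp add: has_expansion_def fps_trunc_eval_def)
  from has_expansion_add[OF has_expansion_weaken[OF a[unfolded has_log_expansion_def], of k] this] k show "has_expansion k F \<phi>" by simp
qed

lemma has_log_expansion_zero_iff: "has_log_expansion m F \<phi> 0 \<longleftrightarrow> has_expansion m F \<phi>"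
  by (simp add: has_log_expansion_def)

lemma has_log_expansion_add: "has_log_expansion m F \<phi> a \<Longrightarrow> has_log_expansion m G \<psi> b \<Longrightarrow> has_log_expansion m (\<lambda>r. F r + G r) (\<phi> + \<psi>) (a + b)"
  unfolding has_log_expansion_def by (drule (1) has_expansion_add) (simp add: algebra_simps)

text \<open>Only the constant terms of the factors meet the logarithm: \<open>r\<^bsup>2m\<^esup> log r\<close> times a function that is \<open>O(r)\<close>
is negligible, and so is the square of \<open>r\<^bsup>2m\<^esup> log r\<close>.\<close>

lemma has_log_expansion_mult:
  assumes F: "has_log_expansion m F \<phi> a" and G: "has_log_expansion m G \<psi> b" and m: "m \<ge> 1"
  shows "has_log_expansion m (\<lambda>r. F r * G r) (\<phi> * \<psi>) (a * fps_nth \<psi> 0 + b * fps_nth \<phi> 0)"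
proof -
  let ?L = "\<lambda>r::real. r ^ (2 * m) * ln r"
  have L: "has_expansion m (\<lambda>r. ?L r * (H r - fps_nth \<theta> 0)) 0" if "has_log_expansion m H \<theta> c" for H \<theta> c
  proof -
    have "(\<lambda>r. H r - fps_nth \<theta> 0) \<in> O[at_right 0](\<lambda>r. r)"
    proof -
      have "has_expansion 0 (\<lambda>r. H r) \<theta>" using has_log_expansion_imp_has_expansion[OF that, of 0] m by simp
      have "has_log_expansion m H \<theta> c" by fact
      then have "(\<lambda>r. H r - c * ?L r - fps_trunc_eval m \<theta> r) \<in> o[at_right 0](\<lambda>r. r ^ (2 * m))"
        by (simp add: has_log_expansion_def has_expansion_def)
      also have "(\<lambda>r::real. r ^ (2 * m)) \<in> O[at_right 0](\<lambda>r. r ^ (2 * 1))"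
        using even_power_bigo[of 1 m, where 'b=real] m by simp
      also have "(\<lambda>r::real. r ^ (2 * 1)) \<in> O[at_right 0](\<lambda>r. r)" by real_asymp
      finally have 1: "(\<lambda>r. H r - c * ?L r - fps_trunc_eval m \<theta> r) \<in> O[at_right 0](\<lambda>r. r)"
        by (rule landau_o.small_imp_big)
      have "?L \<in> O[at_right 0](\<lambda>r. r)"
      proof -
        obtain m' where m': "m = Suc m'" using m by (cases m) auto
        have "(\<lambda>r. r * ln r) \<in> O[at_right 0](\<lambda>r. 1 :: real)" by real_asymp
        from landau_o.big.mult_left[OF this, of "\<lambda>r. r ^ (2 * m - 1)"]
        have "?L \<in> O[at_right 0](\<lambda>r. r ^ (2 * m - 1) :: real)"
          by (simp add: m' algebra_simps)
        also have "(\<lambda>r. r ^ (2 * m - 1)) = (\<lambda>r::real. r * r ^ (2 * m'))"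
          by (simp add: m')
        also have "(\<lambda>r::real. r * r ^ (2 * m')) \<in> O[at_right 0](\<lambda>r. r * r ^ (2 * 0))"
          using even_power_bigo[of 0 m', where 'b=real] by (intro landau_o.big.mult_left) simp
        finally show ?thesis by simp
      qed
      then have 2: "(\<lambda>r. c * ?L r) \<in> O[at_right 0](\<lambda>r. r)" by simp
      have "(\<lambda>r. fps_trunc_eval m \<theta> r - fps_nth \<theta> 0) \<in> O[at_right 0](\<lambda>r. r)"
      proof -
        have "(\<lambda>r. fps_trunc_eval m \<theta> r - fps_nth \<theta> 0) = (\<lambda>r. \<Sum>k\<in>{0<..m}. fps_nth \<theta> k * r ^ (2 * k))"
        proof
          fix r :: real
          have "{..m} = insert 0 {0<..m}" by auto
          then show "fps_trunc_eval m \<theta> r - fps_nth \<theta> 0 = (\<Sum>k\<in>{0<..m}. fps_nth \<theta> k * r ^ (2 * k))"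
            by (simp add: fps_trunc_eval_def)
        qed
        also have "\<dots> \<in> O[at_right 0](\<lambda>r. r ^ (2 * 1))"
          using even_power_bigo[of 1, where 'b=real] by (intro big_sum_in_bigo) auto
        also have "(\<lambda>r::real. r ^ (2 * 1)) \<in> O[at_right 0](\<lambda>r. r)" by real_asymp
        finally show ?thesis .
      qed
      from sum_in_bigo(1)[OF sum_in_bigo(1)[OF 1 2] this] show ?thesis by simp
    qed
    moreover have "(\<lambda>r. r * ln r) \<in> o[at_right 0](\<lambda>r. 1 :: real)" by real_asymp
    ultimately have "(\<lambda>r. ln r * (H r - fps_nth \<theta> 0)) \<in> o[at_right 0](\<lambda>r. 1)"
    proof -
      assume 1: "(\<lambda>r. H r - fps_nth \<theta> 0) \<in> O[at_right 0](\<lambda>r. r)"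
        and 2: "(\<lambda>r. r * ln r) \<in> o[at_right 0](\<lambda>r. 1 :: real)"
      from landau_o.big.mult_left[OF 1, of "\<lambda>r. ln r"]
      have "(\<lambda>r. ln r * (H r - fps_nth \<theta> 0)) \<in> O[at_right 0](\<lambda>r. r * ln r)" by (simp add: mult.commute)
      also note 2
      finally show ?thesis .
    qed
    from landau_o.small.mult_left[OF this, of "\<lambda>r. r ^ (2 * m)"]
    show ?thesis by (simp add: has_expansion_def fps_trunc_eval_def algebra_simps)
  qed
  have 1: "has_expansion m (\<lambda>r. (F r - a * ?L r) * (G r - b * ?L r)) (\<phi> * \<psi>)"
    using F G unfolding has_log_expansion_def by (rule has_expansion_mult)
  have LL: "has_expansion m (\<lambda>r. ?L r * ?L r) 0"
  proof -
    have "?L \<in> o[at_right 0](\<lambda>r. 1)" using power_ln_smallo[of 0 m] m by simp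
    moreover have "(\<lambda>r. r ^ m * ln r) \<in> o[at_right 0](\<lambda>r. 1 :: real)"
    proof -
      have "(\<lambda>r. r * ln r) \<in> o[at_right 0](\<lambda>r. 1 :: real)" by real_asymp
      moreover have "(\<lambda>r::real. r ^ (m - 1)) \<in> O[at_right 0](\<lambda>r. 1)"
      proof (rule landau_o.bigI[of 1])
        have "\<forall>\<^sub>F r in at_right (0::real). r < 1" by (rule eventually_at_right_field[THEN iffD2]) (auto intro: exI[of _ 1])
        then show "\<forall>\<^sub>F r in at_right (0::real). norm (r ^ (m - 1)) \<le> 1 * norm (1::real)"
          using eventually_at_right_less[of "0::real"]
          by eventually_elim (auto intro!: power_le_one)
      qed simp
      ultimately have "(\<lambda>r::real. r ^ (m - 1) * (r * ln r)) \<in> o[at_right 0](\<lambda>r. 1 * 1)"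
        by (intro landau_o.big_small_mult)
      then show ?thesis using m power_minus_mult[of m, where 'a=real] by (simp flip: mult.assoc)
    qed
    ultimately have "(\<lambda>r. (r ^ m * ln r) * (r ^ m * ln r)) \<in> o[at_right 0](\<lambda>r. 1 * 1 :: real)"
      by (intro landau_o.small_big_mult) (auto intro: landau_o.small_imp_big)
    from landau_o.small.mult_left[OF this, of "\<lambda>r. r ^ (2 * m)"]
    show ?thesis by (simp add: has_expansion_def fps_trunc_eval_def algebra_simps power_mult power2_eq_square)
  qed
  have "has_expansion m (\<lambda>r. (F r - a * ?L r) * (G r - b * ?L r)
      + a * (?L r * (G r - fps_nth \<psi> 0)) + b * (?L r * (F r - fps_nth \<phi> 0))
      + (- a * b) * (?L r * ?L r)) (\<phi> * \<psi> + fps_const a * 0 + fps_const b * 0 + fps_const (- a * b) * 0)"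
    by (intro has_expansion_add has_expansion_cmult 1 L[OF F] L[OF G] LL)
  then show ?thesis unfolding has_log_expansion_def by (simp add: algebra_simps)
qed

lemma has_log_expansion_cong_coeffs:
  "has_log_expansion m F \<phi> a \<Longrightarrow> (\<And>k. k \<le> m \<Longrightarrow> fps_nth \<phi> k = fps_nth \<psi> k) \<Longrightarrow> has_log_expansion m F \<psi> a"
  unfolding has_log_expansion_def by (rule has_expansion_cong_coeffs)

text \<open>The difference of the two expansions shows that \<open>a log r\<close> converges as \<open>r\<close> tends to zero, after the
lower coefficients have been compared at the orders below \<open>m\<close>.\<close>

lemma has_log_expansion_unique:
  assumes F: "has_log_expansion m F \<phi> a" and G: "has_expansion m F \<psi>" and m: "m \<ge> 1"
  shows "a = 0" "k \<le> m \<Longrightarrow> fps_nth \<phi> k = fps_nth \<psi> k"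
proof -
  let ?L = "\<lambda>r::real. r ^ (2 * m) * ln r"
  let ?\<theta> = "\<psi> - \<phi>"
  have L: "has_expansion m (\<lambda>r. a * ?L r) ?\<theta>"
    using has_expansion_diff[OF G F[unfolded has_log_expansion_def]] by simp
  have small: "fps_nth ?\<theta> k = 0" if "k < m" for k
  proof -
    have "has_expansion (m - 1) (\<lambda>r. a * ?L r) 0"
      using power_ln_smallo[of "m - 1" m] m by (simp add: has_expansion_def fps_trunc_eval_def)
    from has_expansion_unique[OF has_expansion_weaken[OF L] this, of k] that show ?thesis by simp
  qed
  have e: "fps_trunc_eval m ?\<theta> r = fps_nth ?\<theta> m * r ^ (2 * m)" for r
    unfolding fps_trunc_eval_def by (subst sum.remove[of _ m]) (use small in auto)
  have "(\<lambda>r. a * ?L r - fps_nth ?\<theta> m * r ^ (2 * m)) \<in> o[at_right 0](\<lambda>r. r ^ (2 * m))"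
    using L unfolding has_expansion_def e by simp
  from smalloD_tendsto[OF this]
  have "((\<lambda>r. (a * ?L r - fps_nth ?\<theta> m * r ^ (2 * m)) / r ^ (2 * m)) \<longlongrightarrow> 0) (at_right 0)" .
  moreover have "\<forall>\<^sub>F r in at_right (0::real). (a * ?L r - fps_nth ?\<theta> m * r ^ (2 * m)) / r ^ (2 * m) = a * ln r - fps_nth ?\<theta> m"
    using eventually_at_right_less[of "0::real"] by eventually_elim (simp add: field_simps)
  ultimately have "((\<lambda>r. a * ln r - fps_nth ?\<theta> m) \<longlongrightarrow> 0) (at_right 0)"
    by (rule Lim_transform_eventually)
  from tendsto_add[OF this tendsto_const[of "fps_nth ?\<theta> m"]]
  have lim: "((\<lambda>r. a * ln r) \<longlongrightarrow> fps_nth ?\<theta> m) (at_right 0)" by simp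
  show a: "a = 0"
  proof (rule ccontr)
    assume "a \<noteq> 0"
    with tendsto_mult[OF tendsto_const[of "1 / a"] lim]
    have "((\<lambda>r. ln r) \<longlongrightarrow> 1 / a * fps_nth ?\<theta> m) (at_right (0::real))" by simp
    moreover have "filterlim (\<lambda>r::real. ln r) at_infinity (at_right 0)"
      using ln_at_0 by (rule filterlim_at_bot_imp_at_infinity)
    ultimately show False using not_tendsto_and_filterlim_at_infinity by (metis trivial_limit_at_right_real)
  qed
  with has_expansion_unique[OF F[unfolded has_log_expansion_def] _, of \<psi> k] G show "k \<le> m \<Longrightarrow> fps_nth \<phi> k = fps_nth \<psi> k" by simp
qed

section \<open>Power series with differentiable coefficients\<close>

definition fps_pderiv :: "'m::finite \<Rightarrow> (real^'m \<Rightarrow> 'b::real_normed_field fps) \<Rightarrow> real^'m \<Rightarrow> 'b fps" where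
  "fps_pderiv i \<phi> x = Abs_fps (\<lambda>k. pderiv_at i (\<lambda>y. fps_nth (\<phi> y) k) x)"

definition fps_C1_on :: "(real^'m::finite) set \<Rightarrow> (real^'m \<Rightarrow> 'b::real_normed_field fps) \<Rightarrow> bool" where
  "fps_C1_on U \<phi> \<longleftrightarrow> (\<forall>k. C1_on U (\<lambda>x. fps_nth (\<phi> x) k))"

lemma fps_C1_on_differentiable:
  "fps_C1_on U \<phi> \<Longrightarrow> x \<in> U \<Longrightarrow> (\<lambda>x. fps_nth (\<phi> x) k) differentiable (at x)"
  by (auto simp: fps_C1_on_def C1_on_def)

lemma fps_C1_on_add: "fps_C1_on U \<phi> \<Longrightarrow> fps_C1_on U \<psi> \<Longrightarrow> fps_C1_on U (\<lambda>x. \<phi> x + \<psi> x)"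
  by (auto simp: fps_C1_on_def intro!: C1_on_add)

lemma fps_C1_on_mult: "fps_C1_on U \<phi> \<Longrightarrow> fps_C1_on U \<psi> \<Longrightarrow> fps_C1_on U (\<lambda>x. \<phi> x * \<psi> x)"
  by (auto simp: fps_C1_on_def fps_mult_nth intro!: C1_on_sum C1_on_mult)

lemma fps_C1_on_const [simp]: "fps_C1_on U (\<lambda>x. c)"
  by (auto simp: fps_C1_on_def)

lemma fps_pderiv_const [simp]: "fps_pderiv i (\<lambda>x. c) x = 0"
  by (simp add: fps_pderiv_def fps_eq_iff)

lemma fps_pderiv_add:
  assumes "fps_C1_on U \<phi>" "fps_C1_on U \<psi>" "x \<in> U"
  shows "fps_pderiv i (\<lambda>x. \<phi> x + \<psi> x) x = fps_pderiv i \<phi> x + fps_pderiv i \<psi> x"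
  using assms
  by (auto simp: fps_eq_iff fps_pderiv_def fps_C1_on_differentiable intro!: pderiv_at_add)

lemma fps_pderiv_mult:
  assumes "fps_C1_on U \<phi>" "fps_C1_on U \<psi>" "x \<in> U"
  shows "fps_pderiv i (\<lambda>x. \<phi> x * \<psi> x) x = \<phi> x * fps_pderiv i \<psi> x + fps_pderiv i \<phi> x * \<psi> x"
proof (rule fps_ext)
  fix k
  have d: "(\<lambda>x. fps_nth (\<phi> x) k) differentiable (at x)" "(\<lambda>x. fps_nth (\<psi> x) k) differentiable (at x)" for k
    using assms by (auto intro: fps_C1_on_differentiable)
  show "fps_nth (fps_pderiv i (\<lambda>x. \<phi> x * \<psi> x) x) k =
      fps_nth (\<phi> x * fps_pderiv i \<psi> x + fps_pderiv i \<phi> x * \<psi> x) k"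
    using d by (simp add: fps_pderiv_def fps_mult_nth pderiv_at_sum pderiv_at_mult sum.distrib)
qed

lemma fps_pderiv_cong:
  assumes "open S" "x \<in> S" "\<And>y. y \<in> S \<Longrightarrow> \<phi> y = \<psi> y"
  shows "fps_pderiv i \<phi> x = fps_pderiv i \<psi> x"
  unfolding fps_pderiv_def using assms by (intro arg_cong[of _ _ Abs_fps] ext pderiv_at_cong[of S]) auto

text \<open>This recursion shows that the coefficients of the inverse are as regular as those of the series.\<close>

lemma fps_inverse_nth_rec:
  fixes f :: "'b::field fps"
  assumes "fps_nth f 0 \<noteq> 0"
  shows "fps_nth (inverse f) k = ((if k = 0 then 1 else 0) - (\<Sum>i<k. fps_nth (inverse f) i * fps_nth f (k - i)))
    * inverse (fps_nth f 0)"
proof -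
  have "fps_nth (inverse f * f) k = (if k = 0 then 1 else 0)"
    using inverse_mult_eq_1[OF assms] by simp
  moreover have "{0..k} = insert k {..<k}" by auto
  ultimately have "fps_nth (inverse f) k * fps_nth f 0 + (\<Sum>i<k. fps_nth (inverse f) i * fps_nth f (k - i)) = (if k = 0 then 1 else 0)"
    by (simp add: fps_mult_nth)
  then have "fps_nth (inverse f) k * fps_nth f 0 = (if k = 0 then 1 else 0) - (\<Sum>i<k. fps_nth (inverse f) i * fps_nth f (k - i))"
    by (simp add: algebra_simps)
  then show ?thesis using assms by (simp add: field_simps)
qed

lemma C1_on_inverse:
  fixes q :: "real^'m::finite \<Rightarrow> real"
  assumes "C1_on U q" "\<And>x. x \<in> U \<Longrightarrow> q x \<noteq> 0"
  shows "C1_on U (\<lambda>x. inverse (q x))"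
proof (rule C1_on_compose_real[OF assms(1), where \<psi>' = "\<lambda>t. - (inverse t * inverse t)"])
  show "continuous_on (q ` U) (\<lambda>t. - (inverse t * inverse t))"
    using assms(2) by (auto intro!: continuous_intros)
  show "(inverse has_real_derivative - (inverse (q x) * inverse (q x))) (at (q x))" if "x \<in> U" for x
    using DERIV_inverse[of "q x" UNIV] assms(2)[OF that] by (simp add: power2_eq_square)
qed

lemma fps_C1_on_inverse:
  fixes \<phi> :: "real^'m::finite \<Rightarrow> real fps"
  assumes U: "open U" and \<phi>: "fps_C1_on U \<phi>" "\<And>x. x \<in> U \<Longrightarrow> fps_nth (\<phi> x) 0 \<noteq> 0"
  shows "fps_C1_on U (\<lambda>x. inverse (\<phi> x))"
  unfolding fps_C1_on_def
proof
  fix k show "C1_on U (\<lambda>x. fps_nth (inverse (\<phi> x)) k)"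
  proof (induction k rule: less_induct)
    case (less k)
    have "C1_on U (\<lambda>x. ((if k = 0 then 1 else 0) + (\<Sum>i<k. (-1) * (fps_nth (inverse (\<phi> x)) i * fps_nth (\<phi> x) (k - i))))
    * inverse (fps_nth (\<phi> x) 0))"
      using less \<phi> by (intro C1_on_mult C1_on_add C1_on_sum C1_on_inverse C1_on_const) (auto simp: fps_C1_on_def)
    then show ?case
      by (rule C1_on_cong[OF U]) (use fps_inverse_nth_rec[OF \<phi>(2), of _ k] in \<open>simp add: sum_negf\<close>)
  qed
qed

lemma fps_pderiv_inverse:
  fixes \<phi> :: "real^'m::finite \<Rightarrow> real fps"
  assumes U: "open U" and \<phi>: "fps_C1_on U \<phi>" "\<And>x. x \<in> U \<Longrightarrow> fps_nth (\<phi> x) 0 \<noteq> 0" and x: "x \<in> U"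
  shows "fps_pderiv i (\<lambda>x. inverse (\<phi> x)) x = - (fps_pderiv i \<phi> x * (inverse (\<phi> x))\<^sup>2)"
proof -
  let ?I = "inverse (\<phi> x)"
  have I: "?I * \<phi> x = 1" using inverse_mult_eq_1[OF \<phi>(2)[OF x]] .
  have "0 = fps_pderiv i (\<lambda>x. \<phi> x * inverse (\<phi> x)) x"
    using fps_pderiv_cong[OF U x, of "\<lambda>x. \<phi> x * inverse (\<phi> x)" "\<lambda>x. 1"] inverse_mult_eq_1'[OF \<phi>(2)] by simp
  also have "\<dots> = \<phi> x * fps_pderiv i (\<lambda>x. inverse (\<phi> x)) x + fps_pderiv i \<phi> x * ?I"
    by (rule fps_pderiv_mult[OF \<phi>(1) fps_C1_on_inverse[OF U \<phi>] x])
  finally have "0 = ?I * (\<phi> x * fps_pderiv i (\<lambda>x. inverse (\<phi> x)) x + fps_pderiv i \<phi> x * ?I)" by simp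
  also have "\<dots> = (?I * \<phi> x) * fps_pderiv i (\<lambda>x. inverse (\<phi> x)) x + fps_pderiv i \<phi> x * ?I\<^sup>2"
    by (simp only: algebra_simps power2_eq_square)
  finally show ?thesis unfolding I by (simp add: eq_neg_iff_add_eq_0)
qed

text \<open>The operator \<open>r d/dr\<close> on power series in \<open>r\<^sup>2\<close>.\<close>

definition fps_euler :: "'b::real_normed_field fps \<Rightarrow> 'b fps" where
  "fps_euler \<phi> = fps_const 2 * fps_X * fps_deriv \<phi>"

lemma fps_euler_nth: "fps_nth (fps_euler \<phi>) k = of_nat (2 * k) * fps_nth \<phi> k"
  by (cases k) (simp_all add: fps_euler_def mult.assoc algebra_simps)

lemma fps_euler_mult: "fps_euler (\<phi> * \<psi>) = \<phi> * fps_euler \<psi> + fps_euler \<phi> * \<psi>"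
  by (simp add: fps_euler_def algebra_simps)

lemma fps_euler_add: "fps_euler (\<phi> + \<psi>) = fps_euler \<phi> + fps_euler \<psi>"
  by (simp add: fps_euler_def algebra_simps)

section \<open>Coordinates on the cylinder\<close>

lemma cyl_base_cyl_point [simp]: "cyl_base (cyl_point x r) = x"
  by (simp add: cyl_base_def cyl_point_def vec_eq_iff)

lemma cyl_point_None [simp]: "cyl_point x r $ None = r"
  by (simp add: cyl_point_def)

lemma bounded_linear_cyl_base: "bounded_linear cyl_base"
  by (rule linear_conv_bounded_linear[THEN iffD1], rule linearI) (auto simp: cyl_base_def vec_eq_iff)

lemma cyl_base_axis [simp]: "cyl_base (axis (Some i) 1) = axis i 1" "cyl_base (axis None 1) = 0"
  by (auto simp: cyl_base_def vec_eq_iff axis_def)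

lemma has_derivative_base:
  assumes "f differentiable (at (cyl_base y))"
  shows "((\<lambda>z. f (cyl_base z)) has_derivative (\<lambda>h. frechet_derivative f (at (cyl_base y)) (cyl_base h))) (at y)"
  using diff_chain_at[OF bounded_linear_imp_has_derivative[OF bounded_linear_cyl_base]
      differentiable_has_derivative_frechet[OF assms]] by (simp add: o_def)

lemma differentiable_base:
  "f differentiable (at (cyl_base y)) \<Longrightarrow> (\<lambda>z. f (cyl_base z)) differentiable (at y)"
  using has_derivative_base differentiable_def by blast

lemma pderiv_base_Some:
  "f differentiable (at (cyl_base y)) \<Longrightarrow> pderiv_at (Some i) (\<lambda>z. f (cyl_base z)) y = pderiv_at i f (cyl_base y)"
  by (subst pderiv_at_eqI[OF has_derivative_base]) (simp_all add: pderiv_at_def)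

lemma pderiv_base_None:
  assumes "f differentiable (at (cyl_base y))"
  shows "pderiv_at None (\<lambda>z. f (cyl_base z)) y = 0"
  by (subst pderiv_at_eqI[OF has_derivative_base[OF assms]])
    (simp add: linear_0[OF linear_frechet_derivative[OF assms]])

lemma pderiv_nth: "pderiv_at a (\<lambda>z::real^'m::finite. z $ b) y = (if a = b then 1 else 0)"
  by (subst pderiv_at_eqI[OF bounded_linear_imp_has_derivative[OF bounded_linear_vec_nth]])
    (simp add: axis_def)

lemma differentiable_nth [simp]: "(\<lambda>z::real^'m::finite. z $ b) differentiable (at y)"
  using bounded_linear_imp_has_derivative[OF bounded_linear_vec_nth] differentiable_def by blast

lemma pderiv_radial:
  assumes "(\<psi> has_vector_derivative d) (at (y $ None))"
  shows "pderiv_at None (\<lambda>z. \<psi> (z $ None)) y = d" "pderiv_at (Some i) (\<lambda>z. \<psi> (z $ None)) y = 0"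
    "(\<lambda>z. \<psi> (z $ None)) differentiable (at y)"
  using pderiv_at_compose_real[OF assms differentiable_nth] differentiable_compose_real[OF assms differentiable_nth]
  by (simp_all add: pderiv_nth)

text \<open>All functions on the cylinder used below are built from products of a function of \<open>r\<close> and a function on the
base, for which partial derivatives separate.\<close>

lemma pderiv_radial_mult_base:
  fixes \<psi> :: "real \<Rightarrow> 'b::real_normed_algebra"
  assumes "(\<psi> has_vector_derivative d) (at (y $ None))" "f differentiable (at (cyl_base y))"
  shows "pderiv_at None (\<lambda>z. \<psi> (z $ None) * f (cyl_base z)) y = d * f (cyl_base y)"
    "pderiv_at (Some i) (\<lambda>z. \<psi> (z $ None) * f (cyl_base z)) y = \<psi> (y $ None) * pderiv_at i f (cyl_base y)"
    "(\<lambda>z. \<psi> (z $ None) * f (cyl_base z)) differentiable (at y)"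
  using pderiv_radial[OF assms(1)] differentiable_base[OF assms(2)]
    pderiv_base_Some[OF assms(2), of i] pderiv_base_None[OF assms(2)]
  by (simp_all add: pderiv_at_mult)

section \<open>Functions on the cylinder with differentiable expansions\<close>

text \<open>The functions that admit expansions which may be differentiated once, with regular coefficients. The parameter
\<open>K\<close> is the truncation order of \<open>h\<^sub>r\<close>. For odd \<open>n\<close> the truncation that satisfies the equation depends on the
point \<open>x\<close>, whereas the coefficients are to be differentiated in \<open>x\<close>; hence \<open>\<phi>\<close> and \<open>a\<close> do not depend on \<open>K\<close>.

Applying \<open>r d/dr\<close> to \<open>a r\<^bsup>2m\<^esup> log r\<close> yields the additional coefficient \<open>a\<close> of \<open>r\<^bsup>2m\<^esup>\<close> in the third clause.
Derivatives along the base are only expanded to order \<open>m - 1\<close>, since they will be multiplied by \<open>r\<^sup>2\<close>; at that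
order the logarithm is not visible.\<close>

definition jet_expansion :: "nat set \<Rightarrow> nat \<Rightarrow> (real^'n::finite) set \<Rightarrow>
    (nat \<Rightarrow> real^('n option) \<Rightarrow> real) \<Rightarrow> (real^'n \<Rightarrow> real fps) \<Rightarrow> (real^'n \<Rightarrow> real) \<Rightarrow> bool" where
  "jet_expansion \<K> m U \<Phi> \<phi> a \<longleftrightarrow> fps_C1_on U \<phi> \<and> (\<forall>K\<in>\<K>. \<forall>x\<in>U.
     (\<forall>r>0. \<Phi> K differentiable (at (cyl_point x r))) \<and>
     has_log_expansion m (\<lambda>r. \<Phi> K (cyl_point x r)) (\<phi> x) (a x) \<and>
     has_log_expansion m (\<lambda>r. r * pderiv_at None (\<Phi> K) (cyl_point x r))
       (fps_euler (\<phi> x) + fps_const (a x) * fps_X ^ m) (real (2 * m) * a x) \<and>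
     (\<forall>i. has_expansion (m - 1) (\<lambda>r. pderiv_at (Some i) (\<Phi> K) (cyl_point x r)) (fps_pderiv i \<phi> x)))"

lemma jet_expansionD:
  assumes "jet_expansion \<K> m U \<Phi> \<phi> a" "K \<in> \<K>" "x \<in> U"
  shows "r > 0 \<Longrightarrow> \<Phi> K differentiable (at (cyl_point x r))"
    "has_log_expansion m (\<lambda>r. \<Phi> K (cyl_point x r)) (\<phi> x) (a x)"
    "has_log_expansion m (\<lambda>r. r * pderiv_at None (\<Phi> K) (cyl_point x r))
       (fps_euler (\<phi> x) + fps_const (a x) * fps_X ^ m) (real (2 * m) * a x)"
    "has_expansion (m - 1) (\<lambda>r. pderiv_at (Some i) (\<Phi> K) (cyl_point x r)) (fps_pderiv i \<phi> x)"
  using assms unfolding jet_expansion_def by blast+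

lemma jet_expansion_add:
  assumes F: "jet_expansion \<K> m U F \<phi> a" and G: "jet_expansion \<K> m U G \<psi> b"
  shows "jet_expansion \<K> m U (\<lambda>K z. F K z + G K z) (\<lambda>x. \<phi> x + \<psi> x) (\<lambda>x. a x + b x)"
  unfolding jet_expansion_def
proof (intro conjI ballI allI impI)
  show "fps_C1_on U (\<lambda>x. \<phi> x + \<psi> x)" using F G by (auto simp: jet_expansion_def intro: fps_C1_on_add)
next
  fix K x r assume "K \<in> \<K>" "x \<in> U" "(0::real) < r"
  then show "(\<lambda>z. F K z + G K z) differentiable at (cyl_point x r)"
    using F G by (auto simp: jet_expansion_def)
next
  fix K x assume K: "K \<in> \<K>" "x \<in> U"
  then show "has_log_expansion m (\<lambda>r. F K (cyl_point x r) + G K (cyl_point x r)) (\<phi> x + \<psi> x) (a x + b x)"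
    using F G by (auto simp: jet_expansion_def intro: has_log_expansion_add)
  have d: "F K differentiable at (cyl_point x r)" "G K differentiable at (cyl_point x r)" if "r > 0" for r
    using F G K that by (auto simp: jet_expansion_def)
  have "has_log_expansion m (\<lambda>r. r * pderiv_at None (F K) (cyl_point x r) + r * pderiv_at None (G K) (cyl_point x r))
     ((fps_euler (\<phi> x) + fps_const (a x) * fps_X ^ m) + (fps_euler (\<psi> x) + fps_const (b x) * fps_X ^ m))
     (real (2 * m) * a x + real (2 * m) * b x)"
    using F G K by (intro has_log_expansion_add) (auto simp: jet_expansion_def)
  then have "has_log_expansion m (\<lambda>r. r * pderiv_at None (F K) (cyl_point x r) + r * pderiv_at None (G K) (cyl_point x r))
     (fps_euler (\<phi> x + \<psi> x) + fps_const (a x + b x) * fps_X ^ m) (real (2 * m) * (a x + b x))"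
    by (simp only: fps_euler_add algebra_simps flip: fps_const_add)
  then show "has_log_expansion m (\<lambda>r. r * pderiv_at None (\<lambda>z. F K z + G K z) (cyl_point x r))
     (fps_euler (\<phi> x + \<psi> x) + fps_const (a x + b x) * fps_X ^ m) (real (2 * m) * (a x + b x))"
    by (rule has_log_expansion_cong_pos) (simp add: pderiv_at_add d algebra_simps)
  fix i
  have "has_expansion (m - 1) (\<lambda>r. pderiv_at (Some i) (F K) (cyl_point x r) + pderiv_at (Some i) (G K) (cyl_point x r))
     (fps_pderiv i \<phi> x + fps_pderiv i \<psi> x)"
    using F G K by (intro has_expansion_add) (auto simp: jet_expansion_def)
  then show "has_expansion (m - 1) (\<lambda>r. pderiv_at (Some i) (\<lambda>z. F K z + G K z) (cyl_point x r)) (fps_pderiv i (\<lambda>x. \<phi> x + \<psi> x) x)"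
    using F G K by (subst fps_pderiv_add[of U]) (auto simp: jet_expansion_def pderiv_at_add d elim: has_expansion_cong_pos)
qed

lemma jet_expansion_mult:
  assumes F: "jet_expansion \<K> m U F \<phi> a" and G: "jet_expansion \<K> m U G \<psi> b" and m: "m \<ge> 1"
  shows "jet_expansion \<K> m U (\<lambda>K z. F K z * G K z) (\<lambda>x. \<phi> x * \<psi> x)
     (\<lambda>x. a x * fps_nth (\<psi> x) 0 + b x * fps_nth (\<phi> x) 0)"
  unfolding jet_expansion_def
proof (intro conjI ballI allI impI)
  show "fps_C1_on U (\<lambda>x. \<phi> x * \<psi> x)" using F G by (auto simp: jet_expansion_def intro: fps_C1_on_mult)
next
  fix K x r assume "K \<in> \<K>" "x \<in> U" "(0::real) < r"
  then show "(\<lambda>z. F K z * G K z) differentiable at (cyl_point x r)"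
    using F G by (auto simp: jet_expansion_def)
next
  fix K x assume K: "K \<in> \<K>" "x \<in> U"
  let ?c = "a x * fps_nth (\<psi> x) 0 + b x * fps_nth (\<phi> x) 0"
  have F0: "has_log_expansion m (\<lambda>r. F K (cyl_point x r)) (\<phi> x) (a x)"
    and G0: "has_log_expansion m (\<lambda>r. G K (cyl_point x r)) (\<psi> x) (b x)"
    using F G K by (auto simp: jet_expansion_def)
  from has_log_expansion_mult[OF F0 G0 m]
  show "has_log_expansion m (\<lambda>r. F K (cyl_point x r) * G K (cyl_point x r)) (\<phi> x * \<psi> x) ?c" .
  have d: "F K differentiable at (cyl_point x r)" "G K differentiable at (cyl_point x r)" if "r > 0" for r
    using F G K that by (auto simp: jet_expansion_def)
  let ?\<phi>' = "fps_euler (\<phi> x) + fps_const (a x) * fps_X ^ m" and ?\<psi>' = "fps_euler (\<psi> x) + fps_const (b x) * fps_X ^ m"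
  have F1: "has_log_expansion m (\<lambda>r. r * pderiv_at None (F K) (cyl_point x r)) ?\<phi>' (real (2 * m) * a x)"
    and G1: "has_log_expansion m (\<lambda>r. r * pderiv_at None (G K) (cyl_point x r)) ?\<psi>' (real (2 * m) * b x)"
    using F G K by (auto simp: jet_expansion_def)
  have z: "fps_nth ?\<phi>' 0 = 0" "fps_nth ?\<psi>' 0 = 0"
    using m by (simp_all add: fps_euler_nth)
  have "has_log_expansion m (\<lambda>r. F K (cyl_point x r) * (r * pderiv_at None (G K) (cyl_point x r))
      + (r * pderiv_at None (F K) (cyl_point x r)) * G K (cyl_point x r))
     (\<phi> x * ?\<psi>' + ?\<phi>' * \<psi> x) (real (2 * m) * ?c)"
    using has_log_expansion_add[OF has_log_expansion_mult[OF F0 G1 m] has_log_expansion_mult[OF F1 G0 m]]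
    by (simp only: z mult_zero_right add_0 add_0_right) (simp add: algebra_simps)
  moreover have "fps_nth (\<phi> x * ?\<psi>' + ?\<phi>' * \<psi> x) k = fps_nth (fps_euler (\<phi> x * \<psi> x) + fps_const ?c * fps_X ^ m) k"
    if "k \<le> m" for k
  proof -
    have X: "fps_nth (\<theta> * (fps_const s * fps_X ^ m)) k = (if k = m then s * fps_nth \<theta> 0 else 0)" for s and \<theta> :: "real fps"
    proof -
      have *: "\<theta> * (fps_const s * fps_X ^ m) = fps_const s * (fps_X ^ m * \<theta>)" by (simp add: algebra_simps)
      show ?thesis unfolding * using that by (simp add: fps_X_power_mult_nth)
    qed
    have "fps_nth (\<phi> x * ?\<psi>' + ?\<phi>' * \<psi> x) k = fps_nth (fps_euler (\<phi> x * \<psi> x)) k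
       + fps_nth (\<phi> x * (fps_const (b x) * fps_X ^ m)) k + fps_nth (\<psi> x * (fps_const (a x) * fps_X ^ m)) k"
      unfolding fps_euler_mult by (simp add: algebra_simps)
    also have "\<dots> = fps_nth (fps_euler (\<phi> x * \<psi> x)) k + fps_nth (1 * (fps_const ?c * fps_X ^ m)) k"
      unfolding X by simp
    finally show ?thesis by simp
  qed
  ultimately have "has_log_expansion m (\<lambda>r. F K (cyl_point x r) * (r * pderiv_at None (G K) (cyl_point x r))
      + (r * pderiv_at None (F K) (cyl_point x r)) * G K (cyl_point x r))
     (fps_euler (\<phi> x * \<psi> x) + fps_const ?c * fps_X ^ m) (real (2 * m) * ?c)"
    by (rule has_log_expansion_cong_coeffs)
  then show "has_log_expansion m (\<lambda>r. r * pderiv_at None (\<lambda>z. F K z * G K z) (cyl_point x r))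
     (fps_euler (\<phi> x * \<psi> x) + fps_const ?c * fps_X ^ m) (real (2 * m) * ?c)"
    by (rule has_log_expansion_cong_pos) (simp add: pderiv_at_mult d algebra_simps)
  fix i
  have "has_expansion (m - 1) (\<lambda>r. F K (cyl_point x r) * pderiv_at (Some i) (G K) (cyl_point x r)
      + pderiv_at (Some i) (F K) (cyl_point x r) * G K (cyl_point x r))
     (\<phi> x * fps_pderiv i \<psi> x + fps_pderiv i \<phi> x * \<psi> x)"
    using F G K has_log_expansion_imp_has_expansion[OF F0, of "m - 1"] has_log_expansion_imp_has_expansion[OF G0, of "m - 1"] m
    by (intro has_expansion_add has_expansion_mult) (auto simp: jet_expansion_def)
  then show "has_expansion (m - 1) (\<lambda>r. pderiv_at (Some i) (\<lambda>z. F K z * G K z) (cyl_point x r)) (fps_pderiv i (\<lambda>x. \<phi> x * \<psi> x) x)"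
    using F G K by (subst fps_pderiv_mult[of U]) (auto simp: jet_expansion_def pderiv_at_mult d elim: has_expansion_cong_pos)
qed

lemma jet_expansion_const: "jet_expansion \<K> m U (\<lambda>K z. c) (\<lambda>x. fps_const c) (\<lambda>x. 0)"
  using has_expansion_const[of m c] has_expansion_zero[of m, where 'a=real] has_expansion_zero[of "m - 1", where 'a=real]
  by (auto simp: jet_expansion_def has_log_expansion_def fps_euler_def)

lemma jet_expansion_sum_ex:
  "(\<And>k. k \<in> I \<Longrightarrow> \<exists>\<phi> a. jet_expansion \<K> m U (\<Phi> k) \<phi> a) \<Longrightarrow>
    \<exists>\<phi> a. jet_expansion \<K> m U (\<lambda>K z. \<Sum>k\<in>I. \<Phi> k K z) \<phi> a"
proof (induction I rule: infinite_finite_induct)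
  case (insert k I)
  then obtain \<phi> a \<psi> b where "jet_expansion \<K> m U (\<Phi> k) \<phi> a"
     "jet_expansion \<K> m U (\<lambda>K z. \<Sum>k\<in>I. \<Phi> k K z) \<psi> b" by blast
  from jet_expansion_add[OF this] insert show ?case by auto
qed (auto intro: jet_expansion_const[of _ _ _ 0])

lemma jet_expansion_prod_ex:
  "m \<ge> 1 \<Longrightarrow> (\<And>k. k \<in> I \<Longrightarrow> \<exists>\<phi> a. jet_expansion \<K> m U (\<Phi> k) \<phi> a) \<Longrightarrow>
    \<exists>\<phi> a. jet_expansion \<K> m U (\<lambda>K z. \<Prod>k\<in>I. \<Phi> k K z) \<phi> a"
proof (induction I rule: infinite_finite_induct)
  case (insert k I)
  then obtain \<phi> a \<psi> b where "jet_expansion \<K> m U (\<Phi> k) \<phi> a"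
     "jet_expansion \<K> m U (\<lambda>K z. \<Prod>k\<in>I. \<Phi> k K z) \<psi> b" by blast
  from jet_expansion_mult[OF this insert.prems(1)] insert.hyps show ?case by auto
qed (auto intro: jet_expansion_const[of _ _ _ 1])

text \<open>Determinants are polynomials in the entries. The coefficients remain abstract here; those of the determinant of
\<open>h\<^sub>r\<close> are identified later by uniqueness.\<close>

lemma jet_expansion_det_ex:
  assumes m: "m \<ge> 1"
    and "\<And>i j. \<exists>\<phi> a. jet_expansion \<K> m U (\<lambda>K z. M K z $ i $ j) \<phi> a"
  shows "\<exists>\<phi> a. jet_expansion \<K> m U (\<lambda>K z. det (M K z :: real^'k::finite^'k)) \<phi> a"
  unfolding det_def
proof (rule jet_expansion_sum_ex)
  fix p :: "'k \<Rightarrow> 'k"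
  obtain \<phi> a where "jet_expansion \<K> m U (\<lambda>K z. \<Prod>i\<in>UNIV. M K z $ i $ p i) \<phi> a"
    using jet_expansion_prod_ex[OF m, of UNIV \<K> U "\<lambda>i K z. M K z $ i $ p i"] assms(2) by blast
  from jet_expansion_mult[OF jet_expansion_const[of _ _ _ "of_int (sign p)"] this m]
  show "\<exists>\<phi> a. jet_expansion \<K> m U (\<lambda>K z. of_int (sign p) * (\<Prod>i\<in>UNIV. M K z $ i $ p i)) \<phi> a" by blast
qed

text \<open>The form in which the entries of the truncated metric are given: \<open>\<eta> k\<close> are those of \<open>h\<^sub>(\<^sub>2\<^sub>k\<^sub>)\<close>, and \<open>\<zeta>\<close> is the
entry of the logarithmic coefficient.\<close>

lemma jet_expansion_radial_polynomial:
  fixes \<eta> :: "nat \<Rightarrow> real^'n::finite \<Rightarrow> real" and \<zeta> :: "real^'n \<Rightarrow> real"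
  assumes m: "m \<ge> 1" and \<K>: "\<And>K. K \<in> \<K> \<Longrightarrow> m \<le> K" "\<And>K k. K \<in> \<K> \<Longrightarrow> k \<le> K \<Longrightarrow> C1_on U (\<eta> k)"
    "\<K> \<noteq> {}"
    and \<zeta>: "C1_on U \<zeta>" and U: "open U"
  shows "jet_expansion \<K> m U
    (\<lambda>K z. (\<Sum>k\<le>K. (z $ None) ^ (2 * k) * \<eta> k (cyl_base z)) + (z $ None) ^ (2 * m) * ln (z $ None) * \<zeta> (cyl_base z))
    (\<lambda>x. Abs_fps (\<lambda>k. if k \<le> m then \<eta> k x else 0)) \<zeta>"
  unfolding jet_expansion_def
proof (intro conjI ballI allI impI)
  obtain K0 where K0: "K0 \<in> \<K>" using \<K>(3) by blast
  show "fps_C1_on U (\<lambda>x. Abs_fps (\<lambda>k. if k \<le> m then \<eta> k x else 0))"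
    unfolding fps_C1_on_def
  proof
    fix k show "C1_on U (\<lambda>x. fps_nth (Abs_fps (\<lambda>k. if k \<le> m then \<eta> k x else 0)) k)"
      using \<K>(1)[OF K0] \<K>(2)[OF K0, of k] by (cases "k \<le> m") auto
  qed
next
  fix K x assume K: "K \<in> \<K>" and x: "x \<in> U"
  let ?\<Phi> = "\<lambda>z::real^('n option). (\<Sum>k\<le>K. (z $ None) ^ (2 * k) * \<eta> k (cyl_base z)) + (z $ None) ^ (2 * m) * ln (z $ None) * \<zeta> (cyl_base z)"
  let ?\<phi> = "\<lambda>x. Abs_fps (\<lambda>k. if k \<le> m then \<eta> k x else 0)"
  have \<eta>: "\<eta> k differentiable (at x)" if "k \<le> K" for k
    using \<K>(2)[OF K that] x by (auto simp: C1_on_def)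
  have \<zeta>': "\<zeta> differentiable (at x)" using \<zeta> x by (auto simp: C1_on_def)
  have d1: "((\<lambda>r. r ^ (2 * k)) has_vector_derivative of_nat (2 * k) * r ^ (2 * k - 1)) (at r)" for k and r :: real
    unfolding has_real_derivative_iff_has_vector_derivative[symmetric]
    by (auto intro!: derivative_eq_intros)
  have d2: "((\<lambda>r. r ^ (2 * m) * ln r) has_vector_derivative of_nat (2 * m) * r ^ (2 * m - 1) * ln r + r ^ (2 * m) / r) (at r)"
    if "r > 0" for r :: real
    unfolding has_real_derivative_iff_has_vector_derivative[symmetric]
    using that by (auto intro!: derivative_eq_intros)
  have diffs: "(\<lambda>z. (z $ None) ^ (2 * k) * \<eta> k (cyl_base z)) differentiable (at (cyl_point x r))"
     if "k \<le> K" for k r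
    by (rule pderiv_radial_mult_base(3)[OF d1]) (simp add: \<eta>[OF that])
  have diffl: "(\<lambda>z. (z $ None) ^ (2 * m) * ln (z $ None) * \<zeta> (cyl_base z)) differentiable (at (cyl_point x r))"
     if "r > 0" for r
    by (rule pderiv_radial_mult_base(3)[OF d2]) (simp_all add: \<zeta>' that)
  show "?\<Phi> differentiable at (cyl_point x r)" if "r > 0" for r
    using that diffs diffl by (intro differentiable_add differentiable_sum) auto
  have poly: "has_expansion m (\<lambda>r. \<Sum>k\<le>K. c k * r ^ (2 * k)) \<theta>" if "\<And>k. k \<le> m \<Longrightarrow> fps_nth \<theta> k = c k" for c \<theta>
    using has_expansion_polynomial[OF \<K>(1)[OF K], of c] by (simp, elim has_expansion_cong_coeffs) (use that in auto)
  show "has_log_expansion m (\<lambda>r. ?\<Phi> (cyl_point x r)) (?\<phi> x) (\<zeta> x)"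
    unfolding has_log_expansion_def using poly[of "?\<phi> x" "\<lambda>k. \<eta> k x"] by (simp add: algebra_simps)
  have pN: "pderiv_at None ?\<Phi> (cyl_point x r) =
     (\<Sum>k\<le>K. of_nat (2 * k) * r ^ (2 * k - 1) * \<eta> k x) + (of_nat (2 * m) * r ^ (2 * m - 1) * ln r + r ^ (2 * m) / r) * \<zeta> x"
    if "r > 0" for r
  proof -
    have 1: "pderiv_at None (\<lambda>z. (z $ None) ^ (2 * k) * \<eta> k (cyl_base z)) (cyl_point x r)
       = of_nat (2 * k) * r ^ (2 * k - 1) * \<eta> k x" if "k \<le> K" for k
      using pderiv_radial_mult_base(1)[OF d1, of "\<eta> k" "cyl_point x r" k] \<eta>[OF that] by simp
    have 2: "pderiv_at None (\<lambda>z. (z $ None) ^ (2 * m) * ln (z $ None) * \<zeta> (cyl_base z)) (cyl_point x r)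
       = (of_nat (2 * m) * r ^ (2 * m - 1) * ln r + r ^ (2 * m) / r) * \<zeta> x"
      using pderiv_radial_mult_base(1)[OF d2, of "cyl_point x r" \<zeta>] \<zeta>' that by simp
    have "pderiv_at None (\<lambda>z. \<Sum>k\<le>K. (z $ None) ^ (2 * k) * \<eta> k (cyl_base z)) (cyl_point x r)
       = (\<Sum>k\<le>K. of_nat (2 * k) * r ^ (2 * k - 1) * \<eta> k x)"
      using diffs by (subst pderiv_at_sum) (auto simp only: atMost_iff 1 intro!: sum.cong)
    then show ?thesis using diffs diffl[OF that]
      by (subst pderiv_at_add) (auto simp only: 2 intro!: differentiable_sum)
  qed
  have pS: "pderiv_at (Some i) ?\<Phi> (cyl_point x r) =
     (\<Sum>k\<le>K. r ^ (2 * k) * pderiv_at i (\<eta> k) x) + r ^ (2 * m) * ln r * pderiv_at i \<zeta> x"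
    if "r > 0" for r i
  proof -
    have 1: "pderiv_at (Some i) (\<lambda>z. (z $ None) ^ (2 * k) * \<eta> k (cyl_base z)) (cyl_point x r)
       = r ^ (2 * k) * pderiv_at i (\<eta> k) x" if "k \<le> K" for k
      using pderiv_radial_mult_base(2)[OF d1, of "\<eta> k" "cyl_point x r" i k] \<eta>[OF that] by simp
    have 2: "pderiv_at (Some i) (\<lambda>z. (z $ None) ^ (2 * m) * ln (z $ None) * \<zeta> (cyl_base z)) (cyl_point x r)
       = r ^ (2 * m) * ln r * pderiv_at i \<zeta> x"
      using pderiv_radial_mult_base(2)[OF d2, of "cyl_point x r" \<zeta> i] \<zeta>' that by simp
    have "pderiv_at (Some i) (\<lambda>z. \<Sum>k\<le>K. (z $ None) ^ (2 * k) * \<eta> k (cyl_base z)) (cyl_point x r)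
       = (\<Sum>k\<le>K. r ^ (2 * k) * pderiv_at i (\<eta> k) x)"
      using diffs by (subst pderiv_at_sum) (auto intro!: sum.cong 1)
    then show ?thesis using diffs diffl[OF that]
      by (subst pderiv_at_add) (auto simp only: 2 intro!: differentiable_sum)
  qed
  have pow: "r * r ^ (2 * k - 1) = r ^ (2 * k)" if "k > 0" for k and r :: real
    using that power_minus_mult[of "2 * k" r] by (simp add: mult.commute)
  have rpN: "r * pderiv_at None ?\<Phi> (cyl_point x r) = (\<Sum>k\<le>K. (of_nat (2 * k) * \<eta> k x + (if k = m then \<zeta> x else 0)) * r ^ (2 * k))
     + real (2 * m) * \<zeta> x * (r ^ (2 * m) * ln r)" if "r > 0" for r
  proof -
    have e: "r * (of_nat (2 * k) * r ^ (2 * k - 1) * c) = of_nat (2 * k) * c * r ^ (2 * k)" for k c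
    proof (cases "k = 0")
      case False
      have "r * (of_nat (2 * k) * r ^ (2 * k - 1) * c) = of_nat (2 * k) * c * (r * r ^ (2 * k - 1))"
        by (simp only: ac_simps)
      then show ?thesis using pow[of k r] False by simp
    qed simp
    have "(\<Sum>k\<le>K. (of_nat (2 * k) * \<eta> k x + (if k = m then \<zeta> x else 0)) * r ^ (2 * k))
       = (\<Sum>k\<le>K. of_nat (2 * k) * \<eta> k x * r ^ (2 * k)) + (\<Sum>k\<le>K. if k = m then \<zeta> x * r ^ (2 * k) else 0)"
      by (subst sum.distrib[symmetric]) (auto intro!: sum.cong simp: algebra_simps)
    also have "(\<Sum>k\<le>K. if k = m then \<zeta> x * r ^ (2 * k) else 0) = \<zeta> x * r ^ (2 * m)"
      using \<K>(1)[OF K] by simp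
    finally have s: "(\<Sum>k\<le>K. (of_nat (2 * k) * \<eta> k x + (if k = m then \<zeta> x else 0)) * r ^ (2 * k))
       = (\<Sum>k\<le>K. of_nat (2 * k) * \<eta> k x * r ^ (2 * k)) + \<zeta> x * r ^ (2 * m)" .
    have "r * pderiv_at None ?\<Phi> (cyl_point x r) = (\<Sum>k\<le>K. r * (of_nat (2 * k) * r ^ (2 * k - 1) * \<eta> k x))
       + r * (of_nat (2 * m) * r ^ (2 * m - 1) * (ln r * \<zeta> x)) + r * (r ^ (2 * m) / r) * \<zeta> x"
      unfolding pN[OF that] by (simp only: distrib_left distrib_right sum_distrib_left ac_simps)
    also have "\<dots> = (\<Sum>k\<le>K. of_nat (2 * k) * \<eta> k x * r ^ (2 * k))
       + of_nat (2 * m) * (ln r * \<zeta> x) * r ^ (2 * m) + r ^ (2 * m) * \<zeta> x"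
      unfolding e using that by simp
    finally show ?thesis unfolding s by (simp only: ac_simps)
  qed
  have "has_expansion m (\<lambda>r. \<Sum>k\<le>K. (of_nat (2 * k) * \<eta> k x + (if k = m then \<zeta> x else 0)) * r ^ (2 * k))
     (fps_euler (?\<phi> x) + fps_const (\<zeta> x) * fps_X ^ m)"
    by (rule poly) (auto simp: fps_euler_nth fps_X_power_iff)
  then show "has_log_expansion m (\<lambda>r. r * pderiv_at None ?\<Phi> (cyl_point x r))
     (fps_euler (?\<phi> x) + fps_const (\<zeta> x) * fps_X ^ m) (real (2 * m) * \<zeta> x)"
    unfolding has_log_expansion_def by (rule has_expansion_cong_pos) (simp add: rpN)
  fix i
  have "has_expansion (m - 1) (\<lambda>r. \<Sum>k\<le>K. pderiv_at i (\<eta> k) x * r ^ (2 * k)) (fps_pderiv i ?\<phi> x)"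
  proof (rule has_expansion_cong_coeffs)
    show "has_expansion (m - 1) (\<lambda>r. \<Sum>k\<le>K. pderiv_at i (\<eta> k) x * r ^ (2 * k)) (Abs_fps (\<lambda>k. pderiv_at i (\<eta> k) x))"
      by (rule has_expansion_weaken[OF poly]) auto
    fix k assume "k \<le> m - 1"
    then have "k \<le> m" by simp
    then show "fps_nth (Abs_fps (\<lambda>k. pderiv_at i (\<eta> k) x)) k = fps_nth (fps_pderiv i ?\<phi> x) k"
      by (simp add: fps_pderiv_def)
  qed
  moreover have "has_expansion (m - 1) (\<lambda>r. pderiv_at i \<zeta> x * (r ^ (2 * m) * ln r)) 0"
    using power_ln_smallo[of "m - 1" m] m by (simp add: has_expansion_def fps_trunc_eval_def)
  ultimately have "has_expansion (m - 1) (\<lambda>r. (\<Sum>k\<le>K. pderiv_at i (\<eta> k) x * r ^ (2 * k)) + pderiv_at i \<zeta> x * (r ^ (2 * m) * ln r))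
      (fps_pderiv i ?\<phi> x + 0)"
    by (rule has_expansion_add)
  then show "has_expansion (m - 1) (\<lambda>r. pderiv_at (Some i) ?\<Phi> (cyl_point x r)) (fps_pderiv i ?\<phi> x)"
    unfolding add_0_right by (rule has_expansion_cong_pos) (subst pS, simp_all add: mult.commute)
qed

section \<open>The Laplacian of a metric on the cylinder\<close>

lemma sum_option: "(\<Sum>a\<in>(UNIV :: 'n::finite option set). f a) = f None + (\<Sum>i\<in>UNIV. f (Some i))"
  by (simp add: UNIV_option_conv sum.reindex)

lemma prod_option: "(\<Prod>a\<in>(UNIV :: 'n::finite option set). f a) = f None * (\<Prod>i\<in>UNIV. f (Some i))"
  by (simp add: UNIV_option_conv prod.reindex)

text \<open>The matrix of \<open>t dr\<^sup>2 + A\<close> on the cylinder.\<close>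

definition extend_matrix :: "real \<Rightarrow> real^'n::finite^'n \<Rightarrow> real^('n option)^('n option)" where
  "extend_matrix t A = (\<chi> a b. case (a, b) of (None, None) \<Rightarrow> t | (Some i, Some j) \<Rightarrow> A $ i $ j | _ \<Rightarrow> 0)"

lemma extend_matrix_nth [simp]:
  "extend_matrix t A $ None $ None = t"
  "extend_matrix t A $ Some i $ Some j = A $ i $ j"
  "extend_matrix t A $ None $ Some j = 0"
  "extend_matrix t A $ Some i $ None = 0"
  by (simp_all add: extend_matrix_def)

lemma vec_eq_option_iff:
  "(A :: real^('n::finite option)^('n option)) = B \<longleftrightarrow>
     A $ None $ None = B $ None $ None \<and> (\<forall>j. A $ None $ Some j = B $ None $ Some j) \<and>
     (\<forall>i. A $ Some i $ None = B $ Some i $ None) \<and> (\<forall>i j. A $ Some i $ Some j = B $ Some i $ Some j)"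
  by (auto simp: vec_eq_iff split_option_all)

lemma extend_matrix_mult: "extend_matrix s A ** extend_matrix t B = extend_matrix (s * t) (A ** B)"
  by (simp add: vec_eq_option_iff matrix_matrix_mult_def sum_option)

lemma extend_matrix_mat: "extend_matrix 1 (mat 1) = mat 1"
  by (simp add: vec_eq_option_iff mat_def)

lemma det_transposition_matrix:
  assumes "p \<noteq> q"
  shows "det ((\<chi> i j. mat 1 $ i $ Transposition.transpose p q j) :: real^'k::finite^'k) = -1"
  using assms det_permute_columns[of "Transposition.transpose p q" "mat 1 :: real^'k^'k"]
  by (simp add: permutes_swap_id sign_swap_id)

lemma det_shear_matrix:
  assumes "p \<noteq> q"
  shows "det ((\<chi> i j. if i = p \<and> j = q then c else of_bool (i = j)) :: real^'k::finite^'k) = 1"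
proof -
  have "((\<chi> i j. if i = p \<and> j = q then c else of_bool (i = j)) :: real^'k^'k)
     = (\<chi> k. if k = p then row p (mat 1) + c *s row q (mat 1) else row k (mat 1))"
    using assms by (auto simp: vec_eq_iff row_def mat_def)
  then show ?thesis using det_row_operation[OF assms, of "mat 1 :: real^'k^'k" c] by simp
qed

text \<open>Both sides are multiplicative in \<open>A\<close>, so it suffices to compare them on elementary matrices.\<close>

lemma det_extend_matrix_1: "det (extend_matrix 1 A) = det A"
proof (induction A rule: induct_matrix_elementary)
  case (1 A B)
  have "extend_matrix 1 (A ** B) = extend_matrix 1 A ** extend_matrix 1 B"
    by (simp add: extend_matrix_mult)
  then show ?case using 1 by (simp add: det_mul)
next
  case (2 A i)
  then have "row (Some i) (extend_matrix 1 A) = 0"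
    by (simp add: row_def vec_eq_iff split_option_all)
  then show ?case using 2 by (simp add: det_zero_row)
next
  case (3 A)
  have "det (extend_matrix 1 A) = (\<Prod>a\<in>UNIV. extend_matrix 1 A $ a $ a)"
  proof (rule det_diagonal)
    fix a b :: "'a option" assume "a \<noteq> b"
    then show "extend_matrix 1 A $ a $ b = 0" using 3 by (cases a; cases b) auto
  qed
  then show ?case using det_diagonal[of A] 3 by (simp add: prod_option)
next
  case (4 m n)
  have "extend_matrix 1 (\<chi> i j. mat 1 $ i $ Transposition.transpose m n j)
     = (\<chi> a b. mat 1 $ a $ Transposition.transpose (Some m) (Some n) b)"
    by (auto simp: vec_eq_option_iff mat_def Transposition.transpose_def)
  then show ?case using 4 by (simp add: det_transposition_matrix)
next
  case (5 m n c)
  have "extend_matrix 1 (\<chi> i j. if i = m \<and> j = n then c else of_bool (i = j))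
     = (\<chi> a b. if a = Some m \<and> b = Some n then c else of_bool (a = b))"
    by (auto simp: vec_eq_option_iff)
  then show ?case using 5 by (simp add: det_shear_matrix)
qed

lemma det_scaleR: "det (c *\<^sub>R A :: real^'k::finite^'k) = c ^ CARD('k) * det A"
proof -
  have "c *\<^sub>R A = (c *\<^sub>R mat 1) ** A"
    by (metis matrix_mul_lid scalar_matrix_assoc)
  moreover have "det (c *\<^sub>R mat 1 :: real^'k^'k) = c ^ CARD('k)"
    by (subst det_diagonal) (simp_all add: mat_def)
  ultimately show ?thesis by (simp add: det_mul)
qed

lemma matrix_inv_eqI:
  fixes A :: "real^'k::finite^'k"
  assumes "A ** B = mat 1" shows "matrix_inv A = B"
proof -
  have BA: "B ** A = mat 1" using assms by (simp add: matrix_left_right_inverse)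
  have "A ** matrix_inv A = mat 1 \<and> matrix_inv A ** A = mat 1"
    unfolding matrix_inv_def by (rule someI[of "\<lambda>C. A ** C = mat 1 \<and> C ** A = mat 1" B]) (simp add: assms BA)
  then have "B ** (A ** matrix_inv A) = B" by simp
  then show ?thesis by (simp add: matrix_mul_assoc BA)
qed

text \<open>The numerator in Cramer's rule for the entry \<open>(i, j)\<close> of the inverse matrix. Unlike the inverse, it is a
polynomial in the entries of \<open>A\<close>.\<close>

definition cofactor :: "real^'k::finite^'k \<Rightarrow> 'k \<Rightarrow> 'k \<Rightarrow> real" where
  "cofactor A i j = det (\<chi> k l. if l = i then axis j 1 $ k else A $ k $ l)"

lemma matrix_mult_cofactor:
  fixes A :: "real^'k::finite^'k"
  assumes "det A \<noteq> 0" shows "A ** (\<chi> i j. cofactor A i j / det A) = mat 1"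
proof -
  have "A *v (\<chi> i. cofactor A i j / det A) = axis j 1" for j
    unfolding cofactor_def using cramer[OF assms, of _ "axis j 1"] by blast
  then have "(\<Sum>k\<in>UNIV. A $ i $ k * (cofactor A k j / det A)) = axis j 1 $ i" for i j
    by (metis (no_types, lifting) matrix_vector_mult_def vec_lambda_beta sum.cong)
  then show ?thesis by (simp add: vec_eq_iff matrix_matrix_mult_def mat_def axis_def eq_commute)
qed

lemma g_plus_eq: "g_plus H z = (1 / (z $ None)\<^sup>2) *\<^sub>R extend_matrix 1 (H (z $ None) (cyl_base z))"
  by (simp add: vec_eq_option_iff g_plus_def)

lemma sqrt_det_g_plus:
  fixes z :: "real^('n::finite option)"
  assumes "z $ None > 0"
  shows "sqrt (det (g_plus H z)) = sqrt (det (H (z $ None) (cyl_base z))) / (z $ None) ^ (CARD('n) + 1)"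
proof -
  have "sqrt ((1 / (z $ None)\<^sup>2) ^ (CARD('n) + 1)) = sqrt (1 / (z $ None)\<^sup>2) ^ (CARD('n) + 1)"
    by (rule real_sqrt_power)
  also have "\<dots> = (1 / z $ None) ^ (CARD('n) + 1)"
    using assms by (simp add: real_sqrt_divide)
  finally have "sqrt ((1 / (z $ None)\<^sup>2) ^ (CARD('n) + 1)) = (1 / z $ None) ^ (CARD('n) + 1)" .
  moreover have "det (g_plus H z) = (1 / (z $ None)\<^sup>2) ^ (CARD('n) + 1) * det (H (z $ None) (cyl_base z))"
    by (simp add: g_plus_eq det_scaleR det_extend_matrix_1)
  ultimately show ?thesis by (simp only: real_sqrt_mult) (simp add: power_one_over)
qed

lemma matrix_inv_g_plus:
  fixes z :: "real^('n::finite option)"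
  assumes "z $ None > 0" and d: "det (H (z $ None) (cyl_base z)) \<noteq> 0"
  shows "matrix_inv (g_plus H z) = (z $ None)\<^sup>2 *\<^sub>R extend_matrix 1
     (\<chi> i j. cofactor (H (z $ None) (cyl_base z)) i j / det (H (z $ None) (cyl_base z)))"
proof (rule matrix_inv_eqI)
  have "(c *\<^sub>R A) ** (d *\<^sub>R B) = (c * d) *\<^sub>R (A ** B)" for c d and A B :: "real^('n option)^('n option)"
    by (simp add: vec_eq_iff matrix_matrix_mult_def sum_distrib_left ac_simps)
  then show "g_plus H z ** ((z $ None)\<^sup>2 *\<^sub>R extend_matrix 1
     (\<chi> i j. cofactor (H (z $ None) (cyl_base z)) i j / det (H (z $ None) (cyl_base z)))) = mat 1"
    using assms(1) by (simp add: g_plus_eq extend_matrix_mult matrix_mult_cofactor[OF d] extend_matrix_mat)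
qed

lemma differentiable_det:
  fixes M :: "real^'m::finite \<Rightarrow> real^'k::finite^'k"
  assumes "\<And>i j. (\<lambda>z. M z $ i $ j) differentiable (at y)"
  shows "(\<lambda>z. det (M z)) differentiable (at y)"
proof -
  have "(\<lambda>z. \<Prod>i\<in>I. M z $ i $ p i) differentiable (at y)" if "finite I" for I p
    using that by induction (use assms in auto)
  then show ?thesis unfolding det_def by (intro differentiable_sum differentiable_mult) auto
qed

lemma differentiable_cofactor:
  fixes M :: "real^'m::finite \<Rightarrow> real^'k::finite^'k"
  assumes "\<And>i j. (\<lambda>z. M z $ i $ j) differentiable (at y)"
  shows "(\<lambda>z. cofactor (M z) i j) differentiable (at y)"
  unfolding cofactor_def
proof (rule differentiable_det)
  fix k l show "(\<lambda>z. (\<chi> k l. if l = i then axis j 1 $ k else M z $ k $ l) $ k $ l) differentiable at y"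
    using assms by (cases "l = i") auto
qed

text \<open>The factor \<open>P\<^sup>2\<close> clears all denominators in \<open>h\<^sub>r\<^sup>-\<^sup>1 = B / P\<close> and in the derivatives of \<open>sqrt P\<close>, so the right-hand
side only involves quantities with a known expansion. The grouping of powers of \<open>r\<close> with derivatives is the
one for which every factor, divided by \<open>r\<^bsup>lam\<^esup>\<close>, is a power series in \<open>r\<^sup>2\<close>.\<close>

lemma laplacian_g_plus:
  fixes H :: "real \<Rightarrow> real^'n::finite \<Rightarrow> real^'n^'n" and u :: "real^('n option) \<Rightarrow> complex"
  defines "M \<equiv> \<lambda>z. H (z $ None) (cyl_base z)"
  defines "P \<equiv> \<lambda>z. det (M z)"
  defines "B \<equiv> \<lambda>i j z. cofactor (M z) i j"
  assumes W: "open W" "y \<in> W" "\<And>z. z \<in> W \<Longrightarrow> z $ None > 0"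
    and M: "\<And>z i j. z \<in> W \<Longrightarrow> (\<lambda>z. M z $ i $ j) differentiable (at z)"
    and P: "P y > 0"
    and u: "\<And>a. pderiv_at a u differentiable (at y)"
  defines "r \<equiv> y $ None"
  shows "(complex_of_real (P y))\<^sup>2 * laplacian (g_plus H) u y =
     (P y)\<^sup>2 * ((1 - of_nat CARD('n)) * (r * pderiv_at None u y) + r\<^sup>2 * pderiv_at None (pderiv_at None u) y)
     + of_real (P y) / 2 * of_real (r * pderiv_at None P y) * (r * pderiv_at None u y)
     + r\<^sup>2 * (\<Sum>i\<in>UNIV. \<Sum>j\<in>UNIV.
          of_real (P y) * (of_real (pderiv_at (Some i) (B i j) y) * pderiv_at (Some j) u y
            + of_real (B i j y) * pderiv_at (Some i) (pderiv_at (Some j) u) y)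
          - of_real (pderiv_at (Some i) P y) / 2 * of_real (B i j y) * pderiv_at (Some j) u y)"
proof -
  let ?n = "CARD('n)"
  let ?X = "pderiv_at None (pderiv_at None u) y
        + ((1 - real ?n) / r) *\<^sub>R pderiv_at None u y + (pderiv_at None P y / (2 * P y)) *\<^sub>R pderiv_at None u y"
  let ?Y = "\<lambda>i j. (B i j y / P y) *\<^sub>R pderiv_at (Some i) (pderiv_at (Some j) u) y
       + (pderiv_at (Some i) (B i j) y / P y - B i j y * pderiv_at (Some i) P y / (2 * (P y)\<^sup>2)) *\<^sub>R pderiv_at (Some j) u y"
  \<comment> \<open>The radial factor of \<open>sqrt (det g) g\<^sup>-\<^sup>1\<close>, which is \<open>t\<close> to the power \<open>1 - n\<close>.\<close>
  define \<rho> where "\<rho> = (\<lambda>t::real. t\<^sup>2 / t ^ (?n + 1))"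
  define S where "S = {z \<in> W. P z > 0}"
  have r: "r > 0" unfolding r_def using W by blast
  have Pd: "P differentiable (at z)" if "z \<in> W" for z
    unfolding P_def by (rule differentiable_det) (rule M[OF that])
  have Bd: "B i j differentiable (at z)" if "z \<in> W" for z i j
    unfolding B_def by (rule differentiable_cofactor) (rule M[OF that])
  have "continuous_on W P"
    using Pd by (intro continuous_at_imp_continuous_on ballI differentiable_imp_continuous_within)
  then have S: "open S" unfolding S_def using W(1)
    using continuous_open_preimage[of W P "{0<..}"] by (simp add: vimage_def Int_def)
  have yS: "y \<in> S" using P W by (simp add: S_def)
  have \<rho>': "(\<rho> has_real_derivative (1 - real ?n) * \<rho> r / r) (at r)"
    unfolding \<rho>_def using r
    by (intro DERIV_cong[OF DERIV_divide[OF DERIV_power[OF DERIV_ident] DERIV_power[OF DERIV_ident]]])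
       (auto simp: field_simps power2_eq_square)
  note \<rho>'' = pderiv_radial[of \<rho> _ y, folded r_def, OF \<rho>'[unfolded has_real_derivative_iff_has_vector_derivative]]
  have Py: "P differentiable (at y)" "B i j differentiable (at y)" for i j using Pd Bd W(2) by auto
  have sq: "(sqrt has_vector_derivative inverse (sqrt (P y)) / 2) (at (P y))"
    unfolding has_real_derivative_iff_has_vector_derivative[symmetric]
    using P by (auto intro!: derivative_eq_intros)
  have isq: "((\<lambda>t. inverse (sqrt t)) has_vector_derivative - inverse (sqrt (P y)) / (2 * P y)) (at (P y))"
    unfolding has_real_derivative_iff_has_vector_derivative[symmetric]
    using P by (auto intro!: derivative_eq_intros simp: field_simps)
  note sq' = pderiv_at_compose_real[OF sq Py(1)] differentiable_compose_real[OF sq Py(1)]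
  note isq' = pderiv_at_compose_real[OF isq Py(1)] differentiable_compose_real[OF isq Py(1)]
  define f where "f a b z = sqrt (det (g_plus H z)) * matrix_inv (g_plus H z) $ a $ b" for a b z
  have f: "f None None z = \<rho> (z $ None) * sqrt (P z)" "f None (Some j) z = 0" "f (Some i) None z = 0"
      "f (Some i) (Some j) z = \<rho> (z $ None) * (B i j z * inverse (sqrt (P z)))"
    if "z \<in> S" for z i j
  proof -
    have z: "z $ None > 0" "P z > 0" using that W(3) by (auto simp: S_def)
    then have "det (H (z $ None) (cyl_base z)) \<noteq> 0" by (simp add: P_def M_def)
    note inv = matrix_inv_g_plus[where H=H, OF z(1) this] and sqrtd = sqrt_det_g_plus[OF z(1), of H]
    have s: "sqrt (P z) / P z = inverse (sqrt (P z))"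
      using z(2) by (simp add: field_simps)
    show "f None None z = \<rho> (z $ None) * sqrt (P z)" "f None (Some j) z = 0" "f (Some i) None z = 0"
      using z by (simp_all add: f_def inv sqrtd \<rho>_def P_def M_def field_simps)
    have "f (Some i) (Some j) z = \<rho> (z $ None) * (B i j z * (sqrt (P z) / P z))"
      using z by (simp add: f_def inv sqrtd \<rho>_def P_def M_def B_def)
    then show "f (Some i) (Some j) z = \<rho> (z $ None) * (B i j z * inverse (sqrt (P z)))" unfolding s .
  qed
  have cong: "pderiv_at a (\<lambda>z. f a b z *\<^sub>R pderiv_at b u z) y = pderiv_at a (\<lambda>z. k z *\<^sub>R pderiv_at b u z) y"
    if "\<And>z. z \<in> S \<Longrightarrow> f a b z = k z" for a b k
    using that by (intro pderiv_at_cong[OF S yS]) auto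
  have NN: "pderiv_at None (\<lambda>z. f None None z *\<^sub>R pderiv_at None u z) y =
     (\<rho> r * sqrt (P y)) *\<^sub>R ?X"
  proof -
    have "pderiv_at None (\<lambda>z. f None None z *\<^sub>R pderiv_at None u z) y =
       (\<rho> r * sqrt (P y)) *\<^sub>R pderiv_at None (pderiv_at None u) y
       + (\<rho> r * (pderiv_at None P y * (inverse (sqrt (P y)) / 2)) + (1 - real ?n) * \<rho> r / r * sqrt (P y)) *\<^sub>R pderiv_at None u y"
      by (subst cong[of None None "\<lambda>z. \<rho> (z $ None) * sqrt (P z)"], rule f(1), assumption, subst pderiv_at_scaleR) (use u sq' \<rho>'' in \<open>auto simp: pderiv_at_mult r_def\<close>)
    also have "pderiv_at None P y * (inverse (sqrt (P y)) / 2) = sqrt (P y) * (pderiv_at None P y / (2 * P y))"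
      using P by (simp add: field_simps)
    finally show ?thesis by (simp add: algebra_simps)
  qed
  have SS: "pderiv_at (Some i) (\<lambda>z. f (Some i) (Some j) z *\<^sub>R pderiv_at (Some j) u z) y =
     (\<rho> r * sqrt (P y)) *\<^sub>R (?Y i j)"
    for i j
  proof -
    have "pderiv_at (Some i) (\<lambda>z. f (Some i) (Some j) z *\<^sub>R pderiv_at (Some j) u z) y =
       (\<rho> r * (B i j y * inverse (sqrt (P y)))) *\<^sub>R pderiv_at (Some i) (pderiv_at (Some j) u) y
       + (\<rho> r * (B i j y * (pderiv_at (Some i) P y * (- inverse (sqrt (P y)) / (2 * P y))) + pderiv_at (Some i) (B i j) y * inverse (sqrt (P y))))
          *\<^sub>R pderiv_at (Some j) u y"
      by (subst cong[of "Some i" "Some j" "\<lambda>z. \<rho> (z $ None) * (B i j z * inverse (sqrt (P z)))"], rule f(4), assumption, subst pderiv_at_scaleR) (use u isq' \<rho>'' Py in \<open>auto simp: pderiv_at_mult r_def\<close>)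
    also have "inverse (sqrt (P y)) = sqrt (P y) / P y"
      using P by (simp add: field_simps)
    finally show ?thesis using P by (simp add: algebra_simps power2_eq_square)
  qed
  have 0: "pderiv_at None (\<lambda>z. f None (Some j) z *\<^sub>R pderiv_at (Some j) u z) y = 0"
    "pderiv_at (Some j) (\<lambda>z. f (Some j) None z *\<^sub>R pderiv_at None u z) y = 0" for j
    using cong[of None "Some j" "\<lambda>z. 0", OF f(2)] cong[of "Some j" None "\<lambda>z. 0", OF f(3)] by simp_all
  have "laplacian (g_plus H) u y = (1 / sqrt (det (g_plus H y))) *\<^sub>R
     ((\<rho> r * sqrt (P y)) *\<^sub>R ?X
     + (\<Sum>i\<in>UNIV. \<Sum>j\<in>UNIV. (\<rho> r * sqrt (P y)) *\<^sub>R (?Y i j)))"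
    unfolding laplacian_def f_def[symmetric] sum_option NN SS 0 by simp
  also have "\<dots> = ((1 / sqrt (det (g_plus H y))) * (\<rho> r * sqrt (P y))) *\<^sub>R
     (?X
     + (\<Sum>i\<in>UNIV. \<Sum>j\<in>UNIV. ?Y i j))"
    by (simp only: scaleR_scaleR[symmetric] scaleR_sum_right[symmetric] scaleR_add_right[symmetric])
  also have "(1 / sqrt (det (g_plus H y))) * (\<rho> r * sqrt (P y)) = r\<^sup>2"
    using sqrt_det_g_plus[of y H] r P by (simp add: r_def P_def M_def \<rho>_def field_simps)
  finally have lap: "laplacian (g_plus H) u y = r\<^sup>2 *\<^sub>R
     (?X
     + (\<Sum>i\<in>UNIV. \<Sum>j\<in>UNIV. ?Y i j))" .
  define S1 where "S1 = (\<Sum>i\<in>UNIV. \<Sum>j\<in>UNIV. ?Y i j)"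
  have s: "(complex_of_real (P y))\<^sup>2 * S1 = (\<Sum>i\<in>UNIV. \<Sum>j\<in>UNIV.
          of_real (P y) * (of_real (pderiv_at (Some i) (B i j) y) * pderiv_at (Some j) u y
            + of_real (B i j y) * pderiv_at (Some i) (pderiv_at (Some j) u) y)
          - of_real (pderiv_at (Some i) P y) / 2 * of_real (B i j y) * pderiv_at (Some j) u y)"
    unfolding S1_def sum_distrib_left using P
    by (intro sum.cong refl) (simp add: scaleR_conv_of_real field_simps power2_eq_square)
  have c: "complex_of_real (P y) \<noteq> 0" "complex_of_real r \<noteq> 0" using P r by auto
  show ?thesis unfolding lap S1_def[symmetric] s[symmetric] using c
    by (simp add: scaleR_conv_of_real field_simps power2_eq_square)
qed

section \<open>The divergence identity in a chart\<close>

text \<open>The metric has real coefficients, while the eigenfunction is complex.\<close>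

definition fps_of_real :: "real fps \<Rightarrow> complex fps" where
  "fps_of_real \<phi> = Abs_fps (\<lambda>k. complex_of_real (fps_nth \<phi> k))"

lemma fps_of_real_nth [simp]: "fps_nth (fps_of_real \<phi>) k = complex_of_real (fps_nth \<phi> k)"
  by (simp add: fps_of_real_def)

lemma fps_of_real_mult: "fps_of_real (\<phi> * \<psi>) = fps_of_real \<phi> * fps_of_real \<psi>"
  by (simp add: fps_eq_iff fps_mult_nth)

lemma fps_of_real_add: "fps_of_real (\<phi> + \<psi>) = fps_of_real \<phi> + fps_of_real \<psi>"
  and fps_of_real_minus: "fps_of_real (- \<phi>) = - fps_of_real \<phi>"
  and fps_of_real_1: "fps_of_real 1 = 1"
  by (simp_all add: fps_eq_iff)

lemma fps_of_real_euler: "fps_of_real (fps_euler \<phi>) = fps_euler (fps_of_real \<phi>)"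
  by (simp add: fps_eq_iff fps_euler_nth)

lemma fps_C1_on_of_real: "fps_C1_on U \<phi> \<Longrightarrow> fps_C1_on U (\<lambda>x. fps_of_real (\<phi> x))"
  by (auto simp: fps_C1_on_def intro: C1_on_bounded_linear[OF bounded_linear_of_real])

lemma fps_pderiv_of_real:
  "fps_C1_on U \<phi> \<Longrightarrow> x \<in> U \<Longrightarrow> fps_pderiv i (\<lambda>x. fps_of_real (\<phi> x)) x = fps_of_real (fps_pderiv i \<phi> x)"
  by (auto simp: fps_eq_iff fps_pderiv_def fps_C1_on_differentiable
      intro!: pderiv_at_bounded_linear[OF bounded_linear_of_real])

lemma of_real_powr_add_nat:
  assumes "r > 0"
  shows "complex_of_real r powr (a + of_nat k) = complex_of_real r powr a * of_real r ^ k"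
proof -
  have "complex_of_real r powr of_nat k = of_real r ^ k"
    using assms by (simp add: powr_nat)
  then show ?thesis by (simp add: powr_add)
qed

lemma has_vector_derivative_of_real_powr:
  assumes "r > 0"
  shows "((\<lambda>r. complex_of_real r powr a) has_vector_derivative a * complex_of_real r powr (a - 1)) (at r)"
  using assms by (intro has_vector_derivative_real_field has_field_derivative_powr) auto

text \<open>Sums of complex powers of the radial coordinate with coefficients on the base.\<close>

definition radial_sum :: "nat \<Rightarrow> (nat \<Rightarrow> complex) \<Rightarrow> (nat \<Rightarrow> real^'n::finite \<Rightarrow> complex) \<Rightarrow> real^('n option) \<Rightarrow> complex" where
  "radial_sum K a c z = (\<Sum>j\<le>K. complex_of_real (z $ None) powr (a j) * c j (cyl_base z))"

lemma radial_sum_derivatives: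
  assumes r: "y $ None > 0" and c: "\<And>j. c j differentiable (at (cyl_base y))"
  shows "radial_sum K a c differentiable (at y)"
    "pderiv_at None (radial_sum K a c) y = radial_sum K (\<lambda>j. a j - 1) (\<lambda>j x. a j * c j x) y"
    "pderiv_at (Some i) (radial_sum K a c) y = radial_sum K a (\<lambda>j. pderiv_at i (c j)) y"
proof -
  note * = pderiv_radial_mult_base[OF has_vector_derivative_of_real_powr[OF r] c]
  show "radial_sum K a c differentiable (at y)"
    unfolding radial_sum_def by (intro differentiable_sum) (auto intro: *(3))
  show "pderiv_at None (radial_sum K a c) y = radial_sum K (\<lambda>j. a j - 1) (\<lambda>j x. a j * c j x) y"
    unfolding radial_sum_def by (subst pderiv_at_sum) (auto intro: *(3) simp: *(1) mult.left_commute mult.assoc)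
  show "pderiv_at (Some i) (radial_sum K a c) y = radial_sum K a (\<lambda>j. pderiv_at i (c j)) y"
    unfolding radial_sum_def by (subst pderiv_at_sum) (auto intro: *(3) simp: *(2))
qed

text \<open>Here \<open>s\<close> counts the radial derivatives taken, each of which lowers the exponents by one.\<close>

lemma radial_sum_normalized:
  assumes "r > 0"
  shows "complex_of_real r powr (- lam) * (of_real r ^ s * radial_sum K (\<lambda>j. lam + 2 * of_nat j - of_nat s) c (cyl_point x r))
    = (\<Sum>k\<le>K. c k x * of_real r ^ (2 * k))"
proof -
  have "complex_of_real r powr (- lam) * (of_real r ^ s * complex_of_real r powr (lam + 2 * of_nat j - of_nat s)) = of_real r ^ (2 * j)" for j
  proof -
    have "complex_of_real r powr (lam + 2 * of_nat j - of_nat s) * of_real r ^ s = complex_of_real r powr (lam + of_nat (2 * j))"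
      using of_real_powr_add_nat[OF assms, of "lam + 2 * of_nat j - of_nat s" s] by simp
    also have "\<dots> = complex_of_real r powr lam * of_real r ^ (2 * j)"
      by (rule of_real_powr_add_nat[OF assms])
    finally have *: "complex_of_real r powr (lam + 2 * of_nat j - of_nat s) * of_real r ^ s = complex_of_real r powr lam * of_real r ^ (2 * j)" .
    have "complex_of_real r powr (- lam) * complex_of_real r powr lam = 1"
      using assms powr_add[of "complex_of_real r" "- lam" lam] by simp
    with * show ?thesis by (metis mult.assoc mult.commute mult_1)
  qed
  note * = this
  have "complex_of_real r powr (- lam) * (of_real r ^ s * radial_sum K (\<lambda>j. lam + 2 * of_nat j - of_nat s) c (cyl_point x r))
     = (\<Sum>j\<le>K. (complex_of_real r powr (- lam) * (of_real r ^ s * complex_of_real r powr (lam + 2 * of_nat j - of_nat s))) * c j x)"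
    by (simp add: radial_sum_def sum_distrib_left mult.assoc)
  then show ?thesis unfolding * by (simp add: mult.commute)
qed

lemma open_cylinder: "open U \<Longrightarrow> open {z. z $ None > 0 \<and> cyl_base z \<in> (U :: (real^'n::finite) set)}"
proof -
  assume U: "open U"
  have "open (cyl_base -` U)"
    using continuous_open_vimage[OF U] linear_continuous_at[OF bounded_linear_cyl_base] by blast
  moreover have "open {z :: real^('n option). z $ None > 0}"
    by (rule open_Collect_less) (auto intro: continuous_intros)
  ultimately have "open ({z. z $ None > 0} \<inter> cyl_base -` U)" by (rule open_Int[rotated])
  then show ?thesis by (simp add: vimage_def Int_def)
qed

lemma cyl_point_eta: "cyl_point (cyl_base z) (z $ None) = z"
  by (auto simp: cyl_point_def cyl_base_def vec_eq_iff split: option.split)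

text \<open>The hypothesis on \<open>sqrt P\<close> is an expansion of values only, and it is available at each point for some \<open>K\<close>
only. Comparing it with the given expansion of \<open>P\<close> excludes the logarithm and identifies the coefficients on
all of \<open>U\<close>, hence also their derivatives.\<close>

lemma jet_expansion_square_root:
  fixes w :: "real^'n::finite \<Rightarrow> real fps"
  assumes U: "open U" and m: "m \<ge> 1"
    and P: "jet_expansion \<K> m U P \<phi> a"
    and pos: "\<And>K x. K \<in> \<K> \<Longrightarrow> x \<in> U \<Longrightarrow> \<forall>\<^sub>F r in at_right 0. P K (cyl_point x r) > 0"
    and w: "fps_C1_on U w"
    and root: "\<And>x. x \<in> U \<Longrightarrow> \<exists>K\<in>\<K>. has_expansion m (\<lambda>r. sqrt (P K (cyl_point x r))) (w x)"
  shows "jet_expansion \<K> m U P (\<lambda>x. w x * w x) (\<lambda>x. 0)"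
proof -
  have eq: "a x = 0" "k \<le> m \<Longrightarrow> fps_nth (\<phi> x) k = fps_nth (w x * w x) k" if x: "x \<in> U" for x k
  proof -
    obtain K where K: "K \<in> \<K>" "has_expansion m (\<lambda>r. sqrt (P K (cyl_point x r))) (w x)"
      using root[OF x] by blast
    have "has_expansion m (\<lambda>r. P K (cyl_point x r)) (w x * w x)"
      by (rule has_expansion_cong_eventually[OF has_expansion_mult[OF K(2) K(2)]])
         (use pos[OF K(1) that] in eventually_elim, simp)
    moreover have "has_log_expansion m (\<lambda>r. P K (cyl_point x r)) (\<phi> x) (a x)"
      using P K(1) that by (auto simp: jet_expansion_def)
    ultimately show "a x = 0" "k \<le> m \<Longrightarrow> fps_nth (\<phi> x) k = fps_nth (w x * w x) k"
      using has_log_expansion_unique m by blast+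
  qed
  show ?thesis unfolding jet_expansion_def
  proof (intro conjI ballI allI impI)
    show "fps_C1_on U (\<lambda>x. w x * w x)" using w by (intro fps_C1_on_mult)
  next
    fix K x assume K: "K \<in> \<K>" and x: "x \<in> U"
    have P': "has_log_expansion m (\<lambda>r. P K (cyl_point x r)) (\<phi> x) 0"
      "has_log_expansion m (\<lambda>r. r * pderiv_at None (P K) (cyl_point x r)) (fps_euler (\<phi> x)) 0"
      "has_expansion (m - 1) (\<lambda>r. pderiv_at (Some i) (P K) (cyl_point x r)) (fps_pderiv i \<phi> x)" for i
      using jet_expansionD(2-4)[OF P K x] unfolding eq(1)[OF x] by simp_all
    show "has_log_expansion m (\<lambda>r. P K (cyl_point x r)) (w x * w x) 0"
      by (rule has_log_expansion_cong_coeffs[OF P'(1)]) (rule eq(2)[OF x])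
    show "has_log_expansion m (\<lambda>r. r * pderiv_at None (P K) (cyl_point x r))
        (fps_euler (w x * w x) + fps_const 0 * fps_X ^ m) (real (2 * m) * 0)"
      using has_log_expansion_cong_coeffs[OF P'(2), of "fps_euler (w x * w x)"] eq(2)[OF x] by (simp add: fps_euler_nth)
    show "has_expansion (m - 1) (\<lambda>r. pderiv_at (Some i) (P K) (cyl_point x r)) (fps_pderiv i (\<lambda>x. w x * w x) x)" for i
    proof (rule has_expansion_cong_coeffs[OF P'(3)])
      fix k assume "k \<le> m - 1"
      then have "k \<le> m" by simp
      then show "fps_nth (fps_pderiv i \<phi> x) k = fps_nth (fps_pderiv i (\<lambda>x. w x * w x) x) k"
        unfolding fps_pderiv_def using eq(2) by (auto intro!: pderiv_at_cong[OF U x])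
    qed
    show "P K differentiable at (cyl_point x r)" if "r > 0" for r
      using P K x that by (auto simp: jet_expansion_def)
  qed
qed

text \<open>The coefficient of \<open>r\<^bsup>lam+2N\<^esup>\<close> in the eigenfunction equation, at a point of a chart. The vector field is
\<open>G\<^sub>i = \<Sum>j. w\<^sup>-\<^sup>1 B\<^sub>i\<^sub>j \<partial>\<^sub>j u\<close>, or rather its coefficient of \<open>r\<^bsup>2N-2\<^esup>\<close>; this is the expansion of
\<open>sqrt (det h\<^sub>r) h\<^sub>r\<^sup>-\<^sup>1 \<partial>u\<close>, as \<open>w\<close> is that of \<open>sqrt (det h\<^sub>r)\<close>. It vanishes wherever the differentials of all
\<open>u k\<close> vanish, which makes its support compact when \<open>f\<close> has compact support.\<close>

lemma divergence_identity:
  fixes H :: "nat \<Rightarrow> real \<Rightarrow> real^'n::finite \<Rightarrow> real^'n^'n" and u :: "nat \<Rightarrow> real^'n \<Rightarrow> complex"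
    and lam :: complex and w :: "real^'n \<Rightarrow> real fps"
  assumes U: "open U" and m: "m \<ge> 1" and \<K>: "\<And>K. K \<in> \<K> \<Longrightarrow> m \<le> K"
    and H: "\<And>i j. \<exists>\<phi> a. jet_expansion \<K> m U (\<lambda>K z. H K (z $ None) (cyl_base z) $ i $ j) \<phi> a"
    and lim: "\<And>K x. K \<in> \<K> \<Longrightarrow> x \<in> U \<Longrightarrow> ((\<lambda>r. det (H K r x)) \<longlongrightarrow> d x) (at_right 0)"
    and d: "\<And>x. x \<in> U \<Longrightarrow> d x > 0"
    and w: "fps_C1_on U w"
    and root: "\<And>x. x \<in> U \<Longrightarrow> \<exists>K\<in>\<K>. has_expansion m (\<lambda>r. sqrt (det (H K r x))) (w x)"
    and u: "\<And>k. smooth_on U (u k)"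
    and eigen: "\<And>x. x \<in> U \<Longrightarrow> \<exists>K\<in>\<K>.
      (\<lambda>r. complex_of_real r powr (- lam) *
        (laplacian (g_plus (H K)) (radial_sum K (\<lambda>j. lam + 2 * of_nat j) u) (cyl_point x r)
         + lam * (of_nat CARD('n) - lam) * radial_sum K (\<lambda>j. lam + 2 * of_nat j) u (cyl_point x r)))
      \<in> o[at_right 0](\<lambda>r. of_real r ^ (2 * m))"
    and N: "1 \<le> N" "N \<le> m"
  shows "\<exists>G. (\<forall>i. C1_on U (G i)) \<and>
    (\<forall>x\<in>U. (\<forall>k j. pderiv_at j (u k) x = 0) \<longrightarrow> (\<forall>i. G i x = 0)) \<and>
    (\<forall>x\<in>U. (\<Sum>j\<le>N. 2 * (lam * of_nat N + of_nat j * (lam - of_nat CARD('n) + 2 * of_nat N))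
        * of_real (fps_nth (w x) (N - j)) * u j x) + (\<Sum>i\<in>UNIV. pderiv_at i (G i) x) = 0)"
proof -
  let ?n = "CARD('n)"
  define P where "P K z = det (H K (z $ None) (cyl_base z))" for K and z :: "real^('n option)"
  define B where "B i j K z = cofactor (H K (z $ None) (cyl_base z)) i j" for i j K and z :: "real^('n option)"
  have pos: "\<forall>\<^sub>F r in at_right 0. P K (cyl_point x r) > 0" if "K \<in> \<K>" "x \<in> U" for K x
    using order_tendstoD(1)[OF lim[OF that] d[OF that(2)]] by (simp add: P_def)
  obtain \<phi>P aP where "jet_expansion \<K> m U P \<phi>P aP"
    using jet_expansion_det_ex[OF m, of \<K> U "\<lambda>K z. H K (z $ None) (cyl_base z)"] H by (auto simp: P_def[abs_def])
  from jet_expansion_square_root[OF U m this pos w] root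
  have P: "jet_expansion \<K> m U P (\<lambda>x. w x * w x) (\<lambda>x. 0)" by (simp add: P_def[abs_def])
  have "\<exists>\<phi> a. jet_expansion \<K> m U (B i j) \<phi> a" for i j
    unfolding B_def cofactor_def
  proof (rule jet_expansion_det_ex[OF m])
    fix k l
    show "\<exists>\<phi> a. jet_expansion \<K> m U (\<lambda>K z. (\<chi> k l. if l = i then axis j 1 $ k
        else H K (z $ None) (cyl_base z) $ k $ l) $ k $ l) \<phi> a"
      using H[of k l] by (cases "l = i") (auto intro: jet_expansion_const)
  qed
  then obtain b where "\<forall>i j. \<exists>a. jet_expansion \<K> m U (B i j) (b i j) a" by metis
  then obtain aB where B: "jet_expansion \<K> m U (B i j) (b i j) (aB i j)" for i j by metis
  \<comment> \<open>The square of this coefficient is the limit \<open>d x > 0\<close> of \<open>P\<close>, so \<open>w x\<close> is invertible as a power series.\<close>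
  have w0: "fps_nth (w x) 0 \<noteq> 0" if x: "x \<in> U" for x
  proof -
    obtain K where K: "K \<in> \<K>" using root[OF x] by blast
    have "has_expansion m (\<lambda>r. P K (cyl_point x r)) (w x * w x)"
      using P K that by (auto simp: jet_expansion_def has_log_expansion_zero_iff)
    from has_expansion_imp_tendsto[OF this]
    have "((\<lambda>r. P K (cyl_point x r)) \<longlongrightarrow> (fps_nth (w x) 0)\<^sup>2) (at_right 0)"
      by (simp add: power2_eq_square)
    with lim[OF K that] have "(fps_nth (w x) 0)\<^sup>2 = d x"
      by (intro tendsto_unique[of "at_right (0::real)"]) (simp_all add: P_def)
    then show ?thesis using d[OF that] by auto
  qed
  define V where "V x = Abs_fps (\<lambda>k. u k x)" for x
  define V1 where "V1 x = Abs_fps (\<lambda>k. (lam + 2 * of_nat k) * u k x)" for x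
  define V2 where "V2 x = Abs_fps (\<lambda>k. (lam + 2 * of_nat k - 1) * ((lam + 2 * of_nat k) * u k x))" for x
  define dV where "dV j x = Abs_fps (\<lambda>k. pderiv_at j (u k) x)" for j x
  have dV: "fps_C1_on U (dV j)" for j
    by (auto simp: fps_C1_on_def dV_def intro!: smooth_on_imp_C1_on U smooth_on_pderiv u)
  have iw: "fps_C1_on U (\<lambda>x. inverse (w x))" by (rule fps_C1_on_inverse[OF U w w0])
  have b: "fps_C1_on U (b i j)" for i j using B by (auto simp: jet_expansion_def)
  define F where "F i j x = fps_of_real (inverse (w x) * b i j x) * dV j x" for i j x
  have F: "fps_C1_on U (F i j)" for i j
    unfolding F_def by (intro fps_C1_on_mult fps_C1_on_of_real iw b dV)
  have dF: "fps_pderiv i (F i j) x = fps_of_real (inverse (w x)) * fps_of_real (b i j x) * fps_pderiv i (dV j) x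
      + (fps_of_real (inverse (w x)) * fps_of_real (fps_pderiv i (b i j) x)
         - fps_of_real (fps_pderiv i w x) * (fps_of_real (inverse (w x)))\<^sup>2 * fps_of_real (b i j x)) * dV j x"
    if x: "x \<in> U" for i j x
  proof -
    have "fps_pderiv i (\<lambda>x. inverse (w x) * b i j x) x
        = inverse (w x) * fps_pderiv i (b i j) x - fps_pderiv i w x * (inverse (w x))\<^sup>2 * b i j x"
      using fps_pderiv_mult[OF iw b x] fps_pderiv_inverse[OF U w w0 x] by simp
    moreover have "fps_pderiv i (F i j) x = fps_of_real (inverse (w x) * b i j x) * fps_pderiv i (dV j) x
        + fps_of_real (fps_pderiv i (\<lambda>x. inverse (w x) * b i j x) x) * dV j x"
      unfolding F_def
      by (subst fps_pderiv_mult[OF fps_C1_on_of_real[OF fps_C1_on_mult[OF iw b]] dV x])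
         (simp add: fps_pderiv_of_real[OF fps_C1_on_mult[OF iw b] x])
    ultimately show ?thesis
      by (simp add: fps_of_real_mult fps_of_real_add fps_of_real_minus power2_eq_square diff_conv_add_uminus
          del: add_uminus_conv_diff)
  qed
  \<comment> \<open>The expansion of the equation divided by \<open>w\<^sup>3\<close>, which is its divergence form.\<close>
  define Y where "Y x = fps_of_real (w x) * (fps_const (1 - of_nat ?n) * V1 x + V2 x + fps_const (lam * (of_nat ?n - lam)) * V x)
      + fps_euler (fps_of_real (w x)) * V1 x
      + fps_X * (\<Sum>i\<in>UNIV. \<Sum>j\<in>UNIV. fps_pderiv i (F i j) x)" for x
  have Y: "fps_nth (Y x) k = 0" if x: "x \<in> U" and k: "k \<le> m" for x k
  proof -
    obtain K where K: "K \<in> \<K>" and E: "(\<lambda>r. complex_of_real r powr (- lam) *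
        (laplacian (g_plus (H K)) (radial_sum K (\<lambda>j. lam + 2 * of_nat j) u) (cyl_point x r)
         + lam * (of_nat ?n - lam) * radial_sum K (\<lambda>j. lam + 2 * of_nat j) u (cyl_point x r)))
      \<in> o[at_right 0](\<lambda>r. of_real r ^ (2 * m))"
      using eigen[OF x] by blast
    let ?u = "radial_sum K (\<lambda>j. lam + 2 * of_nat j) u"
    let ?\<rho> = "\<lambda>r. complex_of_real r powr (- lam)"
    let ?y = "\<lambda>r. cyl_point x r"
    let ?C = "{z. z $ None > 0 \<and> cyl_base z \<in> U}"
    have C: "open ?C" by (rule open_cylinder[OF U])
    have ud: "u k differentiable (at z)" "pderiv_at j (u k) differentiable (at z)" if "z \<in> U" for k z j
      using smooth_on_differentiable_at[OF U u that] smooth_on_differentiable_at[OF U smooth_on_pderiv[OF u] that] by auto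
    have D1: "pderiv_at None ?u z = radial_sum K (\<lambda>j. lam + 2 * of_nat j - 1) (\<lambda>j x. (lam + 2 * of_nat j) * u j x) z"
      and D2: "pderiv_at (Some i) ?u z = radial_sum K (\<lambda>j. lam + 2 * of_nat j) (\<lambda>j. pderiv_at i (u j)) z"
      if "z \<in> ?C" for z i
      using that by (auto intro!: radial_sum_derivatives ud)
    have cd: "(\<lambda>x. (lam + 2 * of_nat j) * u j x) differentiable (at x)" for j
      using ud(1)[OF x] by (intro differentiable_mult) auto
    have yC: "?y r \<in> ?C" if "r > 0" for r using that x by simp
    have D11: "pderiv_at None (pderiv_at None ?u) (?y r)
        = radial_sum K (\<lambda>j. lam + 2 * of_nat j - 1 - 1) (\<lambda>j x. (lam + 2 * of_nat j - 1) * ((lam + 2 * of_nat j) * u j x)) (?y r)"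
      and d1: "pderiv_at None ?u differentiable (at (?y r))" if r: "r > 0" for r
    proof -
      show "pderiv_at None (pderiv_at None ?u) (?y r)
        = radial_sum K (\<lambda>j. lam + 2 * of_nat j - 1 - 1) (\<lambda>j x. (lam + 2 * of_nat j - 1) * ((lam + 2 * of_nat j) * u j x)) (?y r)"
        by (subst pderiv_at_cong[OF C yC[OF r] D1], assumption)
           (rule radial_sum_derivatives(2), use r cd in auto)
      have "radial_sum K (\<lambda>j. lam + 2 * of_nat j - 1) (\<lambda>j x. (lam + 2 * of_nat j) * u j x) differentiable (at (?y r))"
        by (rule radial_sum_derivatives(1)) (use r cd in auto)
      then show "pderiv_at None ?u differentiable (at (?y r))"
        by (rule differentiable_cong_open[OF C yC[OF r], rotated]) (simp add: D1)
    qed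
    have D22: "pderiv_at (Some i) (pderiv_at (Some j) ?u) (?y r)
        = radial_sum K (\<lambda>j. lam + 2 * of_nat j) (\<lambda>k. pderiv_at i (pderiv_at j (u k))) (?y r)"
      and d2: "pderiv_at (Some j) ?u differentiable (at (?y r))" if r: "r > 0" for r i j
    proof -
      show "pderiv_at (Some i) (pderiv_at (Some j) ?u) (?y r)
        = radial_sum K (\<lambda>j. lam + 2 * of_nat j) (\<lambda>k. pderiv_at i (pderiv_at j (u k))) (?y r)"
        by (subst pderiv_at_cong[OF C yC[OF r] D2], assumption)
           (rule radial_sum_derivatives(3), use r ud(2)[OF x] in auto)
      have "radial_sum K (\<lambda>j. lam + 2 * of_nat j) (\<lambda>k. pderiv_at j (u k)) differentiable (at (?y r))"
        by (rule radial_sum_derivatives(1)) (use r ud(2)[OF x] in auto)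
      then show "pderiv_at (Some j) ?u differentiable (at (?y r))"
        by (rule differentiable_cong_open[OF C yC[OF r], rotated]) (simp add: D2)
    qed
    have poly: "has_expansion m (\<lambda>r. \<Sum>k\<le>K. c k * of_real r ^ (2 * k)) (Abs_fps c)" for c :: "nat \<Rightarrow> complex"
      by (rule has_expansion_polynomial[OF \<K>[OF K]])
    have U0: "has_expansion m (\<lambda>r. ?\<rho> r * ?u (?y r)) (V x)"
      unfolding V_def using radial_sum_normalized[of _ lam 0 K u x]
      by (intro has_expansion_cong_pos[OF poly]) simp
    have U1: "has_expansion m (\<lambda>r. ?\<rho> r * (of_real r * pderiv_at None ?u (?y r))) (V1 x)"
      unfolding V1_def using radial_sum_normalized[of _ lam 1 K _ x] D1[OF yC]
      by (intro has_expansion_cong_pos[OF poly]) simp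
    have U2: "has_expansion m (\<lambda>r. ?\<rho> r * ((of_real r)\<^sup>2 * pderiv_at None (pderiv_at None ?u) (?y r))) (V2 x)"
      unfolding V2_def using radial_sum_normalized[of _ lam 2 K _ x] D11
      by (intro has_expansion_cong_pos[OF poly]) (simp add: diff_diff_eq)
    have UD: "has_expansion (m - 1) (\<lambda>r. ?\<rho> r * pderiv_at (Some j) ?u (?y r)) (dV j x)" for j
      unfolding dV_def using radial_sum_normalized[of _ lam 0 K _ x] D2[OF yC]
      by (intro has_expansion_cong_pos[OF has_expansion_weaken[OF poly]]) simp_all
    have UDD: "has_expansion (m - 1) (\<lambda>r. ?\<rho> r * pderiv_at (Some i) (pderiv_at (Some j) ?u) (?y r)) (fps_pderiv i (dV j) x)" for i j
      unfolding dV_def fps_pderiv_def using radial_sum_normalized[of _ lam 0 K _ x] D22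
      by (intro has_expansion_cong_pos[OF has_expansion_weaken[OF poly]]) simp_all
    let ?W = "fps_of_real (w x)"
    have cr: "has_expansion l (\<lambda>r. complex_of_real (f r)) (fps_of_real \<phi>)" if "has_expansion l f \<phi>" for l f \<phi>
      using has_expansion_of_real[OF that] by (simp add: fps_of_real_def)
    have P0: "has_expansion m (\<lambda>r. complex_of_real (P K (?y r))) (?W * ?W)"
      using P K x cr[of m "\<lambda>r. P K (?y r)" "w x * w x"] by (auto simp: jet_expansion_def has_log_expansion_zero_iff fps_of_real_mult)
    have P1: "has_expansion m (\<lambda>r. complex_of_real (r * pderiv_at None (P K) (?y r))) (fps_euler (?W * ?W))"
      using P K x cr[of m "\<lambda>r. r * pderiv_at None (P K) (?y r)" "fps_euler (w x * w x)"]
      by (auto simp: jet_expansion_def has_log_expansion_zero_iff fps_of_real_mult fps_of_real_euler)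
    have P2: "has_expansion (m - 1) (\<lambda>r. complex_of_real (pderiv_at (Some i) (P K) (?y r)))
        (fps_of_real (fps_pderiv i (\<lambda>x. w x * w x) x))" for i
      using P K x by (intro cr) (auto simp: jet_expansion_def)
    have P0': "has_expansion (m - 1) (\<lambda>r. complex_of_real (P K (?y r))) (?W * ?W)"
      by (rule has_expansion_weaken[OF P0]) simp
    have B0: "has_expansion (m - 1) (\<lambda>r. complex_of_real (B i j K (?y r))) (fps_of_real (b i j x))" for i j
      using B[of i j] K x m by (intro cr has_log_expansion_imp_has_expansion[of m _ _ "aB i j x"]) (auto simp: jet_expansion_def)
    have B1: "has_expansion (m - 1) (\<lambda>r. complex_of_real (pderiv_at (Some i) (B i j K) (?y r)))
        (fps_of_real (fps_pderiv i (b i j) x))" for i j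
      using B[of i j] K x by (intro cr) (auto simp: jet_expansion_def)
    \<comment> \<open>\<open>S\<close> and \<open>Z\<close> are the expansions of the base part and of the whole right-hand side in \<open>laplacian_g_plus\<close>,
      with \<open>lam (n - lam) P\<^sup>2 u\<close> added and \<open>r\<^bsup>lam\<^esup>\<close> divided out. The equation says \<open>Z = 0\<close> up to order \<open>m\<close>.\<close>
    define S where "S = (\<Sum>i\<in>UNIV. \<Sum>j\<in>UNIV.
        ?W * ?W * (fps_of_real (fps_pderiv i (b i j) x) * dV j x + fps_of_real (b i j x) * fps_pderiv i (dV j) x)
        - fps_const (1/2) * fps_of_real (fps_pderiv i (\<lambda>x. w x * w x) x) * fps_of_real (b i j x) * dV j x)"
    define Z where "Z = (?W * ?W) * (?W * ?W) * (fps_const (1 - of_nat ?n) * V1 x + V2 x + fps_const (lam * (of_nat ?n - lam)) * V x)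
        + fps_const (1/2) * (?W * ?W) * fps_euler (?W * ?W) * V1 x + fps_X * S"
    let ?S = "\<lambda>r. \<Sum>i\<in>UNIV. \<Sum>j\<in>UNIV.
          of_real (P K (?y r)) * (of_real (pderiv_at (Some i) (B i j K) (?y r)) * (?\<rho> r * pderiv_at (Some j) ?u (?y r))
            + of_real (B i j K (?y r)) * (?\<rho> r * pderiv_at (Some i) (pderiv_at (Some j) ?u) (?y r)))
          - (1/2) * of_real (pderiv_at (Some i) (P K) (?y r)) * of_real (B i j K (?y r)) * (?\<rho> r * pderiv_at (Some j) ?u (?y r))"
    have S: "has_expansion (m - 1) ?S S"
      unfolding S_def by (intro has_expansion_sum has_expansion_diff has_expansion_mult has_expansion_add has_expansion_const P0' P2 B0 B1 UD UDD)
    have "has_expansion m (\<lambda>r. of_real r ^ 2 * ?S r) (fps_X * S)"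
      using has_expansion_shift[OF S] m by simp
    note Z1' = has_expansion_add[OF _ this]
    have Z1: "has_expansion m (\<lambda>r. (of_real (P K (?y r)) * of_real (P K (?y r))) *
          ((1 - of_nat ?n) * (?\<rho> r * (of_real r * pderiv_at None ?u (?y r)))
           + ?\<rho> r * ((of_real r)\<^sup>2 * pderiv_at None (pderiv_at None ?u) (?y r))
           + lam * (of_nat ?n - lam) * (?\<rho> r * ?u (?y r)))
        + (1/2) * of_real (P K (?y r)) * of_real (r * pderiv_at None (P K) (?y r)) * (?\<rho> r * (of_real r * pderiv_at None ?u (?y r)))
        + of_real r ^ 2 * ?S r) Z" (is "has_expansion m ?L Z")
      unfolding Z_def by (rule Z1', intro has_expansion_add has_expansion_mult has_expansion_const P0 P1 U0 U1 U2)
    let ?E = "\<lambda>r. ?\<rho> r * (laplacian (g_plus (H K)) ?u (?y r) + lam * (of_nat ?n - lam) * ?u (?y r))"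
    have Cd: "(\<lambda>z. H K (z $ None) (cyl_base z) $ i $ j) differentiable (at z)" if "z \<in> ?C" for z i j
    proof -
      obtain \<phi> a where "jet_expansion \<K> m U (\<lambda>K z. H K (z $ None) (cyl_base z) $ i $ j) \<phi> a" using H by blast
      then have "(\<lambda>z. H K (z $ None) (cyl_base z) $ i $ j) differentiable (at (cyl_point (cyl_base z) (z $ None)))"
        using that K unfolding jet_expansion_def by blast
      then show ?thesis by (simp add: cyl_point_eta)
    qed
    have "\<forall>\<^sub>F r in at_right 0. ?L r = (of_real (P K (?y r)) * of_real (P K (?y r))) * ?E r"
      using eventually_at_right_less[of "0::real"] pos[OF K x]
    proof eventually_elim
      case (elim r)
      have du: "pderiv_at a ?u differentiable at (?y r)" for a
        using d1[OF elim(1)] d2[OF elim(1)] by (cases a) auto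
      have lap: "(complex_of_real (P K (?y r)))\<^sup>2 * laplacian (g_plus (H K)) ?u (?y r) =
         (P K (?y r))\<^sup>2 * ((1 - of_nat ?n) * (r * pderiv_at None ?u (?y r)) + r\<^sup>2 * pderiv_at None (pderiv_at None ?u) (?y r))
         + of_real (P K (?y r)) / 2 * of_real (r * pderiv_at None (P K) (?y r)) * (r * pderiv_at None ?u (?y r))
         + r\<^sup>2 * (\<Sum>i\<in>UNIV. \<Sum>j\<in>UNIV.
          of_real (P K (?y r)) * (of_real (pderiv_at (Some i) (B i j K) (?y r)) * pderiv_at (Some j) ?u (?y r)
            + of_real (B i j K (?y r)) * pderiv_at (Some i) (pderiv_at (Some j) ?u) (?y r))
          - of_real (pderiv_at (Some i) (P K) (?y r)) / 2 * of_real (B i j K (?y r)) * pderiv_at (Some j) ?u (?y r))"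
        using laplacian_g_plus[of ?C "?y r" "H K" ?u, OF C yC[OF elim(1)] _ Cd _ du] elim(2)
        by (simp add: P_def[abs_def] B_def[abs_def])
      have S': "?S r = ?\<rho> r * (\<Sum>i\<in>UNIV. \<Sum>j\<in>UNIV.
          of_real (P K (?y r)) * (of_real (pderiv_at (Some i) (B i j K) (?y r)) * pderiv_at (Some j) ?u (?y r)
            + of_real (B i j K (?y r)) * pderiv_at (Some i) (pderiv_at (Some j) ?u) (?y r))
          - of_real (pderiv_at (Some i) (P K) (?y r)) / 2 * of_real (B i j K (?y r)) * pderiv_at (Some j) ?u (?y r))"
        (is "_ = ?\<rho> r * ?SS")
        unfolding sum_distrib_left by (intro sum.cong refl) (simp add: algebra_simps)
      have "(of_real (P K (?y r)) * of_real (P K (?y r))) * ?E r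
         = ?\<rho> r * ((complex_of_real (P K (?y r)))\<^sup>2 * laplacian (g_plus (H K)) ?u (?y r))
         + ?\<rho> r * (complex_of_real (P K (?y r)))\<^sup>2 * (lam * (of_nat ?n - lam) * ?u (?y r))"
        by (simp add: power2_eq_square algebra_simps)
      also have "\<dots> = ?L r"
        unfolding lap S' by (simp add: power2_eq_square algebra_simps)
      finally show ?case by simp
    qed
    then have Z2: "has_expansion m (\<lambda>r. (of_real (P K (?y r)) * of_real (P K (?y r))) * ?E r) Z"
      by (rule has_expansion_cong_eventually[OF Z1])
    have "has_expansion m ?E 0" using E by (simp add: has_expansion_def fps_trunc_eval_def)
    from has_expansion_mult[OF has_expansion_mult[OF P0 P0] this]
    have "has_expansion m (\<lambda>r. (of_real (P K (?y r)) * of_real (P K (?y r))) * ?E r) 0" by simp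
    from has_expansion_unique[OF Z2 this] have Z0: "fps_nth Z k = 0" if "k \<le> m" for k using that by simp
    let ?I = "fps_of_real (inverse (w x))"
    have I: "?W * ?I = 1"
      using inverse_mult_eq_1'[OF w0[OF x]] by (simp flip: fps_of_real_mult add: fps_of_real_1)
    have half: "fps_const (1/2) * (2 * f) = f" for f :: "complex fps"
    proof -
      have "(2 :: complex fps) = fps_const 2" by (simp add: numeral_fps_const)
      then show ?thesis by (simp flip: mult.assoc)
    qed
    have W2: "fps_of_real (fps_pderiv i (\<lambda>x. w x * w x) x) = 2 * (?W * fps_of_real (fps_pderiv i w x))" for i
      unfolding fps_pderiv_mult[OF w w x] fps_of_real_add fps_of_real_mult by (simp add: algebra_simps)
    have E2: "fps_euler (?W * ?W) = 2 * (?W * fps_euler ?W)"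
      by (simp add: fps_euler_mult algebra_simps)
    \<comment> \<open>Since \<open>P\<close> expands to \<open>W\<^sup>2\<close>, the base part is \<open>W\<^sup>3\<close> times a divergence, by the quotient rule for \<open>F = W\<^sup>-\<^sup>1 B \<partial>u\<close>.\<close>
    have S3: "S = ?W ^ 3 * (\<Sum>i\<in>UNIV. \<Sum>j\<in>UNIV. fps_pderiv i (F i j) x)"
    proof -
      have "?W * ?W * (b' * v + bb * v') - fps_const (1/2) * (2 * (?W * wi)) * bb * v
          = ?W ^ 3 * (?I * bb * v' + (?I * b' - wi * ?I\<^sup>2 * bb) * v)" for b' v bb v' wi
      proof -
        have "?W ^ 3 * (?I * bb * v' + (?I * b' - wi * ?I\<^sup>2 * bb) * v)
          = ?W * ?W * (?W * ?I) * (bb * v' + b' * v) - ?W * (?W * ?I) * (?W * ?I) * wi * bb * v"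
          by (simp only: power3_eq_cube power2_eq_square algebra_simps)
        then show ?thesis unfolding I half by (simp add: algebra_simps)
      qed
      then show ?thesis unfolding S_def sum_distrib_left W2 using dF[OF x] by simp
    qed
    have Z3: "Z = ?W ^ 3 * Y x"
    proof -
      have "fps_const (1/2) * (?W * ?W) * fps_euler (?W * ?W) * V1 x = ?W ^ 3 * (fps_euler ?W * V1 x)"
      proof -
        have "fps_const (1/2) * (?W * ?W) * fps_euler (?W * ?W) * V1 x
            = (?W * ?W) * (fps_const (1/2) * (2 * (?W * fps_euler ?W))) * V1 x"
          unfolding E2 by (simp only: ac_simps)
        then show ?thesis unfolding half by (simp add: power3_eq_cube ac_simps)
      qed
      then show ?thesis unfolding Z_def Y_def S3
        by (simp add: power3_eq_cube algebra_simps)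
    qed
    have "Y x = ?I ^ 3 * Z"
    proof -
      have "?I ^ 3 * Z = (?W * ?I) ^ 3 * Y x" unfolding Z3 power_mult_distrib by (simp only: ac_simps)
      then show ?thesis unfolding I by simp
    qed
    then have "fps_nth (Y x) k = (\<Sum>i=0..k. fps_nth (?I ^ 3) i * fps_nth Z (k - i))"
      by (simp add: fps_mult_nth)
    then show ?thesis using Z0 k by simp
  qed
  define G where "G i x = (\<Sum>j\<in>UNIV. fps_nth (F i j x) (N - 1))" for i x
  have "C1_on U (G i)" for i
    unfolding G_def using F by (intro C1_on_sum) (auto simp: fps_C1_on_def)
  moreover have "G i x = 0" if "\<forall>k j. pderiv_at j (u k) x = 0" for i x
  proof -
    have "dV j x = 0" for j using that by (simp add: dV_def fps_eq_iff)
    then show ?thesis by (simp add: G_def F_def)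
  qed
  moreover have "(\<Sum>j\<le>N. 2 * (lam * of_nat N + of_nat j * (lam - of_nat ?n + 2 * of_nat N))
        * of_real (fps_nth (w x) (N - j)) * u j x) + (\<Sum>i\<in>UNIV. pderiv_at i (G i) x) = 0" if x: "x \<in> U" for x
  proof -
    have "(\<Sum>i\<in>UNIV. pderiv_at i (G i) x) = (\<Sum>i\<in>UNIV. \<Sum>j\<in>UNIV. fps_nth (fps_pderiv i (F i j) x) (N - 1))"
      unfolding G_def fps_pderiv_def using F x
      by (intro sum.cong refl) (subst pderiv_at_sum, auto intro: fps_C1_on_differentiable)
    also have "\<dots> = fps_nth (fps_X * (\<Sum>i\<in>UNIV. \<Sum>j\<in>UNIV. fps_pderiv i (F i j) x)) N"
      using N(1) by (simp add: fps_sum_nth)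
    finally have 1: "(\<Sum>i\<in>UNIV. pderiv_at i (G i) x) = fps_nth (fps_X * (\<Sum>i\<in>UNIV. \<Sum>j\<in>UNIV. fps_pderiv i (F i j) x)) N" .
    let ?A = "fps_const (1 - of_nat ?n) * V1 x + V2 x + fps_const (lam * (of_nat ?n - lam)) * V x"
    have "fps_nth (fps_of_real (w x) * ?A + fps_euler (fps_of_real (w x)) * V1 x) N
       = fps_nth (?A * fps_of_real (w x)) N + fps_nth (V1 x * fps_euler (fps_of_real (w x))) N"
      by (simp add: mult.commute)
    also have "\<dots> = (\<Sum>j=0..N. fps_nth ?A j * of_real (fps_nth (w x) (N - j))
        + fps_nth (V1 x) j * (of_nat (2 * (N - j)) * of_real (fps_nth (w x) (N - j))))"
      by (simp only: fps_mult_nth sum.distrib fps_of_real_nth fps_euler_nth)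
    also have "\<dots> = (\<Sum>j\<le>N. 2 * (lam * of_nat N + of_nat j * (lam - of_nat ?n + 2 * of_nat N))
        * of_real (fps_nth (w x) (N - j)) * u j x)"
      unfolding atMost_atLeast0
    proof (rule sum.cong[OF refl])
      fix j assume "j \<in> {0..N}"
      then have e: "of_nat (2 * (N - j)) = (2 * (of_nat N - of_nat j) :: complex)" by (simp add: of_nat_diff)
      show "fps_nth ?A j * of_real (fps_nth (w x) (N - j))
        + fps_nth (V1 x) j * (of_nat (2 * (N - j)) * of_real (fps_nth (w x) (N - j)))
        = 2 * (lam * of_nat N + of_nat j * (lam - of_nat ?n + 2 * of_nat N)) * of_real (fps_nth (w x) (N - j)) * u j x"
        unfolding e by (simp add: V_def V1_def V2_def algebra_simps)
    qed
    finally show ?thesis using Y[OF x N(2)] unfolding Y_def 1 by simp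
  qed
  ultimately show ?thesis by blast
qed

section \<open>A flat function\<close>

text \<open>The derivatives of \<open>exp (-1/t)\<close>, extended by zero, are of this form with a suitable polynomial \<open>p\<close>.\<close>

definition flat_fun :: "real poly \<Rightarrow> real \<Rightarrow> real" where
  "flat_fun p t = (if t > 0 then poly p (1 / t) * exp (- (1 / t)) else 0)"

definition flat_deriv :: "real poly \<Rightarrow> real poly" where
  "flat_deriv p = [:0, 0, 1:] * (p - pderiv p)"

lemma poly_div_exp_tendsto_0: "((\<lambda>s. poly p s * exp (- s)) \<longlongrightarrow> (0::real)) at_top"
proof -
  have "((\<lambda>s. \<Sum>i\<le>degree p. coeff p i * (s ^ i / exp s)) \<longlongrightarrow> (\<Sum>i\<le>degree p. coeff p i * 0)) at_top"
    by (intro tendsto_intros tendsto_power_div_exp_0)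
  then show ?thesis by (simp add: poly_altdef sum_distrib_right exp_minus divide_inverse mult.assoc)
qed

lemma flat_fun_has_derivative: "(flat_fun p has_real_derivative flat_fun (flat_deriv p) t) (at t)"
proof -
  consider "t > 0" | "t < 0" | "t = 0" by linarith
  then show ?thesis
  proof cases
    case 1
    have "((\<lambda>t. poly p (1 / t) * exp (- (1 / t))) has_real_derivative
       poly p (1 / t) * (exp (- (1 / t)) * (1 / t\<^sup>2)) + poly (pderiv p) (1 / t) * (- (1 / t\<^sup>2)) * exp (- (1 / t))) (at t)"
      using 1 by (auto intro!: derivative_eq_intros DERIV_chain2[of "poly p" _ "\<lambda>t. 1 / t"] poly_DERIV
          simp: power2_eq_square)
    moreover have "poly p (1 / t) * (exp (- (1 / t)) * (1 / t\<^sup>2)) + poly (pderiv p) (1 / t) * (- (1 / t\<^sup>2)) * exp (- (1 / t))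
       = flat_fun (flat_deriv p) t"
      using 1 by (simp add: flat_fun_def flat_deriv_def field_simps power2_eq_square)
    ultimately have "((\<lambda>t. poly p (1 / t) * exp (- (1 / t))) has_real_derivative flat_fun (flat_deriv p) t) (at t)"
      by simp
    then show ?thesis
      by (rule has_field_derivative_transform_within_open[where S="{0<..}"]) (use 1 in \<open>auto simp: flat_fun_def\<close>)
  next
    case 2
    have "((\<lambda>t. 0) has_real_derivative flat_fun (flat_deriv p) t) (at t)"
      using 2 by (simp add: flat_fun_def)
    then show ?thesis
      by (rule has_field_derivative_transform_within_open[where S="{..<0}"]) (use 2 in \<open>auto simp: flat_fun_def\<close>)
  next
    case 3
    have "((\<lambda>h. flat_fun p h / h) \<longlongrightarrow> 0) (at_right 0)"
    proof (rule Lim_transform_eventually)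
      have "filterlim (\<lambda>h::real. 1 / h) at_top (at_right 0)"
        using filterlim_inverse_at_top_right by (simp add: inverse_eq_divide)
      then show "((\<lambda>h. poly (pCons 0 p) (1 / h) * exp (- (1 / h))) \<longlongrightarrow> 0) (at_right 0)"
        by (rule filterlim_compose[OF poly_div_exp_tendsto_0])
      show "\<forall>\<^sub>F h in at_right 0. poly (pCons 0 p) (1 / h) * exp (- (1 / h)) = flat_fun p h / h"
        using eventually_at_right_less[of "0::real"] by eventually_elim (simp add: flat_fun_def)
    qed
    moreover have "((\<lambda>h. flat_fun p h / h) \<longlongrightarrow> 0) (at_left 0)"
      by (rule Lim_transform_eventually[OF tendsto_const])
         (auto simp: eventually_at_filter flat_fun_def)
    ultimately have "((\<lambda>h. flat_fun p h / h) \<longlongrightarrow> 0) (at 0)"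
      by (rule filterlim_split_at[rotated])
    then show ?thesis using 3 by (simp add: DERIV_def flat_fun_def)
  qed
qed

lemma smooth_on_flat_fun:
  fixes q :: "real^'m::finite \<Rightarrow> real"
  assumes "open S" "smooth_on S q"
  shows "smooth_on S (\<lambda>x. flat_fun 1 (q x))"
  using smooth_on_compose_real[OF assms, of "\<lambda>k. flat_fun ((flat_deriv ^^ k) 1)" 0] flat_fun_has_derivative by simp

section \<open>Charts and bump functions\<close>

text \<open>In another chart a bump function is smooth on the overlap, and zero off the support.\<close>

lemma smooth_on_Un_open:
  assumes "open S" "open T" "smooth_on S f" "smooth_on T f" shows "smooth_on (S \<union> T) f"
  using assms unfolding smooth_on_def differentiable_on_open_iff[OF open_Un[OF assms(1,2)]]
  by (auto simp: differentiable_on_open_iff)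

text \<open>The squared distance to \<open>x0\<close> is written as a sum of squares, which is visibly smooth in other charts too.\<close>

definition bump :: "('a, 'n::finite) chart \<Rightarrow> real^'n \<Rightarrow> real \<Rightarrow> 'a \<Rightarrow> complex" where
  "bump c x0 e p = (if p \<in> dom_of c then of_real (flat_fun 1 (e\<^sup>2 - (\<Sum>i\<in>UNIV. (coord c p $ i - x0 $ i)\<^sup>2))) else 0)"

lemma coord_in_img: "p \<in> dom_of c \<Longrightarrow> coord c p \<in> img c"
  by (simp add: img_def)

context
  fixes A :: "('a::{t2_space,second_countable_topology}, 'n::finite) chart set"
  assumes A: "smooth_atlas A"
begin

lemma chart_open: "c \<in> A \<Longrightarrow> open (dom_of c)" "c \<in> A \<Longrightarrow> open (img c)"
  using A by (auto simp: smooth_atlas_def)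

lemma chart_continuous: "c \<in> A \<Longrightarrow> continuous_on (dom_of c) (coord c)" "c \<in> A \<Longrightarrow> continuous_on (img c) (param c)"
  using A by (auto simp: smooth_atlas_def homeomorphism_def)

lemma chart_inverse:
  "c \<in> A \<Longrightarrow> p \<in> dom_of c \<Longrightarrow> param c (coord c p) = p"
  "c \<in> A \<Longrightarrow> x \<in> img c \<Longrightarrow> coord c (param c x) = x"
  "c \<in> A \<Longrightarrow> x \<in> img c \<Longrightarrow> param c x \<in> dom_of c"
  using A by (auto simp: smooth_atlas_def homeomorphism_def img_def)

lemma chart_cover: "\<exists>c\<in>A. p \<in> dom_of c"
  using A by (auto simp: smooth_atlas_def)

lemma coord_image_eq: "c \<in> A \<Longrightarrow> coord c ` (dom_of c \<inter> X) = img c \<inter> param c -` X"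
  using chart_inverse[of c] by (force simp: img_def)

lemma chart_transition_smooth:
  "c \<in> A \<Longrightarrow> c' \<in> A \<Longrightarrow> smooth_on (coord c ` (dom_of c \<inter> dom_of c')) (coord c' \<circ> param c)"
  using A by (auto simp: smooth_atlas_def)

lemma param_open_preimage: "c \<in> A \<Longrightarrow> open X \<Longrightarrow> open (img c \<inter> param c -` X)"
  by (intro continuous_open_preimage chart_open chart_continuous)

lemma compact_param_image:
  "c \<in> A \<Longrightarrow> compact X \<Longrightarrow> X \<subseteq> img c \<Longrightarrow> compact (param c ` X)"
  by (meson chart_continuous(2) compact_continuous_image continuous_on_subset)

lemma bump_param:
  assumes "c \<in> A" "x \<in> img c"
  shows "bump c x0 e (param c x) = of_real (flat_fun 1 (e\<^sup>2 - (dist x x0)\<^sup>2))"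
proof -
  have "(dist x x0)\<^sup>2 = (\<Sum>i\<in>UNIV. (x $ i - x0 $ i)\<^sup>2)"
    by (simp add: dist_vec_def L2_set_def dist_real_def sum_nonneg)
  then show ?thesis using assms chart_inverse by (simp add: bump_def)
qed

lemma bump_param_outside:
  assumes "c \<in> A" "p \<notin> param c ` cball x0 e" "e > 0"
  shows "bump c x0 e p = 0"
proof (cases "p \<in> dom_of c")
  case True
  then have x: "coord c p \<in> img c" "param c (coord c p) = p"
    using chart_inverse(1)[OF assms(1)] coord_in_img[of p c] by simp_all
  with assms have "coord c p \<notin> cball x0 e" by (metis image_eqI)
  then have "dist (coord c p) x0 > e" by (simp add: dist_commute)
  then have "(dist (coord c p) x0)\<^sup>2 > e\<^sup>2" using assms(3) by (intro power_strict_mono) auto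
  then show ?thesis using bump_param[OF assms(1) x(1), of x0 e] x(2) by (simp add: flat_fun_def)
qed (simp add: bump_def)

lemma bump_smooth:
  assumes c: "c \<in> A" and e: "e > 0" "cball x0 e \<subseteq> img c"
  shows "smooth_fun A (bump c x0 e)"
  unfolding smooth_fun_def
proof
  fix c' assume c': "c' \<in> A"
  let ?K = "param c ` cball x0 e"
  \<comment> \<open>The support is compact, hence closed as the manifold is Hausdorff; its complement and the chart domain cover.\<close>
  have K: "closed ?K" using compact_param_image[OF c compact_cball e(2)] by (rule compact_imp_closed)
  let ?S = "img c' \<inter> param c' -` dom_of c" and ?T = "img c' \<inter> param c' -` (- ?K)"
  have S: "open ?S" by (rule param_open_preimage[OF c' chart_open(1)[OF c]])
  have T: "open ?T" using K by (intro param_open_preimage[OF c']) auto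
  have "smooth_on ?S (\<lambda>y. (coord c \<circ> param c') y $ i)" for i
    using chart_transition_smooth[OF c' c] coord_image_eq[OF c', of "dom_of c"] by (intro smooth_on_nth S) (simp add: o_def)
  note coord_smooth = this[unfolded o_def]
  have "smooth_on ?S (\<lambda>y. flat_fun 1 (e\<^sup>2 + (-1) * (\<Sum>i\<in>UNIV. (coord c (param c' y) $ i + (- x0 $ i)) * (coord c (param c' y) $ i + (- x0 $ i)))))"
    by (intro smooth_on_flat_fun smooth_on_add smooth_on_mult smooth_on_sum smooth_on_const S coord_smooth)
  from smooth_on_of_real[OF S this]
  have "smooth_on ?S (bump c x0 e \<circ> param c')"
    by (rule smooth_on_cong[OF S]) (simp add: bump_def power2_eq_square)
  moreover have "smooth_on ?T (bump c x0 e \<circ> param c')"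
    by (rule smooth_on_cong[OF T smooth_on_const[OF T, of 0]]) (use bump_param_outside[OF c _ e(1)] in auto)
  ultimately have "smooth_on (?S \<union> ?T) (bump c x0 e \<circ> param c')"
    using S T by (intro smooth_on_Un_open)
  moreover have "?K \<subseteq> dom_of c" using e(2) chart_inverse(3)[OF c] by auto
  then have "?S \<union> ?T = img c'" by blast
  ultimately show "smooth_on (img c') (bump c x0 e \<circ> param c')" by simp
qed

lemma bump_compactly_supported:
  assumes c: "c \<in> A" and e: "e > 0" "cball x0 e \<subseteq> img c"
  shows "compactly_supported (bump c x0 e)"
proof -
  have K: "compact (param c ` cball x0 e)" by (rule compact_param_image[OF c compact_cball e(2)])
  have "closure {p. bump c x0 e p \<noteq> 0} \<subseteq> param c ` cball x0 e"
    using bump_param_outside[OF c _ e(1), of _ x0] compact_imp_closed[OF K] by (intro closure_minimal) auto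
  then have "closure {p. bump c x0 e p \<noteq> 0} = param c ` cball x0 e \<inter> closure {p. bump c x0 e p \<noteq> 0}" by auto
  then show ?thesis unfolding compactly_supported_def
    using compact_Int_closed[OF K closed_closure] by metis
qed

end

section \<open>The integral of a derivative with compact support\<close>

text \<open>The difference quotients of \<open>G\<close> in direction \<open>i\<close> have integral zero by translation invariance, and they
converge to the derivative, dominated by a constant on a bounded set.\<close>

lemma integral_pderiv_zero:
  fixes G :: "real^'m::finite \<Rightarrow> complex"
  assumes G: "C1_on UNIV G" and K: "compact K" "\<And>x. x \<notin> K \<Longrightarrow> G x = 0"
  shows "integrable lborel (pderiv_at i G)" "integral\<^sup>L lborel (pderiv_at i G) = 0"
proof -
  let ?e = "axis i 1 :: real^'m" and ?D = "pderiv_at i G"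
  obtain R where R: "R > 0" "K \<subseteq> ball 0 R" using compact_imp_bounded[OF K(1)] bounded_subset_ballD[of K 0] by blast
  define L where "L = cball (0::real^'m) (R + 1)"
  have G0: "G x = 0" if "norm x \<ge> R" for x using R that by (intro K(2)) auto
  have L: "compact L" by (simp add: L_def)
  have cG: "continuous_on UNIV G" using C1_on_continuous[OF G] .
  have cD: "continuous_on UNIV ?D" using C1_on_continuous_pderiv[OF G] .
  have D0: "?D x = 0" if "x \<notin> L" for x
  proof -
    have "?D x = pderiv_at i (\<lambda>x. 0) x"
      by (rule pderiv_at_cong[of "- cball 0 R"]) (use that R(1) in \<open>auto simp: L_def intro!: G0\<close>)
    then show ?thesis by simp
  qed
  have intc: "integrable lborel F" if "continuous_on UNIV F" "\<And>x. x \<notin> L \<Longrightarrow> F x = 0" for F :: "real^'m \<Rightarrow> complex"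
  proof -
    have "(\<lambda>x. indicator L x *\<^sub>R F x) = F" using that(2) by (auto simp: indicator_def)
    then show ?thesis using borel_integrable_compact[OF L continuous_on_subset[OF that(1)]] by simp
  qed
  show "integrable lborel ?D" by (rule intc[OF cD D0])
  obtain b where b: "\<And>x. norm (?D x) \<le> b"
  proof -
    have "bounded (?D ` L)" using compact_continuous_image[OF continuous_on_subset[OF cD] L] compact_imp_bounded by blast
    then obtain b where "\<And>x. x \<in> L \<Longrightarrow> norm (?D x) \<le> b" by (auto simp: bounded_iff)
    then have "norm (?D x) \<le> max b 0" for x using D0[of x] by (cases "x \<in> L") (auto simp: le_max_iff_disj)
    then show ?thesis by (rule that)
  qed
  have hd: "(G has_derivative frechet_derivative G (at x)) (at x)" for x
    using G by (intro differentiable_has_derivative_frechet) (auto simp: C1_on_def)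
  have line: "((\<lambda>s. G (x + s *\<^sub>R ?e)) has_derivative (\<lambda>s. s *\<^sub>R ?D (x + s0 *\<^sub>R ?e))) (at s0)" for x s0
  proof -
    have "((\<lambda>s. x + s *\<^sub>R ?e) has_derivative (\<lambda>s. s *\<^sub>R ?e)) (at s0)" by (auto intro!: derivative_eq_intros)
    from diff_chain_at[OF this hd]
    have "((\<lambda>s. G (x + s *\<^sub>R ?e)) has_derivative (\<lambda>s. frechet_derivative G (at (x + s0 *\<^sub>R ?e)) (s *\<^sub>R ?e))) (at s0)"
      by (simp add: o_def)
    then show ?thesis
      using linear_cmul[OF linear_frechet_derivative[OF differentiableI[OF hd]]] by (simp add: pderiv_at_def)
  qed
  have lip: "norm (G (x + t *\<^sub>R ?e) - G x) \<le> b * t" if "t \<ge> 0" for x t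
  proof -
    have "norm (G (x + t *\<^sub>R ?e) - G (x + 0 *\<^sub>R ?e)) \<le> b * norm (t - 0)"
    proof (rule differentiable_bound[of "{0..t}" "\<lambda>s. G (x + s *\<^sub>R ?e)" "\<lambda>s0 s. s *\<^sub>R ?D (x + s0 *\<^sub>R ?e)"])
      show "onorm (\<lambda>s. s *\<^sub>R ?D (x + s0 *\<^sub>R ?e)) \<le> b" for s0
        using b by (intro onorm_le) (simp add: mult.commute[of b] mult_left_mono)
    qed (use that line in \<open>auto intro: has_derivative_at_withinI\<close>)
    then show ?thesis using that by simp
  qed
  \<comment> \<open>Step lengths tending to zero and bounded by one, so that the translated supports stay in the ball \<open>L\<close>.\<close>
  define t where "t n = inverse (real (Suc n))" for n
  define q where "q n x = (G (x + t n *\<^sub>R ?e) - G x) /\<^sub>R t n" for n x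
  have t: "t n > 0" "t n \<le> 1" for n by (auto simp: t_def inverse_le_1_iff)
  have lim_t: "t \<longlonglongrightarrow> 0" unfolding t_def by (rule LIMSEQ_inverse_real_of_nat)
  have intG: "integrable lborel G" by (rule intc[OF cG]) (use R in \<open>auto simp: L_def intro!: G0\<close>)
  have intG': "integrable lborel (\<lambda>x. G (x + t n *\<^sub>R ?e))" for n
  proof (rule intc)
    show "continuous_on UNIV (\<lambda>x. G (x + t n *\<^sub>R ?e))"
      by (intro continuous_on_compose2[OF cG] continuous_intros) auto
    fix x assume "x \<notin> L"
    then have "norm x > R + 1" by (simp add: L_def)
    moreover have "norm (t n *\<^sub>R ?e) \<le> 1" using t[of n] by (simp add: norm_axis_1)
    moreover have "norm x - norm (t n *\<^sub>R ?e) \<le> norm (x + t n *\<^sub>R ?e)" by (rule norm_diff_ineq)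
    ultimately show "G (x + t n *\<^sub>R ?e) = 0" by (intro G0) linarith
  qed
  have trans: "integral\<^sup>L lborel (\<lambda>x. G (x + t n *\<^sub>R ?e)) = integral\<^sup>L lborel G" for n
  proof -
    have "integral\<^sup>L lborel G = integral\<^sup>L (distr lborel borel ((+) (t n *\<^sub>R ?e))) G"
      by (simp add: lborel_distr_plus)
    also have "\<dots> = integral\<^sup>L lborel (\<lambda>x. G (t n *\<^sub>R ?e + x))"
      using borel_measurable_continuous_onI[OF cG] by (subst integral_distr) auto
    finally show ?thesis by (simp add: add.commute)
  qed
  have q0: "integral\<^sup>L lborel (q n) = 0" for n
    unfolding q_def using intG intG'[of n] trans[of n] by simp
  have "(\<lambda>n. integral\<^sup>L lborel (q n)) \<longlonglongrightarrow> integral\<^sup>L lborel ?D"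
  proof (rule integral_dominated_convergence[where w="\<lambda>x. indicator L x *\<^sub>R b"])
    show "?D \<in> borel_measurable lborel" using borel_measurable_continuous_onI[OF cD] by simp
    show "q n \<in> borel_measurable lborel" for n
      unfolding q_def using intG intG'[of n] by (intro borel_measurable_scaleR borel_measurable_diff) auto
    show "integrable lborel (\<lambda>x. indicator L x *\<^sub>R b)"
      by (rule borel_integrable_compact[OF L]) auto
    show "AE x in lborel. (\<lambda>n. q n x) \<longlonglongrightarrow> ?D x"
    proof (rule AE_I2)
      fix x
      have "((\<lambda>s. norm (G (x + (0 + s) *\<^sub>R ?e) - G (x + 0 *\<^sub>R ?e) - s *\<^sub>R ?D (x + 0 *\<^sub>R ?e)) / norm s) \<longlongrightarrow> 0) (at 0)"
        using line[of x 0] unfolding has_derivative_at by blast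
      moreover have "filterlim t (at 0) sequentially"
        using lim_t t by (auto simp: filterlim_at less_imp_neq[symmetric])
      ultimately have "(\<lambda>n. norm (G (x + (0 + t n) *\<^sub>R ?e) - G (x + 0 *\<^sub>R ?e) - t n *\<^sub>R ?D (x + 0 *\<^sub>R ?e)) / norm (t n)) \<longlonglongrightarrow> 0"
        by (rule filterlim_compose)
      moreover have "norm (G (x + (0 + t n) *\<^sub>R ?e) - G (x + 0 *\<^sub>R ?e) - t n *\<^sub>R ?D (x + 0 *\<^sub>R ?e)) / norm (t n) = norm (q n x - ?D x)" for n
      proof -
        have "q n x - ?D x = (G (x + t n *\<^sub>R ?e) - G x - t n *\<^sub>R ?D x) /\<^sub>R t n"
          using t[of n] by (simp add: q_def scaleR_diff_right)
        then show ?thesis using t[of n] by (simp add: divide_inverse mult.commute)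
      qed
      ultimately have "(\<lambda>n. norm (q n x - ?D x)) \<longlonglongrightarrow> 0" by simp
      then show "(\<lambda>n. q n x) \<longlonglongrightarrow> ?D x" using LIM_zero_iff tendsto_norm_zero_iff by blast
    qed
    show "AE x in lborel. norm (q n x) \<le> indicator L x *\<^sub>R b" for n
    proof (rule AE_I2)
      fix x
      show "norm (q n x) \<le> indicator L x *\<^sub>R b"
      proof (cases "x \<in> L")
        case True
        have "norm (q n x) = norm (G (x + t n *\<^sub>R ?e) - G x) / t n"
          unfolding q_def norm_scaleR using t(1)[of n] by (simp add: divide_inverse mult.commute)
        then show ?thesis using True lip[of "t n" x] t[of n] by (simp add: pos_divide_le_eq)
      next
        case False
        then have "norm x > R + 1" by (simp add: L_def)
        moreover have "norm (t n *\<^sub>R ?e) \<le> 1" using t[of n] by (simp add: norm_axis_1)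
        moreover have "norm x - norm (t n *\<^sub>R ?e) \<le> norm (x + t n *\<^sub>R ?e)" by (rule norm_diff_ineq)
        ultimately have "G (x + t n *\<^sub>R ?e) = 0" "G x = 0" by (auto intro!: G0)
        then show ?thesis using False by (simp add: q_def)
      qed
    qed
  qed
  with q0 show "integral\<^sup>L lborel ?D = 0" by (simp add: LIMSEQ_const_iff)
qed

text \<open>The vector field, extended by zero off \<open>U\<close>, is still continuously differentiable because it vanishes off a
compact subset of \<open>U\<close>.\<close>

lemma integral_divergence_zero:
  fixes G :: "'m::finite \<Rightarrow> real^'m \<Rightarrow> complex"
  assumes U: "open U" and G: "\<And>i. C1_on U (G i)" and K: "compact K" "K \<subseteq> U"
    and G0: "\<And>i x. x \<in> U \<Longrightarrow> x \<notin> K \<Longrightarrow> G i x = 0"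
  shows "integral\<^sup>L lborel (\<lambda>x. indicator U x *\<^sub>R (\<Sum>i\<in>UNIV. pderiv_at i (G i) x)) = 0"
proof -
  define F where "F i x = (if x \<in> U then G i x else 0)" for i x
  have F0: "F i x = 0" if "x \<notin> K" for i x using G0 that by (simp add: F_def)
  have KC: "open (- K)" using compact_imp_closed[OF K(1)] by auto
  have FU: "C1_on U (F i)" for i by (rule C1_on_cong[OF U G]) (simp add: F_def)
  have FK: "C1_on (- K) (F i)" for i by (rule C1_on_cong[OF KC C1_on_const[of _ 0]]) (simp add: F0)
  have "C1_on UNIV (F i)" for i
  proof -
    have un: "U \<union> - K = UNIV" using K(2) by auto
    have "continuous_on (U \<union> - K) (pderiv_at j (F i))" for j
      using FU[of i] FK[of i] U KC by (intro continuous_on_open_Un) (auto simp: C1_on_def)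
    moreover have "F i differentiable (at x)" for x
      using FU[of i] FK[of i] un by (auto simp: C1_on_def)
    ultimately show ?thesis by (simp add: C1_on_def un)
  qed
  note int = integral_pderiv_zero[OF this K(1) F0]
  have "indicator U x *\<^sub>R (\<Sum>i\<in>UNIV. pderiv_at i (G i) x) = (\<Sum>i\<in>UNIV. pderiv_at i (F i) x)" for x
  proof (cases "x \<in> U")
    case True
    then show ?thesis using pderiv_at_cong[OF U True, of "F _" "G _"] by (simp add: F_def)
  next
    case False
    then have "x \<in> - K" using K(2) by auto
    then show ?thesis using False pderiv_at_cong[OF KC, of x "F _" "\<lambda>_. 0"] F0 by simp
  qed
  then have "integral\<^sup>L lborel (\<lambda>x. indicator U x *\<^sub>R (\<Sum>i\<in>UNIV. pderiv_at i (G i) x))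
     = (\<Sum>i\<in>UNIV. integral\<^sup>L lborel (pderiv_at i (F i)))"
    using int by simp
  then show ?thesis using int by simp
qed

section \<open>The Riemannian volume in a chart\<close>

text \<open>On subsets of the chart domain the volume is the image of the measure \<open>sqrt (det h) dx\<close> under the
parametrization, so the two measures have the same restriction to that domain.\<close>

lemma chart_integral:
  fixes A :: "('a::{t2_space,second_countable_topology}, 'n::finite) chart set" and F :: "'a \<Rightarrow> complex"
  assumes A: "smooth_atlas A" and c: "c \<in> A" and \<mu>: "riemannian_volume A h \<mu>"
    and d: "continuous_on (img c) (\<lambda>x. sqrt (det (h c x)))" "\<And>x. x \<in> img c \<Longrightarrow> det (h c x) \<ge> 0"
    and F: "continuous_on (img c) (F \<circ> param c)" "\<And>p. p \<notin> dom_of c \<Longrightarrow> F p = 0"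
  shows "integral\<^sup>L \<mu> F = integral\<^sup>L lborel (\<lambda>x. indicator (img c) x *\<^sub>R (sqrt (det (h c x)) *\<^sub>R F (param c x)))"
    "integrable \<mu> F \<longleftrightarrow> integrable lborel (\<lambda>x. indicator (img c) x *\<^sub>R (sqrt (det (h c x)) *\<^sub>R F (param c x)))"
proof -
  note o = chart_open[OF A c] and inv = chart_inverse[OF A c] coord_in_img[of _ c]
  define g where "g x = (if x \<in> img c then sqrt (det (h c x)) else 0)" for x
  define p where "p x = (if x \<in> img c then param c x else undefined)" for x
  have g[measurable]: "g \<in> borel_measurable borel"
    unfolding g_def using d(1) o(2) by (intro borel_measurable_continuous_on_if) auto
  have g0: "g x \<ge> 0" for x using d(2) by (simp add: g_def)
  have p[measurable]: "p \<in> borel_measurable borel"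
    unfolding p_def using chart_continuous(2)[OF A c] o(2) by (intro borel_measurable_continuous_on_if) auto
  have [measurable]: "dom_of c \<in> sets borel" "img c \<in> sets borel" using o by auto
  have s\<mu>: "sets \<mu> = sets borel" using \<mu> by (simp add: riemannian_volume_def)
  then have sp\<mu>: "space \<mu> = UNIV" by (metis sets_eq_imp_space_eq space_borel)
  define \<nu> where "\<nu> = distr (density lborel g) borel p"
  have FF: "F = (\<lambda>q. if q \<in> dom_of c then ((F \<circ> param c) \<circ> coord c) q else 0)"
    using F(2) inv by (auto simp: fun_eq_iff)
  have Fm: "F \<in> borel_measurable borel"
  proof -
    have "continuous_on (dom_of c) ((F \<circ> param c) \<circ> coord c)"
      by (rule continuous_on_compose[OF chart_continuous(1)[OF A c]]) (use F(1) in \<open>simp add: img_def\<close>)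
    then show ?thesis
      by (subst FF) (rule borel_measurable_continuous_on_if, auto)
  qed
  have em: "emeasure \<mu> B = emeasure \<nu> B" if B: "B \<in> sets borel" "B \<subseteq> dom_of c" for B
  proof -
    have "emeasure \<nu> B = emeasure (density lborel g) (p -` B)"
      unfolding \<nu>_def using B(1) by (subst emeasure_distr) auto
    also have "\<dots> = (\<integral>\<^sup>+x. ennreal (g x) * indicator (p -` B) x \<partial>lborel)"
      using measurable_sets[OF p B(1)] by (subst emeasure_density) auto
    also have "\<dots> = (\<integral>\<^sup>+x. ennreal (sqrt (det (h c x))) * indicator (coord c ` B) x \<partial>lborel)"
    proof (rule nn_integral_cong)
      fix x
      have "x \<in> img c \<and> param c x \<in> B \<longleftrightarrow> x \<in> coord c ` B"
        using coord_image_eq[OF A c, of B] B(2) by (auto simp: Int_absorb1)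
      then show "ennreal (g x) * indicator (p -` B) x = ennreal (sqrt (det (h c x))) * indicator (coord c ` B) x"
        by (auto simp: g_def p_def indicator_def)
    qed
    also have "\<dots> = emeasure \<mu> B" using \<mu> c B by (simp add: riemannian_volume_def)
    finally show ?thesis by simp
  qed
  have rs: "restrict_space \<mu> (dom_of c) = restrict_space \<nu> (dom_of c)"
  proof (rule measure_eqI)
    show "sets (restrict_space \<mu> (dom_of c)) = sets (restrict_space \<nu> (dom_of c))"
      by (simp add: sets_restrict_space s\<mu> \<nu>_def)
    fix B assume "B \<in> sets (restrict_space \<mu> (dom_of c))"
    then have B: "B \<in> sets borel" "B \<subseteq> dom_of c"
      using o(1) by (auto simp: sets_restrict_space s\<mu>)
    then show "emeasure (restrict_space \<mu> (dom_of c)) B = emeasure (restrict_space \<nu> (dom_of c)) B"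
      using o(1) em by (simp add: emeasure_restrict_space s\<mu> sp\<mu> \<nu>_def)
  qed
  have Fi: "(\<lambda>q. indicator (dom_of c) q *\<^sub>R F q) = F" using F(2) by (auto simp: indicator_def)
  have gi: "(\<lambda>x. g x *\<^sub>R F (p x)) = (\<lambda>x. indicator (img c) x *\<^sub>R (sqrt (det (h c x)) *\<^sub>R F (param c x)))"
    by (auto simp: g_def p_def indicator_def)
  have dm: "dom_of c \<inter> space \<mu> \<in> sets \<mu>" "dom_of c \<inter> space \<nu> \<in> sets \<nu>"
    using o(1) by (auto simp: s\<mu> sp\<mu> \<nu>_def)
  have "integral\<^sup>L \<mu> F = integral\<^sup>L \<nu> F"
    using integral_restrict_space[OF dm(1), of F] integral_restrict_space[OF dm(2), of F] unfolding Fi rs by simp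
  also have "\<dots> = integral\<^sup>L (density lborel g) (\<lambda>x. F (p x))"
    unfolding \<nu>_def using Fm by (intro integral_distr) auto
  also have "\<dots> = integral\<^sup>L lborel (\<lambda>x. g x *\<^sub>R F (p x))"
    using g0 measurable_compose[OF p Fm] by (intro integral_density) auto
  finally show "integral\<^sup>L \<mu> F = integral\<^sup>L lborel (\<lambda>x. indicator (img c) x *\<^sub>R (sqrt (det (h c x)) *\<^sub>R F (param c x)))"
    unfolding gi .
  have "integrable \<mu> F \<longleftrightarrow> integrable \<nu> F"
    using integrable_restrict_space[OF dm(1), of F] integrable_restrict_space[OF dm(2), of F] unfolding Fi rs by simp
  also have "\<dots> \<longleftrightarrow> integrable (density lborel g) (\<lambda>x. F (p x))"
    unfolding \<nu>_def using Fm by (intro integrable_distr_eq) auto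
  also have "\<dots> \<longleftrightarrow> integrable lborel (\<lambda>x. g x *\<^sub>R F (p x))"
    using g0 measurable_compose[OF p Fm] by (intro integrable_density) auto
  finally show "integrable \<mu> F \<longleftrightarrow> integrable lborel (\<lambda>x. indicator (img c) x *\<^sub>R (sqrt (det (h c x)) *\<^sub>R F (param c x)))"
    unfolding gi .
qed

lemma chart_integrable_compact:
  fixes A :: "('a::{t2_space,second_countable_topology}, 'n::finite) chart set" and F :: "'a \<Rightarrow> complex"
  assumes A: "smooth_atlas A" and c: "c \<in> A" and \<mu>: "riemannian_volume A h \<mu>"
    and d: "continuous_on (img c) (\<lambda>x. sqrt (det (h c x)))" "\<And>x. x \<in> img c \<Longrightarrow> det (h c x) \<ge> 0"
    and F: "continuous_on (img c) (F \<circ> param c)"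
    and K: "compact K" "K \<subseteq> img c" "\<And>p. p \<notin> param c ` K \<Longrightarrow> F p = 0"
  shows "integrable \<mu> F"
    "integrable lborel (\<lambda>x. indicator (img c) x *\<^sub>R (sqrt (det (h c x)) *\<^sub>R F (param c x)))"
proof -
  have F0: "F p = 0" if "p \<notin> dom_of c" for p
  proof (rule K(3))
    show "p \<notin> param c ` K" using K(2) chart_inverse(3)[OF A c] that by auto
  qed
  have "continuous_on K (\<lambda>x. sqrt (det (h c x)) *\<^sub>R (F \<circ> param c) x)"
    by (intro continuous_on_scaleR continuous_on_subset[OF d(1) K(2)] continuous_on_subset[OF F K(2)])
  from borel_integrable_compact[OF K(1) this]
  have "integrable lborel (\<lambda>x. indicator K x *\<^sub>R (sqrt (det (h c x)) *\<^sub>R F (param c x)))" by simp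
  moreover have "indicator K x *\<^sub>R (sqrt (det (h c x)) *\<^sub>R F (param c x))
      = indicator (img c) x *\<^sub>R (sqrt (det (h c x)) *\<^sub>R F (param c x))" for x
  proof (cases "x \<in> img c \<and> x \<notin> K")
    case True
    have "x = y" if "y \<in> K" "param c x = param c y" for y
      using chart_inverse(2)[OF A c, of x] chart_inverse(2)[OF A c, of y] True K(2) that by auto
    then have "param c x \<notin> param c ` K" using True by blast
    then show ?thesis using K(3) by simp
  next
    case False
    then show ?thesis using K(2) by (auto simp: indicator_def)
  qed
  ultimately show i: "integrable lborel (\<lambda>x. indicator (img c) x *\<^sub>R (sqrt (det (h c x)) *\<^sub>R F (param c x)))" by (simp only:)
  show "integrable \<mu> F" using chart_integral(2)[OF A c \<mu> d F F0] i by blast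
qed

section \<open>The metric and its expansion\<close>

text \<open>On the segment from the identity to \<open>M\<close> all matrices are positive definite, so the determinant has no zero.\<close>

lemma det_pos_of_pos_def:
  fixes M :: "real^'k::finite^'k"
  assumes "\<And>\<xi>. \<xi> \<noteq> 0 \<Longrightarrow> \<xi> \<bullet> (M *v \<xi>) > 0"
  shows "det M > 0"
proof (rule ccontr)
  assume "\<not> det M > 0"
  define f where "f t = det ((1 - t) *\<^sub>R mat 1 + t *\<^sub>R M)" for t
  have "continuous_on {0..1} f"
    unfolding f_def det_def by (intro continuous_intros)
  moreover have "f 0 = 1" "f 1 \<le> 0" using \<open>\<not> det M > 0\<close> by (simp_all add: f_def)
  ultimately obtain t where t: "0 \<le> t" "t \<le> 1" "f t = 0"
    using IVT2'[of f 1 0 0] by auto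
  let ?X = "(1 - t) *\<^sub>R mat 1 + t *\<^sub>R M"
  have "\<not> invertible ?X" using t(3) by (simp add: f_def invertible_det_nz)
  then obtain \<xi> where \<xi>: "\<xi> \<noteq> 0" "?X *v \<xi> = 0"
    using matrix_left_invertible_ker[of ?X] invertible_left_inverse[of ?X] by blast
  have "?X *v \<xi> = (1 - t) *\<^sub>R \<xi> + t *\<^sub>R (M *v \<xi>)"
    by (simp add: matrix_vector_mult_add_rdistrib scaleR_matrix_vector_assoc[symmetric])
  then have "(1 - t) * (\<xi> \<bullet> \<xi>) + t * (\<xi> \<bullet> (M *v \<xi>)) = 0"
    using \<xi>(2) by (metis inner_add_right inner_scaleR_right inner_zero_right)
  moreover have "\<xi> \<bullet> \<xi> > 0" "\<xi> \<bullet> (M *v \<xi>) > 0" using \<xi>(1) assms by auto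
  ultimately show False using t(1,2)
    by (smt (verit) mult_nonneg_nonneg mult_pos_pos)
qed

lemma tendsto_det:
  fixes M :: "'x \<Rightarrow> real^'k::finite^'k"
  assumes "\<And>i j. ((\<lambda>x. M x $ i $ j) \<longlongrightarrow> L $ i $ j) F"
  shows "((\<lambda>x. det (M x)) \<longlongrightarrow> det L) F"
  unfolding det_def by (intro tendsto_intros assms)

lemma C1_on_det:
  fixes M :: "real^'m::finite \<Rightarrow> real^'k::finite^'k"
  assumes "\<And>i j. C1_on U (\<lambda>x. M x $ i $ j)"
  shows "C1_on U (\<lambda>x. det (M x))"
  unfolding det_def by (intro C1_on_sum C1_on_mult C1_on_prod C1_on_const assms)

text \<open>The truncations under consideration, and the order up to which all of them agree. For odd \<open>n\<close> any order \<open>N\<close> can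
be reached; for even \<open>n\<close> there is just the one truncation, and expansions are carried to the order of the
logarithm, which may exceed \<open>N\<close>.\<close>

definition truncation_set :: "nat \<Rightarrow> nat \<Rightarrow> nat set" where
  "truncation_set n N = (if even n then {n div 2} else {N..})"

definition truncation_order :: "nat \<Rightarrow> nat \<Rightarrow> nat" where
  "truncation_order n N = (if even n then n div 2 else N)"

lemma truncation_set_le: "K \<in> truncation_set n N \<Longrightarrow> truncation_order n N \<le> K"
  by (auto simp: truncation_set_def truncation_order_def split: if_splits)

lemma truncation_set_admissible: "K \<in> truncation_set n N \<Longrightarrow> j \<le> K \<Longrightarrow> admissible n j"
  by (auto simp: truncation_set_def admissible_def split: if_splits)

lemma eventually_truncations_ex:
  "eventually Q (truncations n) \<Longrightarrow> \<exists>K\<in>truncation_set n N. Q K"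
proof (cases "even n")
  case False
  assume "eventually Q (truncations n)"
  with False obtain M where "\<And>K. K \<ge> M \<Longrightarrow> Q K"
    by (auto simp: truncations_def eventually_sequentially)
  then have "Q (max M N)" by simp
  then show ?thesis using False unfolding truncation_set_def by (intro bexI[of _ "max M N"]) auto
qed (auto simp: truncations_def truncation_set_def eventually_principal)

lemma h_trunc_nth:
  "h_trunc hk hlog K c r x $ i $ j = (\<Sum>k\<le>K. r ^ (2 * k) * hk k c x $ i $ j)
     + (if even CARD('n) then r ^ CARD('n) * ln r * hlog c x $ i $ j else 0)"
  for x :: "real^'n::finite"
  by (simp add: h_trunc_def sum_component)

lemma h_trunc_jet_expansion:
  fixes A :: "('a::{t2_space,second_countable_topology}, 'n::finite) chart set"
  assumes A: "smooth_atlas A" and c: "c \<in> A" and n: "CARD('n) \<ge> 2" and N: "N \<ge> 1"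
    and pe: "poincare_einstein A h hk hlog"
  shows "jet_expansion (truncation_set CARD('n) N) (truncation_order CARD('n) N) (img c)
     (\<lambda>K z. h_trunc hk hlog K c (z $ None) (cyl_base z) $ i $ j)
     (\<lambda>x. Abs_fps (\<lambda>k. if k \<le> truncation_order CARD('n) N then hk k c x $ i $ j else 0))
     (\<lambda>x. if even CARD('n) then hlog c x $ i $ j else 0)"
proof -
  let ?n = "CARD('n)" and ?\<K> = "truncation_set CARD('n) N" and ?m = "truncation_order CARD('n) N"
  have U: "open (img c)" by (rule chart_open(2)[OF A c])
  have smooth: "C1_on (img c) (\<lambda>x. k c x $ i $ j)" if "sym_tensor A k" for k
    using that c by (intro smooth_on_imp_C1_on U smooth_on_nth) (auto simp: sym_tensor_def)
  have hk: "C1_on (img c) (\<lambda>x. hk k c x $ i $ j)" if "K \<in> ?\<K>" "k \<le> K" for k K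
    using smooth pe truncation_set_admissible[OF that] by (auto simp: poincare_einstein_def)
  have hl: "C1_on (img c) (\<lambda>x. if even ?n then hlog c x $ i $ j else 0)"
    using smooth pe by (cases "even ?n") (auto simp: poincare_einstein_def)
  have m: "?m \<ge> 1" using n N by (auto simp: truncation_order_def)
  have ne: "?\<K> \<noteq> {}" by (auto simp: truncation_set_def)
  have "(\<lambda>K z. h_trunc hk hlog K c (z $ None) (cyl_base z) $ i $ j) = (\<lambda>K z. (\<Sum>k\<le>K. (z $ None) ^ (2 * k) * hk k c (cyl_base z) $ i $ j)
     + (z $ None) ^ (2 * ?m) * ln (z $ None) * (if even ?n then hlog c (cyl_base z) $ i $ j else 0))"
    by (auto simp: fun_eq_iff h_trunc_nth truncation_order_def)
  then show ?thesis
    using jet_expansion_radial_polynomial[OF m truncation_set_le hk ne hl U] by simp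
qed

section \<open>Differential operators\<close>

lemma iter_pderiv_zero:
  assumes "open S" "\<And>x. x \<in> S \<Longrightarrow> f x = 0" "x \<in> S" shows "iter_pderiv is f x = 0"
  using assms(3)
proof (induction "is" arbitrary: x)
  case (Cons i "is")
  then show ?case using pderiv_at_cong[OF assms(1) Cons.prems, of "iter_pderiv is f" "\<lambda>_. 0"] by simp
qed (use assms in auto)

lemma diff_operatorE:
  assumes P: "diff_operator A P" and f: "smooth_fun A f" and c: "c \<in> A"
  obtains m a where "\<And>is. smooth_on (img c) (a is)"
    "\<And>x. x \<in> img c \<Longrightarrow> P f (param c x) = (\<Sum>is | length is \<le> m. a is x * iter_pderiv is (f \<circ> param c) x)"
proof -
  obtain m where "\<forall>c\<in>A. \<exists>a. (\<forall>is. smooth_on (img c) (a is)) \<and> (\<forall>f. smooth_fun A f \<longrightarrow> (\<forall>x\<in>img c.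
      P f (param c x) = (\<Sum>is | length is \<le> m. a is x * iter_pderiv is (f \<circ> param c) x)))"
    using P unfolding diff_operator_def by (elim exE)
  from bspec[OF this c] obtain a where "\<forall>is. smooth_on (img c) (a is)" "\<forall>f. smooth_fun A f \<longrightarrow> (\<forall>x\<in>img c.
      P f (param c x) = (\<Sum>is | length is \<le> m. a is x * iter_pderiv is (f \<circ> param c) x))"
    by (elim exE conjE)
  then show ?thesis using f by (intro that) auto
qed

lemma rational_diff_operatorE:
  assumes P: "rational_diff_operator A S P" and f: "smooth_fun A f"
  obtains q d B where "\<And>z. poly q z = 0 \<Longrightarrow> z \<in> S" "\<And>k. diff_operator A (B k)"
    "\<And>lam x. lam \<notin> S \<Longrightarrow> P lam f x = (\<Sum>k\<le>(d::nat). lam^k * B k f x) / poly q lam"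
proof -
  obtain q d B where "\<forall>z. poly q z = 0 \<longrightarrow> z \<in> S" "\<forall>k. diff_operator A (B k)"
    "\<forall>lam f x. lam \<notin> S \<and> smooth_fun A f \<longrightarrow> P lam f x = (\<Sum>k\<le>(d::nat). lam^k * B k f x) / poly q lam"
    using P unfolding rational_diff_operator_def by (elim exE conjE)
  then show ?thesis using f by (intro that) auto
qed

lemma diff_operator_smooth:
  assumes A: "smooth_atlas A" and P: "diff_operator A P" and f: "smooth_fun A f" and c: "c \<in> A"
  shows "smooth_on (img c) (P f \<circ> param c)"
proof -
  obtain m a where a: "\<And>is. smooth_on (img c) (a is)"
    "\<And>x. x \<in> img c \<Longrightarrow> P f (param c x) = (\<Sum>is | length is \<le> m. a is x * iter_pderiv is (f \<circ> param c) x)"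
    by (rule diff_operatorE[OF P f c]) (rule that)
  have U: "open (img c)" by (rule chart_open(2)[OF A c])
  have "smooth_on (img c) (f \<circ> param c)" using f c by (simp add: smooth_fun_def)
  then have "smooth_on (img c) (\<lambda>x. \<Sum>is | length is \<le> m. a is x * iter_pderiv is (f \<circ> param c) x)"
    by (intro smooth_on_sum smooth_on_mult U a smooth_on_iter_pderiv)
  then show ?thesis by (rule smooth_on_cong[OF U]) (simp add: a)
qed

lemma diff_operator_local:
  assumes A: "smooth_atlas A" and P: "diff_operator A P" and f: "smooth_fun A f"
    and K: "closed K" "\<And>p. p \<notin> K \<Longrightarrow> f p = 0" and p: "p \<notin> K"
  shows "P f p = 0"
proof -
  obtain c where c: "c \<in> A" "p \<in> dom_of c" using chart_cover[OF A] by blast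
  obtain m a where "\<And>is. smooth_on (img c) (a is)"
    and a: "\<And>x. x \<in> img c \<Longrightarrow> P f (param c x) = (\<Sum>is | length is \<le> m. a is x * iter_pderiv is (f \<circ> param c) x)"
    by (rule diff_operatorE[OF P f c(1)]) (rule that)
  let ?S = "img c \<inter> param c -` (- K)"
  have S: "open ?S" using K(1) by (intro param_open_preimage[OF A c(1)]) auto
  have x: "coord c p \<in> img c" "param c (coord c p) = p"
    using chart_inverse(1)[OF A c] coord_in_img[OF c(2)] by auto
  have "iter_pderiv is (f \<circ> param c) (coord c p) = 0" for "is"
    by (rule iter_pderiv_zero[OF S]) (use K p x in auto)
  then show ?thesis using a[OF x(1)] x(2) by simp
qed

lemma rational_diff_operator_smooth:
  assumes A: "smooth_atlas A" and P: "rational_diff_operator A S P" and f: "smooth_fun A f" and c: "c \<in> A"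
    and lam: "lam \<notin> S"
  shows "smooth_on (img c) (P lam f \<circ> param c)"
proof -
  obtain q d B where "\<And>z. poly q z = 0 \<Longrightarrow> z \<in> S" and B: "\<And>k. diff_operator A (B k)"
    "\<And>lam x. lam \<notin> S \<Longrightarrow> P lam f x = (\<Sum>k\<le>(d::nat). lam^k * B k f x) / poly q lam"
    by (rule rational_diff_operatorE[OF P f]) (rule that)
  have U: "open (img c)" by (rule chart_open(2)[OF A c])
  have "smooth_on (img c) (\<lambda>x. (\<Sum>k\<le>d. lam^k * (B k f \<circ> param c) x) * inverse (poly q lam))"
    by (intro smooth_on_sum smooth_on_mult smooth_on_const U diff_operator_smooth[OF A B(1) f c])
  then show ?thesis by (rule smooth_on_cong[OF U]) (simp add: B(2)[OF lam] divide_inverse)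
qed

lemma rational_diff_operator_local:
  assumes A: "smooth_atlas A" and P: "rational_diff_operator A S P" and f: "smooth_fun A f"
    and lam: "lam \<notin> S" and K: "closed K" "\<And>p. p \<notin> K \<Longrightarrow> f p = 0" and p: "p \<notin> K"
  shows "P lam f p = 0"
proof -
  obtain q d B where "\<And>z. poly q z = 0 \<Longrightarrow> z \<in> S" and B: "\<And>k. diff_operator A (B k)"
    "\<And>lam x. lam \<notin> S \<Longrightarrow> P lam f x = (\<Sum>k\<le>(d::nat). lam^k * B k f x) / poly q lam"
    by (rule rational_diff_operatorE[OF P f]) (rule that)
  show ?thesis unfolding B(2)[OF lam] using diff_operator_local[OF A B(1) f K p] by simp
qed

section \<open>The integrated identity and the theorem\<close>

text \<open>The hypotheses of the theorem on the data, together with a chart in which the test functions will be supported.\<close>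

locale poincare_einstein_chart =
  fixes A :: "('a::{t2_space,second_countable_topology}, 'n::finite) chart set"
    and h hlog :: "('a, 'n) tensor2" and hk :: "nat \<Rightarrow> ('a, 'n) tensor2"
    and v :: "nat \<Rightarrow> 'a \<Rightarrow> real"
    and T :: "nat \<Rightarrow> complex \<Rightarrow> ('a \<Rightarrow> complex) \<Rightarrow> ('a \<Rightarrow> complex)"
    and \<mu> :: "'a measure" and N m :: nat and c :: "('a, 'n) chart"
  assumes A: "smooth_atlas A" and metric: "riemannian_metric A h" and n2: "CARD('n) \<ge> 2"
    and pe: "poincare_einstein A h hk hlog" and hc: "holographic_coeffs A h hk hlog v"
    and so: "solution_operators A hk hlog T" and \<mu>: "riemannian_volume A h \<mu>"
    and N: "1 \<le> N" "even CARD('n) \<Longrightarrow> 2 * N \<le> CARD('n)"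
    and c: "c \<in> A"
    and m_eq: "m = truncation_order CARD('n) N"
begin

lemma U: "open (img c)" by (rule chart_open(2)[OF A c])

lemma m: "1 \<le> m" "N \<le> m" "admissible CARD('n) m"
  using N n2 by (auto simp: m_eq truncation_order_def admissible_def)

lemma admissible_le: "j \<le> m \<Longrightarrow> admissible CARD('n) j"
  by (auto simp: m_eq truncation_order_def admissible_def split: if_splits)

lemma det_h_pos: "x \<in> img c \<Longrightarrow> det (h c x) > 0"
  using metric c by (intro det_pos_of_pos_def) (auto simp: riemannian_metric_def)

lemma C1_det_h: "C1_on (img c) (\<lambda>x. det (h c x))"
  using metric c by (intro C1_on_det smooth_on_imp_C1_on U smooth_on_nth)
    (auto simp: riemannian_metric_def sym_tensor_def)

lemma C1_sqrt_det_h: "C1_on (img c) (\<lambda>x. sqrt (det (h c x)))"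
proof (rule C1_on_compose_real[OF C1_det_h])
  show "(sqrt has_real_derivative (inverse (sqrt (det (h c x))) / 2)) (at (det (h c x)))" if "x \<in> img c" for x
    using DERIV_real_sqrt[OF det_h_pos[OF that]] by simp
  show "continuous_on ((\<lambda>x. det (h c x)) ` img c) (\<lambda>t. inverse (sqrt t) / 2)"
    using det_h_pos by (intro continuous_intros) force+
qed

lemma sqrt_det_h: "continuous_on (img c) (\<lambda>x. sqrt (det (h c x)))" "x \<in> img c \<Longrightarrow> det (h c x) \<ge> 0"
  using C1_on_continuous[OF C1_sqrt_det_h] det_h_pos[of x] by auto

lemma v_smooth: "j \<le> m \<Longrightarrow> smooth_on (img c) (v j \<circ> param c)"
  using hc c admissible_le by (auto simp: holographic_coeffs_def smooth_fun_def)

lemma T_smooth: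
  "admissible CARD('n) j \<Longrightarrow> lam \<notin> poles CARD('n) j \<Longrightarrow> smooth_fun A f \<Longrightarrow> smooth_on (img c) (T j lam f \<circ> param c)"
  using so by (intro rational_diff_operator_smooth[OF A _ _ c]) (auto simp: solution_operators_def)

lemma param_notin_image: "x \<in> img c \<Longrightarrow> x \<notin> K \<Longrightarrow> K \<subseteq> img c \<Longrightarrow> param c x \<notin> param c ` K"
proof
  assume x: "x \<in> img c" "x \<notin> K" "K \<subseteq> img c" and "param c x \<in> param c ` K"
  then obtain y where y: "y \<in> K" "param c x = param c y" by blast
  then have "x = y" using chart_inverse(2)[OF A c, of x] chart_inverse(2)[OF A c, of y] x by auto
  then show False using x y by simp
qed

lemma integrable_compact_chart:
  fixes F :: "'a \<Rightarrow> complex"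
  assumes "continuous_on (img c) (F \<circ> param c)" "compact K" "K \<subseteq> img c" "\<And>p. p \<notin> param c ` K \<Longrightarrow> F p = 0"
  shows "integrable \<mu> F"
  by (rule chart_integrable_compact(1)[OF A c \<mu> sqrt_det_h assms])

text \<open>The theorem tested against \<open>f\<close>: integrate the divergence identity over the chart. As \<open>w = sqrt (det h) v\<close>, the
density of the volume is already present in it.\<close>

lemma generic_identity:
  assumes f: "smooth_fun A f" and K: "compact K" "K \<subseteq> img c" "\<And>p. p \<notin> param c ` K \<Longrightarrow> f p = 0"
    and lam: "\<And>j. admissible CARD('n) j \<Longrightarrow> lam \<notin> poles CARD('n) j"
  shows "(\<Sum>j\<le>N. (lam * of_nat N + of_nat j * (lam - of_nat CARD('n) + 2 * of_nat N)) *
      (\<integral>p. T j lam f p * complex_of_real (v (N - j) p) \<partial>\<mu>)) = 0"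
proof -
  let ?\<K> = "truncation_set CARD('n) N"
  let ?w = "\<lambda>x. fps_const (sqrt (det (h c x))) * Abs_fps (\<lambda>k. if k \<le> m then v k (param c x) else 0)"
  let ?u = "\<lambda>k x. if admissible CARD('n) k then T k lam f (param c x) else 0"
  let ?co = "\<lambda>j. lam * of_nat N + of_nat j * (lam - of_nat CARD('n) + 2 * of_nat N)"
  note jets = h_trunc_jet_expansion[OF A c n2 N(1) pe, folded m_eq]
  have Kc: "closed (param c ` K)" using compact_param_image[OF A c K(1,2)] by (rule compact_imp_closed)
  have T0: "T j lam f p = 0" if "admissible CARD('n) j" "p \<notin> param c ` K" for j p
    using so lam[OF that(1)] that f
    by (intro rational_diff_operator_local[OF A _ f _ Kc K(3)]) (auto simp: solution_operators_def)
  have u_smooth: "smooth_on (img c) (?u k)" for k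
    using T_smooth[OF _ lam f, of k] by (cases "admissible CARD('n) k") (auto simp: o_def intro: smooth_on_const[OF U])
  have w: "fps_C1_on (img c) ?w"
    unfolding fps_C1_on_def
  proof
    fix k
    show "C1_on (img c) (\<lambda>x. fps_nth (?w x) k)"
      using C1_on_mult[OF C1_sqrt_det_h smooth_on_imp_C1_on[OF U v_smooth, of k]]
      by (cases "k \<le> m") (simp_all add: o_def)
  qed
  have lim: "((\<lambda>r. det (h_trunc hk hlog L c r x)) \<longlongrightarrow> det (h c x)) (at_right 0)" if L: "L \<in> ?\<K>" and x: "x \<in> img c" for L x
  proof (rule tendsto_det)
    fix i j
    have "has_log_expansion m (\<lambda>r. h_trunc hk hlog L c r x $ i $ j) (Abs_fps (\<lambda>k. if k \<le> m then hk k c x $ i $ j else 0))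
       (if even CARD('n) then hlog c x $ i $ j else 0)"
      using jet_expansionD(2)[OF jets L x] by simp
    from has_log_expansion_imp_has_expansion[OF this, of 0] m(1)
    have "has_expansion 0 (\<lambda>r. h_trunc hk hlog L c r x $ i $ j) (Abs_fps (\<lambda>k. if k \<le> m then hk k c x $ i $ j else 0))" by simp
    from has_expansion_imp_tendsto[OF this]
    show "((\<lambda>r. h_trunc hk hlog L c r x $ i $ j) \<longlongrightarrow> h c x $ i $ j) (at_right 0)"
      using pe c x by (simp add: poincare_einstein_def)
  qed
  have root: "\<exists>L\<in>?\<K>. has_expansion m (\<lambda>r. sqrt (det (h_trunc hk hlog L c r x))) (?w x)" if x: "x \<in> img c" for x
  proof -
    have "\<forall>\<^sub>F L in truncations CARD('n). (\<lambda>r. sqrt (det (h_trunc hk hlog L c r x)) / sqrt (det (h c x))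
                - (\<Sum>j\<le>m. v j (param c x) * r^(2*j))) \<in> o[at_right 0](\<lambda>r. r^(2*m))"
      using hc m(3) c x unfolding holographic_coeffs_def by blast
    then obtain L where L: "L \<in> ?\<K>" "(\<lambda>r. sqrt (det (h_trunc hk hlog L c r x)) / sqrt (det (h c x))
                - (\<Sum>j\<le>m. v j (param c x) * r^(2*j))) \<in> o[at_right 0](\<lambda>r. r^(2*m))"
      using eventually_truncations_ex by blast
    have "has_expansion m (\<lambda>r. sqrt (det (h_trunc hk hlog L c r x)) / sqrt (det (h c x)))
        (Abs_fps (\<lambda>k. if k \<le> m then v k (param c x) else 0))"
      using L(2) by (simp add: has_expansion_def fps_trunc_eval_def)
    from has_expansion_cmult[OF this, of "sqrt (det (h c x))"]
    have "has_expansion m (\<lambda>r. sqrt (det (h_trunc hk hlog L c r x))) (?w x)"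
      using det_h_pos[OF x] by simp
    then show ?thesis using L(1) by blast
  qed
  have eigen: "\<exists>L\<in>?\<K>. (\<lambda>r. complex_of_real r powr (- lam) *
        (laplacian (g_plus (h_trunc hk hlog L c)) (radial_sum L (\<lambda>j. lam + 2 * of_nat j) ?u) (cyl_point x r)
         + lam * (of_nat CARD('n) - lam) * radial_sum L (\<lambda>j. lam + 2 * of_nat j) ?u (cyl_point x r)))
      \<in> o[at_right 0](\<lambda>r. of_real r ^ (2 * m))" if x: "x \<in> img c" for x
  proof -
    have so': "\<forall>c\<in>A. \<forall>x\<in>img c. (odd CARD('n) \<longrightarrow> (\<forall>m. \<forall>\<^sub>F K in sequentially.
              eigen_defect hk hlog T lam f K c x
                \<in> O[at_right 0](\<lambda>r. complex_of_real r powr (lam + of_nat m)))) \<and>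
           (even CARD('n) \<longrightarrow>
              eigen_defect hk hlog T lam f (CARD('n) div 2) c x
                \<in> O[at_right 0](\<lambda>r. complex_of_real r powr (lam + of_nat CARD('n) + 1)))"
      using so lam f unfolding solution_operators_def by (elim conjE allE[of _ lam] allE[of _ f] impE) simp_all
    have eigen_odd: "odd CARD('n) \<Longrightarrow> \<forall>\<^sub>F K in sequentially. eigen_defect hk hlog T lam f K c x
                \<in> O[at_right 0](\<lambda>r. complex_of_real r powr (lam + of_nat k))"
      and eigen_even: "even CARD('n) \<Longrightarrow> eigen_defect hk hlog T lam f (CARD('n) div 2) c x
                \<in> O[at_right 0](\<lambda>r. complex_of_real r powr (lam + of_nat CARD('n) + 1))" for k
      using bspec[OF bspec[OF so' c] x] by auto
    \<comment> \<open>Both parities give the error order \<open>lam + 2m + 1\<close>: for even \<open>n\<close> it is \<open>lam + n + 1\<close>, for odd \<open>n\<close> it is a choice.\<close>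
    have "\<exists>L\<in>?\<K>. eigen_defect hk hlog T lam f L c x
        \<in> O[at_right 0](\<lambda>r. complex_of_real r powr (lam + of_nat (2 * m + 1)))"
    proof (cases "even CARD('n)")
      case True
      then have "eigen_defect hk hlog T lam f (CARD('n) div 2) c x
          \<in> O[at_right 0](\<lambda>r. complex_of_real r powr (lam + of_nat CARD('n) + 1))"
        by (rule eigen_even)
      moreover have "lam + of_nat CARD('n) + 1 = lam + of_nat (2 * m + 1)"
        using True by (auto simp: m_eq truncation_order_def elim!: evenE)
      ultimately show ?thesis using True by (simp add: truncation_set_def)
    next
      case False
      then have "\<forall>\<^sub>F L in truncations CARD('n). eigen_defect hk hlog T lam f L c x
                \<in> O[at_right 0](\<lambda>r. complex_of_real r powr (lam + of_nat (2 * m + 1)))"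
        using eigen_odd[OF False, of "2 * m + 1"] by (simp only: truncations_def False if_False)
      then show ?thesis by (rule eventually_truncations_ex)
    qed
    then obtain L where L: "L \<in> ?\<K>" and E: "eigen_defect hk hlog T lam f L c x
        \<in> O[at_right 0](\<lambda>r. complex_of_real r powr (lam + of_nat (2 * m + 1)))" by blast
    have u: "u_trunc T lam f L c = radial_sum L (\<lambda>j. lam + 2 * of_nat j) ?u"
      unfolding u_trunc_def radial_sum_def fun_eq_iff using truncation_set_admissible[OF L]
      by (auto intro!: sum.cong)
    have "(\<lambda>r. complex_of_real r powr (- lam) * eigen_defect hk hlog T lam f L c x r)
        \<in> O[at_right 0](\<lambda>r. complex_of_real r powr (- lam) * complex_of_real r powr (lam + of_nat (2 * m + 1)))"
      using E by (intro landau_o.big.mult_left)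
    also have "(\<lambda>r. complex_of_real r powr (- lam) * complex_of_real r powr (lam + of_nat (2 * m + 1)))
        \<in> \<Theta>[at_right 0](\<lambda>r. of_real r ^ (2 * m + 1))"
    proof (rule bigthetaI_cong, use eventually_at_right_less[of "0::real"] in eventually_elim)
      case (elim r)
      then show ?case
        using of_real_powr_add_nat[OF elim, of 0 "2 * m + 1"] by (simp add: powr_add[symmetric])
    qed
    also have "(\<lambda>r. of_real r ^ (2 * m + 1)) \<in> o[at_right 0](\<lambda>r. complex_of_real r ^ (2 * m))"
    proof -
      have "(\<lambda>r::real. r) \<in> o[at_right 0](\<lambda>_. 1)" by real_asymp
      then have "(\<lambda>r. complex_of_real r) \<in> o[at_right 0](\<lambda>_. complex_of_real 1)"
        unfolding landau_o.small.of_real_iff .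
      from landau_o.small.mult_left[OF this, of "\<lambda>r. complex_of_real r ^ (2 * m)"]
      show ?thesis by (simp add: mult.commute)
    qed
    finally show ?thesis using L unfolding eigen_defect_def u by blast
  qed
  have set_le: "m \<le> L" if "L \<in> ?\<K>" for L using truncation_set_le[OF that] by (simp add: m_eq)
  have jets': "\<exists>\<phi> a. jet_expansion ?\<K> m (img c) (\<lambda>K z. h_trunc hk hlog K c (z $ None) (cyl_base z) $ i $ j) \<phi> a" for i j
    using jets by blast
  obtain G where G: "\<And>i. C1_on (img c) (G i)"
    "\<And>x i. x \<in> img c \<Longrightarrow> \<forall>k j. pderiv_at j (?u k) x = 0 \<Longrightarrow> G i x = 0"
    "\<And>x. x \<in> img c \<Longrightarrow> (\<Sum>j\<le>N. 2 * ?co j * of_real (fps_nth (?w x) (N - j)) * ?u j x)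
       + (\<Sum>i\<in>UNIV. pderiv_at i (G i) x) = 0"
    using divergence_identity[where H="\<lambda>K. h_trunc hk hlog K c" and u="?u" and \<K>="?\<K>" and m=m and U="img c"
        and lam=lam and N=N and d="\<lambda>x. det (h c x)" and w="?w",
        OF U m(1) set_le jets' lim det_h_pos w root u_smooth eigen N(1) m(2)] by blast
  have G0: "G i x = 0" if x: "x \<in> img c" "x \<notin> K" for i x
  proof (rule G(2)[OF x(1)], intro allI)
    fix k j
    have S: "open (img c \<inter> - K)" using U compact_imp_closed[OF K(1)] by auto
    have "pderiv_at j (?u k) x = pderiv_at j (\<lambda>_. 0) x"
      using x T0 param_notin_image[OF _ _ K(2)] by (intro pderiv_at_cong[OF S]) auto
    then show "pderiv_at j (?u k) x = 0" by simp
  qed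
  let ?F = "\<lambda>j p. T j lam f p * complex_of_real (v (N - j) p)"
  have ad: "admissible CARD('n) j" "j \<le> m" if "j \<le> N" for j using that m(2) admissible_le[of j] by auto
  have Fc: "continuous_on (img c) (?F j \<circ> param c)" if "j \<le> N" for j
  proof -
    have "smooth_on (img c) (\<lambda>x. (T j lam f \<circ> param c) x * complex_of_real ((v (N - j) \<circ> param c) x))"
      using ad[OF that] m(2) by (intro smooth_on_mult U smooth_on_of_real T_smooth lam f v_smooth) auto
    from C1_on_continuous[OF smooth_on_imp_C1_on[OF U this]] show ?thesis by (simp add: o_def)
  qed
  have F0: "?F j p = 0" if "j \<le> N" "p \<notin> param c ` K" for j p using T0[OF ad(1)] that by simp
  have Fint: "integrable \<mu> (?F j)" if "j \<le> N" for j
    by (rule integrable_compact_chart[OF Fc[OF that] K(1,2)]) (rule F0[OF that])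
  let ?S = "\<lambda>p. \<Sum>j\<le>N. ?co j * ?F j p"
  have "(\<Sum>j\<le>N. ?co j * integral\<^sup>L \<mu> (?F j)) = integral\<^sup>L \<mu> ?S"
    using Fint by (subst Bochner_Integration.integral_sum) auto
  also have "\<dots> = integral\<^sup>L lborel (\<lambda>x. indicator (img c) x *\<^sub>R (sqrt (det (h c x)) *\<^sub>R ?S (param c x)))"
  proof (rule chart_integral(1)[OF A c \<mu> sqrt_det_h])
    have "continuous_on (img c) (\<lambda>x. \<Sum>j\<le>N. ?co j * (?F j \<circ> param c) x)"
      by (rule continuous_on_sum, rule continuous_on_mult[OF continuous_on_const Fc]) simp
    then show "continuous_on (img c) (?S \<circ> param c)" by (simp add: o_def)
    fix p assume "p \<notin> dom_of c"
    then have "p \<notin> param c ` K" using K(2) chart_inverse(3)[OF A c] by auto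
    then show "?S p = 0" using F0 by (intro sum.neutral) auto
  qed
  also have "\<dots> = integral\<^sup>L lborel (\<lambda>x. (- 1 / 2) *\<^sub>R (indicator (img c) x *\<^sub>R (\<Sum>i\<in>UNIV. pderiv_at i (G i) x)))"
  proof (rule Bochner_Integration.integral_cong[OF refl])
    fix x
    show "indicator (img c) x *\<^sub>R (sqrt (det (h c x)) *\<^sub>R ?S (param c x))
      = (- 1 / 2) *\<^sub>R (indicator (img c) x *\<^sub>R (\<Sum>i\<in>UNIV. pderiv_at i (G i) x))"
    proof (cases "x \<in> img c")
      case True
      have "(\<Sum>j\<le>N. 2 * ?co j * of_real (fps_nth (?w x) (N - j)) * ?u j x) = 2 * (sqrt (det (h c x)) *\<^sub>R ?S (param c x))"
        unfolding scaleR_conv_of_real sum_distrib_left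
      proof (intro sum.cong refl)
        fix j assume "j \<in> {..N}"
        then have "N - j \<le> m" "admissible CARD('n) j" using ad m(2) by auto
        then show "2 * ?co j * of_real (fps_nth (?w x) (N - j)) * ?u j x
           = 2 * (complex_of_real (sqrt (det (h c x))) * (?co j * ?F j (param c x)))"
          by simp
      qed
      with G(3)[OF True] have "2 * (sqrt (det (h c x)) *\<^sub>R ?S (param c x)) + (\<Sum>i\<in>UNIV. pderiv_at i (G i) x) = 0" by simp
      then have e: "(\<Sum>i\<in>UNIV. pderiv_at i (G i) x) = - (2 * (sqrt (det (h c x)) *\<^sub>R ?S (param c x)))"
        by (simp add: eq_neg_iff_add_eq_0 add.commute)
      show ?thesis unfolding e using True by (simp add: scaleR_conv_of_real)
    qed simp
  qed
  also have "\<dots> = 0"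
  proof -
    have "integral\<^sup>L lborel (\<lambda>x. indicator (img c) x *\<^sub>R (\<Sum>i\<in>UNIV. pderiv_at i (G i) x)) = 0"
      by (rule integral_divergence_zero[OF U G(1) K(1,2)]) (rule G0)
    then show ?thesis by (simp only: integral_scaleR_right scaleR_zero_right)
  qed
  finally show ?thesis .
qed

lemma poles_mono: "j \<le> k \<Longrightarrow> poles CARD('n) j \<subseteq> poles CARD('n) k"
  by (force simp: poles_def)

lemma pole_isolated:
  assumes "lam0 \<in> poles CARD('n) i" "lam \<in> poles CARD('n) j" "dist lam lam0 < 1" shows "lam = lam0"
proof -
  obtain a b :: nat where ab: "lam0 = of_nat CARD('n) / 2 - of_nat a" "lam = of_nat CARD('n) / 2 - of_nat b"
    using assms by (auto simp: poles_def)
  have "lam - lam0 = of_int (int a - int b)" using ab by simp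
  then have "\<bar>int a - int b\<bar> < 1"
    using assms(3) by (simp only: dist_norm norm_of_int)
  then show ?thesis using ab by simp
qed

text \<open>By rationality of \<open>T\<^sub>2\<^sub>j\<close>, its dependence on \<open>lam\<close> can be taken out of the integral.\<close>

lemma integral_rational:
  assumes f: "smooth_fun A f" and K: "compact K" "K \<subseteq> img c" "\<And>p. p \<notin> param c ` K \<Longrightarrow> f p = 0"
    and j: "j \<le> N"
  shows "\<exists>R. (\<forall>lam. lam \<notin> poles CARD('n) j \<longrightarrow> isCont R lam \<and>
      (\<integral>p. T j lam f p * complex_of_real (v (N - j) p) \<partial>\<mu>) = R lam)"
proof -
  have ad: "admissible CARD('n) j" using j m(2) admissible_le by simp
  then have "rational_diff_operator A (poles CARD('n) j) (T j)" using so by (simp add: solution_operators_def)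
  then obtain q d B where B: "\<And>z. poly q z = 0 \<Longrightarrow> z \<in> poles CARD('n) j" "\<And>k. diff_operator A (B k)"
    "\<And>lam x. lam \<notin> poles CARD('n) j \<Longrightarrow> T j lam f x = (\<Sum>k\<le>(d::nat). lam^k * B k f x) / poly q lam"
    by (rule rational_diff_operatorE[OF _ f]) (rule that)
  have Kc: "closed (param c ` K)" using compact_param_image[OF A c K(1,2)] by (rule compact_imp_closed)
  let ?F = "\<lambda>k p. B k f p * complex_of_real (v (N - j) p)"
  have int: "integrable \<mu> (?F k)" for k
  proof (rule integrable_compact_chart[OF _ K(1,2)])
    have "smooth_on (img c) (\<lambda>x. (B k f \<circ> param c) x * complex_of_real ((v (N - j) \<circ> param c) x))"
      using m(2) by (intro smooth_on_mult U smooth_on_of_real diff_operator_smooth[OF A B(2) f c] v_smooth) auto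
    from C1_on_continuous[OF smooth_on_imp_C1_on[OF U this]]
    show "continuous_on (img c) (?F k \<circ> param c)" by (simp add: o_def)
    show "?F k p = 0" if "p \<notin> param c ` K" for p
      using diff_operator_local[OF A B(2) f Kc K(3) that] by simp
  qed
  let ?R = "\<lambda>lam. (\<Sum>k\<le>d. lam^k * integral\<^sup>L \<mu> (?F k)) / poly q lam"
  have "(\<integral>p. T j lam f p * complex_of_real (v (N - j) p) \<partial>\<mu>) = ?R lam" if "lam \<notin> poles CARD('n) j" for lam
  proof -
    have "(\<lambda>p. T j lam f p * complex_of_real (v (N - j) p)) = (\<lambda>p. (\<Sum>k\<le>d. lam^k * ?F k p) / poly q lam)"
      by (auto simp: B(3)[OF that] sum_distrib_right mult.assoc)
    then show ?thesis using int by (simp add: Bochner_Integration.integral_sum)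
  qed
  moreover have "isCont ?R lam" if "lam \<notin> poles CARD('n) j" for lam
    using B(1)[of lam] that by (intro continuous_intros) auto
  ultimately show ?thesis by blast
qed

text \<open>If \<open>lam0\<close> is a pole of some operator of index above \<open>N\<close>, then no other point at distance less than one from it is
a pole. So the identity holds on a punctured neighbourhood, and at \<open>lam0\<close> by continuity.\<close>

lemma test_identity:
  assumes f: "smooth_fun A f" and K: "compact K" "K \<subseteq> img c" "\<And>p. p \<notin> param c ` K \<Longrightarrow> f p = 0"
    and lam0: "lam0 \<notin> poles CARD('n) N"
  shows "(\<Sum>j\<le>N. (lam0 * of_nat N + of_nat j * (lam0 - of_nat CARD('n) + 2 * of_nat N)) *
      (\<integral>p. T j lam0 f p * complex_of_real (v (N - j) p) \<partial>\<mu>)) = 0"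
proof (cases "\<forall>j. admissible CARD('n) j \<longrightarrow> lam0 \<notin> poles CARD('n) j")
  case True
  then show ?thesis using generic_identity[OF f K] by blast
next
  case False
  then obtain i where i: "lam0 \<in> poles CARD('n) i" by blast
  have "\<forall>j. \<exists>R. j \<le> N \<longrightarrow> (\<forall>lam. lam \<notin> poles CARD('n) j \<longrightarrow> isCont R lam \<and>
      (\<integral>p. T j lam f p * complex_of_real (v (N - j) p) \<partial>\<mu>) = R lam)"
    using integral_rational[OF f K] by blast
  then obtain R where R: "\<And>j lam. j \<le> N \<Longrightarrow> lam \<notin> poles CARD('n) j \<Longrightarrow> isCont (R j) lam"
    "\<And>j lam. j \<le> N \<Longrightarrow> lam \<notin> poles CARD('n) j \<Longrightarrow> (\<integral>p. T j lam f p * complex_of_real (v (N - j) p) \<partial>\<mu>) = R j lam"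
    by metis
  define I where "I lam = (\<Sum>j\<le>N. (lam * of_nat N + of_nat j * (lam - of_nat CARD('n) + 2 * of_nat N)) * R j lam)" for lam
  have pN: "lam \<notin> poles CARD('n) j" if "j \<le> N" "lam \<notin> poles CARD('n) N" for j lam
    using poles_mono[OF that(1)] that(2) by blast
  have "isCont I lam0"
    unfolding I_def using R(1) pN[OF _ lam0] by (intro continuous_intros) auto
  then have "(I \<longlongrightarrow> I lam0) (at lam0)" by (simp add: isCont_def)
  moreover have "\<forall>\<^sub>F lam in at lam0. I lam = 0"
    unfolding eventually_at
  proof (intro exI[of _ 1] conjI ballI impI)
    fix lam assume lam: "lam \<noteq> lam0 \<and> dist lam lam0 < 1"
    have g: "lam \<notin> poles CARD('n) j" for j using pole_isolated[OF i] lam by blast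
    have "I lam = (\<Sum>j\<le>N. (lam * of_nat N + of_nat j * (lam - of_nat CARD('n) + 2 * of_nat N)) *
        (\<integral>p. T j lam f p * complex_of_real (v (N - j) p) \<partial>\<mu>))"
      unfolding I_def using R(2) g by (intro sum.cong) auto
    also have "\<dots> = 0" by (rule generic_identity[OF f K g])
    finally show "I lam = 0" .
  qed simp
  ultimately have "((\<lambda>_. 0) \<longlongrightarrow> I lam0) (at lam0)" by (rule Lim_transform_eventually)
  then have "I lam0 = 0" by (simp add: tendsto_const_iff)
  then show ?thesis unfolding I_def using R(2) pN[OF _ lam0] by simp
qed

text \<open>Otherwise the real part of \<open>cnj (g p) g\<close> is positive near \<open>p\<close>, and so is its integral against a bump
supported there.\<close>

lemma vanishing_from_bumps:
  fixes g :: "'a \<Rightarrow> complex"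
  assumes g: "continuous_on (img c) (g \<circ> param c)" and p: "p \<in> dom_of c"
    and int0: "\<And>x0 e. e > 0 \<Longrightarrow> cball x0 e \<subseteq> img c \<Longrightarrow> (\<integral>q. bump c x0 e q * g q \<partial>\<mu>) = 0"
  shows "g p = 0"
proof (rule ccontr)
  assume g0: "g p \<noteq> 0"
  define x0 where "x0 = coord c p"
  have x0: "x0 \<in> img c" "param c x0 = p"
    using chart_inverse(1)[OF A c p] coord_in_img[OF p] by (auto simp: x0_def)
  \<comment> \<open>Rotating by \<open>cnj (g p)\<close> makes the value at \<open>p\<close> positive real.\<close>
  define k where "k x = Re (cnj (g p) * g (param c x))" for x
  have k: "continuous_on (img c) k"
    unfolding k_def using g by (intro continuous_intros) (simp add: o_def)
  have "k x0 > 0" using g0 x0(2) by (simp add: k_def complex_mult_cnj cmod_power2[symmetric] mult.commute[of "cnj _"])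
  have "open (img c \<inter> k -` {0<..})" by (rule continuous_open_preimage[OF k U]) simp
  then obtain e where e: "e > 0" "cball x0 e \<subseteq> img c \<inter> k -` {0<..}"
    using \<open>k x0 > 0\<close> x0(1) open_contains_cball by (metis IntI greaterThan_iff vimageI2)
  then have e': "cball x0 e \<subseteq> img c" by blast
  let ?b = "\<lambda>x. flat_fun 1 (e\<^sup>2 - (dist x x0)\<^sup>2)"
  let ?F = "\<lambda>q. bump c x0 e q * g q"
  have Fc: "continuous_on (img c) (?F \<circ> param c)"
  proof -
    have "smooth_on (img c) (bump c x0 e \<circ> param c)"
      using bump_smooth[OF A c e(1) e'] c by (simp add: smooth_fun_def)
    from C1_on_continuous[OF smooth_on_imp_C1_on[OF U this]]
    have "continuous_on (img c) (\<lambda>x. (bump c x0 e \<circ> param c) x * (g \<circ> param c) x)"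
      by (intro continuous_on_mult g)
    then show ?thesis by (simp add: o_def)
  qed
  have F0: "?F q = 0" if "q \<notin> param c ` cball x0 e" for q
    using bump_param_outside[OF A c that e(1)] by simp
  have F0': "?F q = 0" if "q \<notin> dom_of c" for q
    using that by (simp add: bump_def)
  let ?J = "\<lambda>x. indicator (img c) x *\<^sub>R (sqrt (det (h c x)) *\<^sub>R ?F (param c x))"
  have J: "integrable lborel ?J" "integral\<^sup>L lborel ?J = 0"
    using chart_integrable_compact(2)[OF A c \<mu> sqrt_det_h Fc compact_cball e' F0]
      chart_integral(1)[OF A c \<mu> sqrt_det_h Fc F0'] int0[OF e(1) e'] by simp_all
  let ?R = "\<lambda>x. indicator (img c) x * sqrt (det (h c x)) * ?b x * k x"
  have JR: "Re (cnj (g p) * ?J x) = ?R x" for x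
  proof (cases "x \<in> img c")
    case True
    have "cnj (g p) * ?J x = complex_of_real (sqrt (det (h c x)) * ?b x) * (cnj (g p) * g (param c x))"
      using True bump_param[OF A c True, of x0 e] by (simp add: scaleR_conv_of_real)
    then have "Re (cnj (g p) * ?J x) = (sqrt (det (h c x)) * ?b x) * k x"
      unfolding k_def by (simp only: scaleR_conv_of_real[symmetric] scaleR_complex.sel)
    then show ?thesis using True by simp
  qed simp
  have "integrable lborel (\<lambda>x. Re (cnj (g p) * ?J x))"
    using J(1) by (intro integrable_Re integrable_mult_right) auto
  then have R1: "integrable lborel ?R" unfolding JR .
  have gen: "integral\<^sup>L lborel (\<lambda>x. Re (z * F x)) = Re (z * integral\<^sup>L lborel F)"
    if "integrable lborel F" for F :: "real^'n \<Rightarrow> complex" and z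
    using that integral_Re[of lborel "\<lambda>x. z * F x"] by simp
  have "integral\<^sup>L lborel (\<lambda>x. Re (cnj (g p) * ?J x)) = Re (cnj (g p) * integral\<^sup>L lborel ?J)"
    by (rule gen[OF J(1)])
  then have R2: "integral\<^sup>L lborel ?R = 0" unfolding JR J(2) by simp
  have b0: "?b x \<ge> 0" for x by (simp add: flat_fun_def)
  have Rpos: "?R x \<ge> 0" for x
  proof (cases "x \<in> cball x0 e")
    case True
    then have "k x > 0" "x \<in> img c" using e(2) by auto
    then show ?thesis using b0[of x] det_h_pos[of x] by simp
  next
    case False
    then have "(dist x x0)\<^sup>2 > e\<^sup>2" using e(1) by (intro power_strict_mono) (auto simp: dist_commute)
    then show ?thesis by (simp add: flat_fun_def)
  qed
  have "AE x in lborel. ?R x = 0"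
    using integral_nonneg_eq_0_iff_AE[OF R1] Rpos R2 by simp
  moreover have "?R x \<noteq> 0" if "x \<in> ball x0 e" for x
  proof -
    have "x \<in> cball x0 e" using that by simp
    then have "k x > 0" "x \<in> img c" using e(2) by auto
    moreover have "(dist x x0)\<^sup>2 < e\<^sup>2" using that by (intro power_strict_mono) (auto simp: dist_commute)
    then have "?b x > 0" by (simp add: flat_fun_def)
    ultimately show ?thesis using det_h_pos[of x] by simp
  qed
  ultimately have "AE x in lborel. x \<notin> ball x0 e" by (auto elim!: eventually_mono)
  then have "ball x0 e \<in> null_sets lborel" by (simp add: AE_iff_null_sets)
  then have "measure lborel (ball x0 e) = 0" by (simp add: measure_def null_setsD1)
  then show False using content_ball_pos[OF e(1), of x0] by simp
qed

end

theorem theorem2p1: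
  fixes A :: "('a::{t2_space,second_countable_topology}, 'n::finite) chart set"
    and h hlog :: "('a, 'n) tensor2"
    and hk :: "nat \<Rightarrow> ('a, 'n) tensor2"
    and v :: "nat \<Rightarrow> 'a \<Rightarrow> real"
    and T Tadj :: "nat \<Rightarrow> complex \<Rightarrow> ('a \<Rightarrow> complex) \<Rightarrow> ('a \<Rightarrow> complex)"
    and \<mu> :: "'a measure"
    and n N :: nat
  assumes "smooth_atlas A" and "riemannian_metric A h"
    and "n = CARD('n)" and "n \<ge> 2"
    and "poincare_einstein A h hk hlog"
    and "holographic_coeffs A h hk hlog v"
    and "solution_operators A hk hlog T"
    and "riemannian_volume A h \<mu>"
    and "\<And>j lam. admissible n j \<Longrightarrow> lam \<notin> poles n j \<Longrightarrow> formal_adjoint A \<mu> (T j lam) (Tadj j lam)"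
    and "1 \<le> N" and "even n \<Longrightarrow> real N \<le> real n / 2"
  shows "\<forall>lam. lam \<notin> poles n N \<longrightarrow> (\<forall>x.
      lam * of_nat N * (\<Sum>j\<le>N. Tadj j lam (\<lambda>y. complex_of_real (v (N - j) y)) x)
      + (lam - of_nat n + 2 * of_nat N) *
          (\<Sum>j\<le>N. of_nat j * Tadj j lam (\<lambda>y. complex_of_real (v (N - j) y)) x) = 0)"
proof (intro allI impI)
  fix lam p assume lam: "lam \<notin> poles n N"
  obtain c where cp: "c \<in> A" "p \<in> dom_of c" using chart_cover[OF assms(1)] by blast
  interpret poincare_einstein_chart A h hlog hk v T \<mu> N "truncation_order CARD('n) N" c
    using assms cp(1) by unfold_locales auto
  have adm: "admissible n j" if "j \<le> N" for j
    using that m(2) admissible_le[of j] assms(3) by simp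
  have pol: "lam \<notin> poles n j" if "j \<le> N" for j
    using poles_mono[OF that] lam assms(3) by blast
  let ?v = "\<lambda>j y. complex_of_real (v (N - j) y)"
  let ?co = "\<lambda>j. lam * of_nat N + of_nat j * (lam - of_nat n + 2 * of_nat N)"
  have v: "smooth_fun A (?v j)" for j
  proof -
    have "N - j \<le> truncation_order CARD('n) N" using m(2) by simp
    then have "smooth_fun A (v (N - j))"
      using assms(6) admissible_le by (auto simp: holographic_coeffs_def)
    then have "smooth_on (img c) (\<lambda>x. complex_of_real ((v (N - j) \<circ> param c) x))" if "c \<in> A" for c
      using that by (intro smooth_on_of_real chart_open(2)[OF assms(1)]) (auto simp only: smooth_fun_def)
    then show ?thesis unfolding smooth_fun_def by (simp add: o_def)
  qed
  have adj: "smooth_fun A (Tadj j lam (?v j))"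
    "smooth_fun A f \<Longrightarrow> compactly_supported f \<Longrightarrow>
      (\<integral>x. T j lam f x * ?v j x \<partial>\<mu>) = (\<integral>x. f x * Tadj j lam (?v j) x \<partial>\<mu>)" if "j \<le> N" for j f
    using assms(9)[OF adm[OF that] pol[OF that]] v unfolding formal_adjoint_def by blast+
  let ?g = "\<lambda>q. \<Sum>j\<le>N. ?co j * Tadj j lam (?v j) q"
  have Tc: "continuous_on (img c) (Tadj j lam (?v j) \<circ> param c)" if "j \<le> N" for j
    using adj(1)[OF that] cp(1) unfolding smooth_fun_def
    by (intro C1_on_continuous smooth_on_imp_C1_on U) (rule bspec)
  have "?g p = 0"
  proof (rule vanishing_from_bumps[OF _ cp(2)])
    have "continuous_on (img c) (\<lambda>x. \<Sum>j\<le>N. ?co j * (Tadj j lam (?v j) \<circ> param c) x)"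
      by (rule continuous_on_sum, rule continuous_on_mult[OF continuous_on_const Tc]) simp
    then show "continuous_on (img c) (?g \<circ> param c)" by (simp add: o_def)
    fix x0 and e :: real assume e: "e > 0" "cball x0 e \<subseteq> img c"
    let ?f = "bump c x0 e"
    have f: "smooth_fun A ?f" "compactly_supported ?f"
      using bump_smooth[OF assms(1) cp(1) e] bump_compactly_supported[OF assms(1) cp(1) e] by auto
    have f0: "?f q = 0" if "q \<notin> param c ` cball x0 e" for q
      using bump_param_outside[OF assms(1) cp(1) that e(1)] .
    have int: "integrable \<mu> (\<lambda>q. ?f q * Tadj j lam (?v j) q)" if "j \<le> N" for j
    proof (rule integrable_compact_chart[OF _ compact_cball e(2)])
      have "continuous_on (img c) (?f \<circ> param c)"
        using f(1) cp(1) unfolding smooth_fun_def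
        by (intro C1_on_continuous smooth_on_imp_C1_on U) (rule bspec)
      then have "continuous_on (img c) (\<lambda>x. (?f \<circ> param c) x * (Tadj j lam (?v j) \<circ> param c) x)"
        by (intro continuous_on_mult Tc[OF that])
      then show "continuous_on (img c) ((\<lambda>q. ?f q * Tadj j lam (?v j) q) \<circ> param c)" by (simp add: o_def)
    qed (use f0 in auto)
    have "(\<integral>q. ?f q * ?g q \<partial>\<mu>) = (\<integral>q. (\<Sum>j\<le>N. ?co j * (?f q * Tadj j lam (?v j) q)) \<partial>\<mu>)"
      by (intro Bochner_Integration.integral_cong refl) (simp add: sum_distrib_left algebra_simps)
    also have "\<dots> = (\<Sum>j\<le>N. ?co j * (\<integral>q. ?f q * Tadj j lam (?v j) q \<partial>\<mu>))"
      using int by (subst Bochner_Integration.integral_sum) auto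
    also have "\<dots> = (\<Sum>j\<le>N. ?co j * (\<integral>q. T j lam ?f q * ?v j q \<partial>\<mu>))"
      using adj(2)[OF _ f] by (intro sum.cong) auto
    also have "\<dots> = 0"
      using test_identity[OF f(1) compact_cball e(2) f0, of lam] lam assms(3) by simp
    finally show "(\<integral>q. ?f q * ?g q \<partial>\<mu>) = 0" .
  qed
  then show "lam * of_nat N * (\<Sum>j\<le>N. Tadj j lam (?v j) p)
      + (lam - of_nat n + 2 * of_nat N) * (\<Sum>j\<le>N. of_nat j * Tadj j lam (?v j) p) = 0"
    unfolding sum_distrib_left sum.distrib[symmetric] by (simp only: distrib_right mult.assoc mult.left_commute)
qed

end
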